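(* Let $M$ be a semi-invariant submanifold of a normal complex contact metric manifold $\bar M$, with invariant distribution $\mathcal D$, and let $\mathbf h$ be the second fundamental form of $M$ in $\bar M$. Then the distribution $\mathcal D\oplus sp\{\bar U,\bar V\}$ on $M$ is involutive if and only if $$\mathbf h(K,\bar GL)=\mathbf h(\bar GK,L)\quad\text{for all }K,L\in\Gamma(\mathcal D).$$
   Context: Complex contact metric manifolds. A complex contact manifold is a complex manifold $\bar M$ of complex dimension $2m+1$ with an open cover by coordinate neighborhoods $\mathcal U_i$ and holomorphic $1$-forms $\omega_i$ on $\mathcal U_i$ with $\omega_i\wedge(d\omega_i)^m\neq 0$ on $\mathcal U_i$ and $\omega_i=f_{ij}\omega_j$ on $\mathcal U_i\cap\mathcal U_j\ne\emptyset$ with $f_{ij}$ holomorphic. The kernels of the $\omega_i$ define the horizontal subbundle $\mathcal H\subset T\bar M$. Let $\bar J$ be the complex structure and $\bar g$ a Hermitian metric. A complex almost contact metric structure consists, on each $\mathcal U_i$ (index suppressed), of real $1$-forms $\bar u$, $\bar v=\bar u\circ \bar J$, with dual unit vector fields $\bar U$, $\bar V=-\bar J\bar U$, and $(1,1)$-tensor fields $\bar G$, $\bar H=\bar G\bar J$ such that $\bar G^2=\bar H^2=-I+\bar u\otimes\bar U+\bar v\otimes\bar V$, $\bar G\bar J=-\bar J\bar G$, $\bar G\bar U=0$, $\bar g(K,\bar GL)=-\bar g(\bar GK,L)$; on overlaps $u_j=cu_i-dv_i$, $v_j=du_i+cv_i$, $G_j=cG_i-dH_i$, $H_j=dG_i+cH_i$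 for functions $c,d$ with $c^2+d^2=1$. Let $\bar\nabla$ be the Levi-Civita connection of $\bar g$ and $\bar\sigma(K)=\bar g(\bar\nabla_K\bar U,\bar V)$. $\bar M$ is a complex contact metric manifold if moreover $\mathcal H=\ker\bar u\cap\ker\bar v$ and $d\bar u(K,L)=\bar g(K,\bar GL)+(\bar\sigma\wedge\bar v)(K,L)$, $d\bar v(K,L)=\bar g(K,\bar HL)-(\bar\sigma\wedge\bar u)(K,L)$ (conventions $2d\alpha(K,L)=K\alpha(L)-L\alpha(K)-\alpha([K,L])$ and $2(\alpha\wedge\beta)(K,L)=\alpha(K)\beta(L)-\alpha(L)\beta(K)$). Normality (Korkmaz). For a $(1,1)$-tensor $F$ put $[F,F](K,L)=(\bar\nabla_{FK}F)L-(\bar\nabla_{FL}F)K-F(\bar\nabla_KF)L+F(\bar\nabla_LF)K$. Define $S(K,L)=[\bar G,\bar G](K,L)+2\bar g(K,\bar GL)\bar U-2\bar g(K,\bar HL)\bar V+2(\bar v(L)\bar HK-\bar v(K)\bar HL)+\bar\sigma(\bar GL)\bar HK-\bar\sigma(\bar GK)\bar HL+\bar\sigma(K)\bar G\bar HL-\bar\sigma(L)\bar G\bar HK$, $T(K,L)=[\bar H,\bar H](K,L)-2\bar g(K,\bar GL)\bar U+2\bar g(K,\bar HL)\bar V+2(\bar u(L)\bar GK-\bar u(K)\bar GL)+\bar\sigma(\bar HK)\bar GL-\bar\sigma(\bar HL)\bar GK+\bar\sigma(K)\bar G\bar HL-\bar\sigma(L)\bar G\bar HK$. $\bar M$ is normal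 if $S(K,L)=T(K,L)=0$ for all $K,L\in\mathcal H$ and $S(K,\bar U)=T(K,\bar V)=0$ for all $K$. Semi-invariant submanifolds. Let $M$ be a complex submanifold of the normal complex contact metric manifold $\bar M$ (real dimension $4m+2$), of real dimension $n+2$, with $\bar U,\bar V$ tangent to $M$. $M$ is semi-invariant if there are smooth distributions $\mathcal D,\mathcal D^{\bot}$ on $M$, orthogonal to $sp\{\bar U,\bar V\}$ (the span of $\bar U,\bar V$), with $TM=\mathcal D\oplus\mathcal D^{\bot}\oplus sp\{\bar U,\bar V\}$ (orthogonal sum), $\bar G\mathcal D=\mathcal D$, $\bar H\mathcal D=\mathcal D$, $\bar G\mathcal D^{\bot}\subset TM^{\bot}$, $\bar H\mathcal D^{\bot}\subset TM^{\bot}$, where $TM^\bot$ is the normal bundle. $\mathcal D$ is called the invariant and $\mathcal D^{\bot}$ the anti-invariant distribution. The second fundamental form is defined by $\bar\nabla_KL=\nabla_KL+\mathbf h(K,L)$ for $K,L\in\Gamma(TM)$, with $\nabla$ the induced connection on $M$ and $\mathbf h(K,L)$ normal to $M$. *)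

theory Defs
  imports "HOL-Analysis.Analysis"
begin

section \<open>Smooth and holomorphic maps on open subsets of Euclidean spaces\<close>

text \<open>The sets on which these notions are used are always open.\<close>

primrec Ck_on :: "nat \<Rightarrow> 'a set \<Rightarrow> ('a::real_normed_vector \<Rightarrow> 'b::real_normed_vector) \<Rightarrow> bool" where
  "Ck_on 0 S f \<longleftrightarrow> continuous_on S f"
| "Ck_on (Suc k) S f \<longleftrightarrow> (\<forall>x\<in>S. f differentiable (at x)) \<and>
     (\<forall>v. Ck_on k S (\<lambda>x. frechet_derivative f (at x) v))"

definition Cinf_on :: "'a set \<Rightarrow> ('a::real_normed_vector \<Rightarrow> 'b::real_normed_vector) \<Rightarrow> bool" where
  "Cinf_on S f \<longleftrightarrow> (\<forall>k. Ck_on k S f)"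

text \<open>A function of several complex variables is holomorphic if it is smooth and satisfies the
  Cauchy-Riemann equations, i.e. its real derivative is complex linear.  (Smoothness already
  follows from complex differentiability; it is part of the definition for convenience.)\<close>

definition holo_on :: "(complex^'k::finite) set \<Rightarrow> (complex^'k \<Rightarrow> complex) \<Rightarrow> bool" where
  "holo_on S f \<longleftrightarrow> Cinf_on S f \<and>
     (\<forall>x\<in>S. \<forall>v. frechet_derivative f (at x) (\<i> *s v) = \<i> * frechet_derivative f (at x) v)"


section \<open>Complex manifolds\<close>

text \<open>The points of the manifold are the elements of a Hausdorff, second countable type \<open>'m\<close>;
  its complex dimension is \<open>CARD('k)\<close>.  A chart is a pair of its domain and its coordinate map,
  whose values outside the domain are irrelevant.\<close>

type_synonym ('m, 'k) chart = "'m set \<times> ('m \<Rightarrow> complex^'k)"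

definition chart_inv :: "('m, 'k::finite) chart \<Rightarrow> complex^'k \<Rightarrow> 'm" where
  "chart_inv c = inv_into (fst c) (snd c)"

definition transition :: "('m, 'k::finite) chart \<Rightarrow> ('m, 'k) chart \<Rightarrow> complex^'k \<Rightarrow> complex^'k" where
  "transition c c' x = snd c' (chart_inv c x)"

definition complex_atlas ::
  "('m::{t2_space,second_countable_topology}, 'k::finite) chart set \<Rightarrow> bool" where
  "complex_atlas A \<longleftrightarrow>
     (\<forall>c\<in>A. open (fst c) \<and> open (snd c ` fst c) \<and>
        homeomorphism (fst c) (snd c ` fst c) (snd c) (chart_inv c)) \<and>
     (\<Union>c\<in>A. fst c) = UNIV \<and>
     (\<forall>c\<in>A. \<forall>c'\<in>A. \<forall>j. holo_on (snd c ` (fst c \<inter> fst c')) (\<lambda>x. transition c c' x $ j))"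

text \<open>A chart of the maximal atlas determined by \<open>A\<close>.\<close>

definition compatible_chart ::
  "('m::{t2_space,second_countable_topology}, 'k::finite) chart set \<Rightarrow> ('m, 'k) chart \<Rightarrow> bool" where
  "compatible_chart A c \<longleftrightarrow> complex_atlas (insert c A)"

definition coordinate_nbhd ::
  "('m::{t2_space,second_countable_topology}, 'k::finite) chart set \<Rightarrow> 'm set \<Rightarrow> bool" where
  "coordinate_nbhd A W \<longleftrightarrow> (\<exists>\<phi>. compatible_chart A (W, \<phi>))"

text \<open>Once and for all a chart \<open>chart_at A p\<close> around each point \<open>p\<close> is chosen, and the real tangent
  space at \<open>p\<close> is identified with \<open>complex^'k\<close>, regarded as a real vector space, by means of this
  chart.  A vector field is thus a function \<open>'m \<Rightarrow> complex^'k\<close>, and a tensor at \<open>p\<close> is a multilinear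
  map on \<open>complex^'k\<close>.  \<open>to_chart A c p\<close> converts a tangent vector at \<open>p\<close> into its components with
  respect to the chart \<open>c\<close>, and \<open>from_chart A c p\<close> is the inverse conversion.\<close>

definition chart_at :: "('m, 'k::finite) chart set \<Rightarrow> 'm \<Rightarrow> ('m, 'k) chart" where
  "chart_at A p = (SOME c. c \<in> A \<and> p \<in> fst c)"

definition to_chart ::
  "('m, 'k::finite) chart set \<Rightarrow> ('m, 'k) chart \<Rightarrow> 'm \<Rightarrow> complex^'k \<Rightarrow> complex^'k" where
  "to_chart A c p = frechet_derivative (transition (chart_at A p) c) (at (snd (chart_at A p) p))"

definition from_chart ::
  "('m, 'k::finite) chart set \<Rightarrow> ('m, 'k) chart \<Rightarrow> 'm \<Rightarrow> complex^'k \<Rightarrow> complex^'k" where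
  "from_chart A c p = frechet_derivative (transition c (chart_at A p)) (at (snd c p))"

text \<open>The complex structure of the manifold; as the transition maps are holomorphic, it is
  multiplication by the imaginary unit in every chart.\<close>

definition Jc :: "complex^'k::finite \<Rightarrow> complex^'k" where
  "Jc v = \<i> *s v"

definition smooth_fun ::
  "('m, 'k::finite) chart set \<Rightarrow> 'm set \<Rightarrow> ('m \<Rightarrow> 'b::real_normed_vector) \<Rightarrow> bool" where
  "smooth_fun A W f \<longleftrightarrow> (\<forall>c\<in>A. Cinf_on (snd c ` (fst c \<inter> W)) (\<lambda>x. f (chart_inv c x)))"

definition holo_fun :: "('m, 'k::finite) chart set \<Rightarrow> 'm set \<Rightarrow> ('m \<Rightarrow> complex) \<Rightarrow> bool" where
  "holo_fun A W f \<longleftrightarrow> (\<forall>c\<in>A. holo_on (snd c ` (fst c \<inter> W)) (\<lambda>x. f (chart_inv c x)))"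

definition vf_rep ::
  "('m, 'k::finite) chart set \<Rightarrow> ('m, 'k) chart \<Rightarrow> ('m \<Rightarrow> complex^'k) \<Rightarrow> complex^'k \<Rightarrow> complex^'k" where
  "vf_rep A c X x = to_chart A c (chart_inv c x) (X (chart_inv c x))"

definition smooth_vf :: "('m, 'k::finite) chart set \<Rightarrow> 'm set \<Rightarrow> ('m \<Rightarrow> complex^'k) \<Rightarrow> bool" where
  "smooth_vf A W X \<longleftrightarrow> (\<forall>c\<in>A. Cinf_on (snd c ` (fst c \<inter> W)) (vf_rep A c X))"

definition dir_deriv ::
  "('m, 'k::finite) chart set \<Rightarrow> ('m \<Rightarrow> 'b::real_normed_vector) \<Rightarrow> 'm \<Rightarrow> complex^'k \<Rightarrow> 'b" where
  "dir_deriv A f p v =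
     frechet_derivative (\<lambda>x. f (chart_inv (chart_at A p) x)) (at (snd (chart_at A p) p)) v"

definition lie_bracket ::
  "('m, 'k::finite) chart set \<Rightarrow> ('m \<Rightarrow> complex^'k) \<Rightarrow> ('m \<Rightarrow> complex^'k) \<Rightarrow> 'm \<Rightarrow> complex^'k" where
  "lie_bracket A X Y p =
     frechet_derivative (vf_rep A (chart_at A p) Y) (at (snd (chart_at A p) p)) (X p) -
     frechet_derivative (vf_rep A (chart_at A p) X) (at (snd (chart_at A p) p)) (Y p)"

text \<open>Smoothness of 1-forms and of (1,1)-tensor fields is tested on smooth vector fields.\<close>

definition smooth_one_form ::
  "('m::topological_space, 'k::finite) chart set \<Rightarrow> 'm set \<Rightarrow> ('m \<Rightarrow> complex^'k \<Rightarrow> real) \<Rightarrow> bool" where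
  "smooth_one_form A W \<alpha> \<longleftrightarrow> (\<forall>p\<in>W. linear (\<alpha> p)) \<and>
     (\<forall>W' X. open W' \<and> W' \<subseteq> W \<and> smooth_vf A W' X \<longrightarrow> smooth_fun A W' (\<lambda>p. \<alpha> p (X p)))"

definition smooth_endo ::
  "('m::topological_space, 'k::finite) chart set \<Rightarrow> 'm set \<Rightarrow>
   ('m \<Rightarrow> complex^'k \<Rightarrow> complex^'k) \<Rightarrow> bool" where
  "smooth_endo A W F \<longleftrightarrow> (\<forall>p\<in>W. linear (F p)) \<and>
     (\<forall>W' X. open W' \<and> W' \<subseteq> W \<and> smooth_vf A W' X \<longrightarrow> smooth_vf A W' (\<lambda>p. F p (X p)))"

text \<open>Holomorphic 1-forms: of type (1,0), with holomorphic coefficients in every chart.  They are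
  evaluated on real tangent vectors.\<close>

definition holo_one_form ::
  "('m, 'k::finite) chart set \<Rightarrow> 'm set \<Rightarrow> ('m \<Rightarrow> complex^'k \<Rightarrow> complex) \<Rightarrow> bool" where
  "holo_one_form A W \<omega> \<longleftrightarrow>
     (\<forall>p\<in>W. linear (\<omega> p) \<and> (\<forall>v. \<omega> p (Jc v) = \<i> * \<omega> p v)) \<and>
     (\<forall>c\<in>A. \<forall>v. holo_on (snd c ` (fst c \<inter> W))
        (\<lambda>x. \<omega> (chart_inv c x) (from_chart A c (chart_inv c x) v)))"

text \<open>Conventions: \<open>2 d\<alpha>(K,L) = K \<alpha>(L) - L \<alpha>(K) - \<alpha>([K,L])\<close> and
  \<open>2 (\<alpha> \<and> \<beta>)(x,y) = \<alpha>(x) \<beta>(y) - \<alpha>(y) \<beta>(x)\<close>.\<close>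

definition ext_d ::
  "('m, 'k::finite) chart set \<Rightarrow> ('m \<Rightarrow> complex^'k \<Rightarrow> 'b::real_normed_vector) \<Rightarrow>
   ('m \<Rightarrow> complex^'k) \<Rightarrow> ('m \<Rightarrow> complex^'k) \<Rightarrow> 'm \<Rightarrow> 'b" where
  "ext_d A \<alpha> K L p =
     (dir_deriv A (\<lambda>q. \<alpha> q (L q)) p (K p) - dir_deriv A (\<lambda>q. \<alpha> q (K q)) p (L p)
       - \<alpha> p (lie_bracket A K L p)) /\<^sub>R 2"

definition wedge :: "('v \<Rightarrow> real) \<Rightarrow> ('v \<Rightarrow> real) \<Rightarrow> 'v \<Rightarrow> 'v \<Rightarrow> real" where
  "wedge \<alpha> \<beta> x y = (\<alpha> x * \<beta> y - \<alpha> y * \<beta> x) / 2"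

text \<open>The value of \<open>\<omega> \<and> (d\<omega>)\<^sup>m\<close> on the vector fields \<open>K 0, \<dots>, K (2 * m)\<close>, where, as for two
  1-forms, a wedge product is the full antisymmetrisation of the tensor product.\<close>

definition contact_volume ::
  "('m, 'k::finite) chart set \<Rightarrow> nat \<Rightarrow> ('m \<Rightarrow> complex^'k \<Rightarrow> complex) \<Rightarrow>
   (nat \<Rightarrow> 'm \<Rightarrow> complex^'k) \<Rightarrow> 'm \<Rightarrow> complex" where
  "contact_volume A m \<omega> K p =
     (\<Sum>\<pi> | \<pi> permutes {..2 * m}. of_int (sign \<pi>) * \<omega> p (K (\<pi> 0) p) *
        (\<Prod>j<m. ext_d A \<omega> (K (\<pi> (2 * j + 1))) (K (\<pi> (2 * j + 2))) p)) / fact (2 * m + 1)"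


section \<open>Riemannian notions\<close>

definition hermitian_metric ::
  "('m::topological_space, 'k::finite) chart set \<Rightarrow>
   ('m \<Rightarrow> complex^'k \<Rightarrow> complex^'k \<Rightarrow> real) \<Rightarrow> bool" where
  "hermitian_metric A g \<longleftrightarrow>
     (\<forall>p. bilinear (g p) \<and> (\<forall>v w. g p v w = g p w v) \<and> (\<forall>v. v \<noteq> 0 \<longrightarrow> g p v v > 0) \<and>
        (\<forall>v w. g p (Jc v) (Jc w) = g p v w)) \<and>
     (\<forall>W X Y. open W \<and> smooth_vf A W X \<and> smooth_vf A W Y \<longrightarrow>
        smooth_fun A W (\<lambda>p. g p (X p) (Y p)))"

text \<open>\<open>nabla p v Y\<close> is the covariant derivative at \<open>p\<close>, in the direction of the tangent vector \<open>v\<close>,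
  of a vector field \<open>Y\<close> that is smooth near \<open>p\<close>.\<close>

type_synonym ('m, 'k) conn = "'m \<Rightarrow> complex^'k \<Rightarrow> ('m \<Rightarrow> complex^'k) \<Rightarrow> complex^'k"

definition affine_connection ::
  "('m::topological_space, 'k::finite) chart set \<Rightarrow> ('m, 'k) conn \<Rightarrow> bool" where
  "affine_connection A nabla \<longleftrightarrow>
     (\<forall>W Y. open W \<and> smooth_vf A W Y \<longrightarrow>
        (\<forall>p\<in>W. linear (\<lambda>v. nabla p v Y)) \<and>
        (\<forall>X. smooth_vf A W X \<longrightarrow> smooth_vf A W (\<lambda>p. nabla p (X p) Y)) \<and>
        (\<forall>Z. smooth_vf A W Z \<longrightarrow>
           (\<forall>p\<in>W. \<forall>v. nabla p v (\<lambda>q. Y q + Z q) = nabla p v Y + nabla p v Z)) \<and>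
        (\<forall>f :: 'm \<Rightarrow> real. smooth_fun A W f \<longrightarrow>
           (\<forall>p\<in>W. \<forall>v. nabla p v (\<lambda>q. f q *\<^sub>R Y q) =
              dir_deriv A f p v *\<^sub>R Y p + f p *\<^sub>R nabla p v Y)))"

definition levi_civita ::
  "('m::topological_space, 'k::finite) chart set \<Rightarrow>
   ('m \<Rightarrow> complex^'k \<Rightarrow> complex^'k \<Rightarrow> real) \<Rightarrow> ('m, 'k) conn \<Rightarrow> bool" where
  "levi_civita A g nabla \<longleftrightarrow> affine_connection A nabla \<and>
     (\<forall>W X Y. open W \<and> smooth_vf A W X \<and> smooth_vf A W Y \<longrightarrow> (\<forall>p\<in>W.
        nabla p (X p) Y - nabla p (Y p) X = lie_bracket A X Y p \<and>
        (\<forall>v. dir_deriv A (\<lambda>q. g q (X q) (Y q)) p v =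
           g p (nabla p v X) (Y p) + g p (X p) (nabla p v Y))))"

text \<open>The value at \<open>p\<close> of \<open>(\<nabla>\<^bsub>v\<^esub> F) L\<close> for a (1,1)-tensor field \<open>F\<close>, and \<open>[F,F](K,L)\<close>.\<close>

definition cov_endo ::
  "('m, 'k::finite) conn \<Rightarrow> ('m \<Rightarrow> complex^'k \<Rightarrow> complex^'k) \<Rightarrow>
   'm \<Rightarrow> complex^'k \<Rightarrow> ('m \<Rightarrow> complex^'k) \<Rightarrow> complex^'k" where
  "cov_endo nabla F p v L = nabla p v (\<lambda>q. F q (L q)) - F p (nabla p v L)"

definition nijenhuis ::
  "('m, 'k::finite) conn \<Rightarrow> ('m \<Rightarrow> complex^'k \<Rightarrow> complex^'k) \<Rightarrow>
   ('m \<Rightarrow> complex^'k) \<Rightarrow> ('m \<Rightarrow> complex^'k) \<Rightarrow> 'm \<Rightarrow> complex^'k" where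
  "nijenhuis nabla F K L p =
     cov_endo nabla F p (F p (K p)) L - cov_endo nabla F p (F p (L p)) K
     - F p (cov_endo nabla F p (K p) L) + F p (cov_endo nabla F p (L p) K)"


section \<open>Normal complex contact metric manifolds\<close>

text \<open>\<open>N i\<close> is the coordinate neighbourhood with index \<open>i \<in> I\<close>, and \<open>\<omega> i\<close> the holomorphic 1-form
  on it.\<close>

definition complex_contact_manifold ::
  "('m::{t2_space,second_countable_topology}, 'k::finite) chart set \<Rightarrow> nat \<Rightarrow>
   'i set \<Rightarrow> ('i \<Rightarrow> 'm set) \<Rightarrow> ('i \<Rightarrow> 'm \<Rightarrow> complex^'k \<Rightarrow> complex) \<Rightarrow> bool" where
  "complex_contact_manifold A m I N \<omega> \<longleftrightarrow>
     complex_atlas A \<and> CARD('k) = 2 * m + 1 \<and>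
     (\<Union>i\<in>I. N i) = UNIV \<and>
     (\<forall>i\<in>I. coordinate_nbhd A (N i) \<and> holo_one_form A (N i) (\<omega> i) \<and>
        (\<forall>p\<in>N i. \<exists>K. (\<forall>j\<le>2 * m. smooth_vf A (N i) (K j)) \<and> contact_volume A m (\<omega> i) K p \<noteq> 0)) \<and>
     (\<forall>i\<in>I. \<forall>j\<in>I. N i \<inter> N j \<noteq> {} \<longrightarrow>
        (\<exists>f. holo_fun A (N i \<inter> N j) f \<and>
           (\<forall>p\<in>N i \<inter> N j. \<forall>v. \<omega> i p v = f p * \<omega> j p v)))"

text \<open>The objects \<open>v = u \<circ> J\<close>, \<open>V = - J U\<close>, \<open>H = G J\<close> are determined by \<open>u\<close>, \<open>U\<close> and \<open>G\<close>.\<close>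

definition v_of :: "('m \<Rightarrow> complex^'k::finite \<Rightarrow> real) \<Rightarrow> 'm \<Rightarrow> complex^'k \<Rightarrow> real" where
  "v_of u p x = u p (Jc x)"

definition V_of :: "('m \<Rightarrow> complex^'k::finite) \<Rightarrow> 'm \<Rightarrow> complex^'k" where
  "V_of U p = - Jc (U p)"

definition H_of :: "('m \<Rightarrow> complex^'k::finite \<Rightarrow> complex^'k) \<Rightarrow> 'm \<Rightarrow> complex^'k \<Rightarrow> complex^'k" where
  "H_of G p x = G p (Jc x)"

definition complex_almost_contact_metric ::
  "('m::topological_space, 'k::finite) chart set \<Rightarrow> 'i set \<Rightarrow> ('i \<Rightarrow> 'm set) \<Rightarrow>
   ('m \<Rightarrow> complex^'k \<Rightarrow> complex^'k \<Rightarrow> real) \<Rightarrow> ('i \<Rightarrow> 'm \<Rightarrow> complex^'k \<Rightarrow> real) \<Rightarrow>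
   ('i \<Rightarrow> 'm \<Rightarrow> complex^'k) \<Rightarrow> ('i \<Rightarrow> 'm \<Rightarrow> complex^'k \<Rightarrow> complex^'k) \<Rightarrow> bool" where
  "complex_almost_contact_metric A I N g u U G \<longleftrightarrow>
     hermitian_metric A g \<and>
     (\<forall>i\<in>I. smooth_one_form A (N i) (u i) \<and> smooth_vf A (N i) (U i) \<and> smooth_endo A (N i) (G i) \<and>
        (\<forall>p\<in>N i.
           g p (U i p) (U i p) = 1 \<and> (\<forall>x. u i p x = g p x (U i p)) \<and>
           (\<forall>x. G i p (G i p x) = - x + u i p x *\<^sub>R U i p + v_of (u i) p x *\<^sub>R V_of (U i) p) \<and>
           (\<forall>x. H_of (G i) p (H_of (G i) p x) =
                  - x + u i p x *\<^sub>R U i p + v_of (u i) p x *\<^sub>R V_of (U i) p) \<and>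
           (\<forall>x. G i p (Jc x) = - Jc (G i p x)) \<and>
           G i p (U i p) = 0 \<and>
           (\<forall>x y. g p x (G i p y) = - g p (G i p x) y))) \<and>
     (\<forall>i\<in>I. \<forall>j\<in>I. \<exists>c d :: 'm \<Rightarrow> real. \<forall>p\<in>N i \<inter> N j.
        (c p)\<^sup>2 + (d p)\<^sup>2 = 1 \<and>
        (\<forall>x. u j p x = c p * u i p x - d p * v_of (u i) p x) \<and>
        (\<forall>x. v_of (u j) p x = d p * u i p x + c p * v_of (u i) p x) \<and>
        (\<forall>x. G j p x = c p *\<^sub>R G i p x - d p *\<^sub>R H_of (G i) p x) \<and>
        (\<forall>x. H_of (G j) p x = d p *\<^sub>R G i p x + c p *\<^sub>R H_of (G i) p x))"

definition sigma_of ::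
  "('m \<Rightarrow> complex^'k::finite \<Rightarrow> complex^'k \<Rightarrow> real) \<Rightarrow> ('m, 'k) conn \<Rightarrow> ('m \<Rightarrow> complex^'k) \<Rightarrow>
   'm \<Rightarrow> complex^'k \<Rightarrow> real" where
  "sigma_of g nabla U p x = g p (nabla p x U) (V_of U p)"

definition complex_contact_metric_manifold ::
  "('m::{t2_space,second_countable_topology}, 'k::finite) chart set \<Rightarrow> nat \<Rightarrow>
   'i set \<Rightarrow> ('i \<Rightarrow> 'm set) \<Rightarrow> ('i \<Rightarrow> 'm \<Rightarrow> complex^'k \<Rightarrow> complex) \<Rightarrow>
   ('m \<Rightarrow> complex^'k \<Rightarrow> complex^'k \<Rightarrow> real) \<Rightarrow> ('m, 'k) conn \<Rightarrow> ('i \<Rightarrow> 'm \<Rightarrow> complex^'k \<Rightarrow> real) \<Rightarrow>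
   ('i \<Rightarrow> 'm \<Rightarrow> complex^'k) \<Rightarrow> ('i \<Rightarrow> 'm \<Rightarrow> complex^'k \<Rightarrow> complex^'k) \<Rightarrow> bool" where
  "complex_contact_metric_manifold A m I N \<omega> g nabla u U G \<longleftrightarrow>
     complex_contact_manifold A m I N \<omega> \<and>
     complex_almost_contact_metric A I N g u U G \<and>
     levi_civita A g nabla \<and>
     (\<forall>i\<in>I. \<forall>p\<in>N i. {x. \<omega> i p x = 0} = {x. u i p x = 0 \<and> v_of (u i) p x = 0}) \<and>
     (\<forall>i\<in>I. \<forall>W K L. open W \<and> W \<subseteq> N i \<and> smooth_vf A W K \<and> smooth_vf A W L \<longrightarrow> (\<forall>p\<in>W.
        ext_d A (u i) K L p = g p (K p) (G i p (L p)) +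
          wedge (sigma_of g nabla (U i) p) (v_of (u i) p) (K p) (L p) \<and>
        ext_d A (v_of (u i)) K L p = g p (K p) (H_of (G i) p (L p)) -
          wedge (sigma_of g nabla (U i) p) (u i p) (K p) (L p)))"

text \<open>Korkmaz' tensors \<open>S\<close> and \<open>T\<close> for the local tensors \<open>u\<close>, \<open>U\<close>, \<open>G\<close> on one neighbourhood.\<close>

definition S_tensor ::
  "('m \<Rightarrow> complex^'k::finite \<Rightarrow> complex^'k \<Rightarrow> real) \<Rightarrow> ('m, 'k) conn \<Rightarrow> ('m \<Rightarrow> complex^'k \<Rightarrow> real) \<Rightarrow>
   ('m \<Rightarrow> complex^'k) \<Rightarrow> ('m \<Rightarrow> complex^'k \<Rightarrow> complex^'k) \<Rightarrow>
   ('m \<Rightarrow> complex^'k) \<Rightarrow> ('m \<Rightarrow> complex^'k) \<Rightarrow> 'm \<Rightarrow> complex^'k" where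
  "S_tensor g nabla u U G K L p =
    (let H = H_of G; V = V_of U; v = v_of u; \<sigma> = sigma_of g nabla U in
       nijenhuis nabla G K L p
       + (2 * g p (K p) (G p (L p))) *\<^sub>R U p - (2 * g p (K p) (H p (L p))) *\<^sub>R V p
       + 2 *\<^sub>R (v p (L p) *\<^sub>R H p (K p) - v p (K p) *\<^sub>R H p (L p))
       + \<sigma> p (G p (L p)) *\<^sub>R H p (K p) - \<sigma> p (G p (K p)) *\<^sub>R H p (L p)
       + \<sigma> p (K p) *\<^sub>R G p (H p (L p)) - \<sigma> p (L p) *\<^sub>R G p (H p (K p)))"

definition T_tensor ::
  "('m \<Rightarrow> complex^'k::finite \<Rightarrow> complex^'k \<Rightarrow> real) \<Rightarrow> ('m, 'k) conn \<Rightarrow> ('m \<Rightarrow> complex^'k \<Rightarrow> real) \<Rightarrow>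
   ('m \<Rightarrow> complex^'k) \<Rightarrow> ('m \<Rightarrow> complex^'k \<Rightarrow> complex^'k) \<Rightarrow>
   ('m \<Rightarrow> complex^'k) \<Rightarrow> ('m \<Rightarrow> complex^'k) \<Rightarrow> 'm \<Rightarrow> complex^'k" where
  "T_tensor g nabla u U G K L p =
    (let H = H_of G; V = V_of U; \<sigma> = sigma_of g nabla U in
       nijenhuis nabla H K L p
       - (2 * g p (K p) (G p (L p))) *\<^sub>R U p + (2 * g p (K p) (H p (L p))) *\<^sub>R V p
       + 2 *\<^sub>R (u p (L p) *\<^sub>R G p (K p) - u p (K p) *\<^sub>R G p (L p))
       + \<sigma> p (H p (K p)) *\<^sub>R G p (L p) - \<sigma> p (H p (L p)) *\<^sub>R G p (K p)
       + \<sigma> p (K p) *\<^sub>R G p (H p (L p)) - \<sigma> p (L p) *\<^sub>R G p (H p (K p)))"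

definition normal_complex_contact_metric_manifold ::
  "('m::{t2_space,second_countable_topology}, 'k::finite) chart set \<Rightarrow> nat \<Rightarrow>
   'i set \<Rightarrow> ('i \<Rightarrow> 'm set) \<Rightarrow> ('i \<Rightarrow> 'm \<Rightarrow> complex^'k \<Rightarrow> complex) \<Rightarrow>
   ('m \<Rightarrow> complex^'k \<Rightarrow> complex^'k \<Rightarrow> real) \<Rightarrow> ('m, 'k) conn \<Rightarrow> ('i \<Rightarrow> 'm \<Rightarrow> complex^'k \<Rightarrow> real) \<Rightarrow>
   ('i \<Rightarrow> 'm \<Rightarrow> complex^'k) \<Rightarrow> ('i \<Rightarrow> 'm \<Rightarrow> complex^'k \<Rightarrow> complex^'k) \<Rightarrow> bool" where
  "normal_complex_contact_metric_manifold A m I N \<omega> g nabla u U G \<longleftrightarrow>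
     complex_contact_metric_manifold A m I N \<omega> g nabla u U G \<and>
     (\<forall>i\<in>I. \<forall>W K. open W \<and> W \<subseteq> N i \<and> smooth_vf A W K \<longrightarrow>
        (\<forall>L. smooth_vf A W L \<and> (\<forall>p\<in>W. \<omega> i p (K p) = 0 \<and> \<omega> i p (L p) = 0) \<longrightarrow>
           (\<forall>p\<in>W. S_tensor g nabla (u i) (U i) (G i) K L p = 0 \<and>
                   T_tensor g nabla (u i) (U i) (G i) K L p = 0)) \<and>
        (\<forall>p\<in>W. S_tensor g nabla (u i) (U i) (G i) K (U i) p = 0 \<and>
                T_tensor g nabla (u i) (U i) (G i) K (V_of (U i)) p = 0))"


section \<open>Submanifolds\<close>

text \<open>A submanifold \<open>M\<close> is given by its manifold topology \<open>T\<close>, a topology on the subset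
  \<open>topspace T\<close> of the ambient manifold.  Around every point of \<open>M\<close> there is a chart \<open>(W, \<phi>)\<close> of the
  ambient manifold such that a slice of \<open>W\<close> is open in \<open>M\<close> and carries the topology of the ambient
  manifold.  For embedded submanifolds, \<open>T\<close> is the subspace topology; in general it is finer (as
  for a dense leaf of a foliation).  The parameter \<open>d\<close> is the real dimension of \<open>M\<close>; note that
  \<open>subspace\<close> and \<open>dim\<close> refer to \<open>complex^'k\<close> as a real vector space.\<close>

definition complex_submanifold ::
  "('m::{t2_space,second_countable_topology}, 'k::finite) chart set \<Rightarrow> 'm topology \<Rightarrow> nat \<Rightarrow> bool" where
  "complex_submanifold A T d \<longleftrightarrow>
     second_countable T \<and>
     (\<forall>p\<in>topspace T. \<exists>W \<phi> E P. compatible_chart A (W, \<phi>) \<and> p \<in> W \<and>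
        subspace E \<and> (\<forall>x\<in>E. Jc x \<in> E) \<and> dim E = d \<and>
        P = {q \<in> W. \<phi> q \<in> E} \<and> p \<in> P \<and>
        openin T P \<and> subtopology T P = top_of_set P)"

text \<open>Velocities at \<open>p\<close> of the curves in \<open>M\<close>.\<close>

definition tangent_space :: "('m, 'k::finite) chart set \<Rightarrow> 'm topology \<Rightarrow> 'm \<Rightarrow> (complex^'k) set" where
  "tangent_space A T p = {v. \<exists>\<gamma> :: real \<Rightarrow> 'm. \<exists>\<epsilon>>0.
     continuous_map (top_of_set {-\<epsilon><..<\<epsilon>}) T \<gamma> \<and> \<gamma> 0 = p \<and>
     ((\<lambda>t. snd (chart_at A p) (\<gamma> t)) has_vector_derivative v) (at 0)}"

definition normal_vectors ::
  "('m, 'k::finite) chart set \<Rightarrow> 'm topology \<Rightarrow> ('m \<Rightarrow> complex^'k \<Rightarrow> complex^'k \<Rightarrow> real) \<Rightarrow>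
   'm \<Rightarrow> (complex^'k) set" where
  "normal_vectors A T g p = {w. \<forall>v\<in>tangent_space A T p. g p w v = 0}"

text \<open>\<open>Y\<close> is smooth on a neighbourhood of \<open>p\<close> in the ambient manifold and coincides with \<open>X\<close> on a
  neighbourhood of \<open>p\<close> in \<open>M\<close>.  The smooth fields along \<open>M\<close> are those with such local extensions.\<close>

definition local_extension ::
  "('m::topological_space, 'k::finite) chart set \<Rightarrow> 'm topology \<Rightarrow> 'm \<Rightarrow>
   ('m \<Rightarrow> complex^'k) \<Rightarrow> ('m \<Rightarrow> complex^'k) \<Rightarrow> bool" where
  "local_extension A T p X Y \<longleftrightarrow>
     (\<exists>W P. open W \<and> smooth_vf A W Y \<and> openin T P \<and> p \<in> P \<and> P \<subseteq> W \<and> (\<forall>q\<in>P. Y q = X q))"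

definition some_extension ::
  "('m::topological_space, 'k::finite) chart set \<Rightarrow> 'm topology \<Rightarrow> 'm \<Rightarrow>
   ('m \<Rightarrow> complex^'k) \<Rightarrow> ('m \<Rightarrow> complex^'k)" where
  "some_extension A T p X = (SOME Y. local_extension A T p X Y)"

text \<open>\<open>\<Gamma>(\<Delta>)\<close> over the subset \<open>P\<close> of \<open>M\<close>.  The values of a section outside \<open>P\<close> are irrelevant.\<close>

definition sections ::
  "('m::topological_space, 'k::finite) chart set \<Rightarrow> 'm topology \<Rightarrow> 'm set \<Rightarrow>
   ('m \<Rightarrow> (complex^'k) set) \<Rightarrow> ('m \<Rightarrow> complex^'k) set" where
  "sections A T P \<Delta> = {X. \<forall>p\<in>P. X p \<in> \<Delta> p \<and> (\<exists>Y. local_extension A T p X Y)}"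

definition smooth_distribution ::
  "('m::topological_space, 'k::finite) chart set \<Rightarrow> 'm topology \<Rightarrow> ('m \<Rightarrow> (complex^'k) set) \<Rightarrow> bool" where
  "smooth_distribution A T \<Delta> \<longleftrightarrow>
     (\<forall>p\<in>topspace T. subspace (\<Delta> p) \<and> \<Delta> p \<subseteq> tangent_space A T p \<and>
        (\<exists>P r. \<exists>X :: nat \<Rightarrow> 'm \<Rightarrow> complex^'k. openin T P \<and> p \<in> P \<and>
           (\<forall>j<r. X j \<in> sections A T P \<Delta>) \<and>
           (\<forall>q\<in>P. inj_on (\<lambda>j. X j q) {..<r} \<and> independent ((\<lambda>j. X j q) ` {..<r}) \<and>
                   span ((\<lambda>j. X j q) ` {..<r}) = \<Delta> q)))"

text \<open>The bracket at \<open>p\<close> of vector fields on \<open>M\<close>, and the second fundamental form, which is the normal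
  component of the ambient covariant derivative.  Neither depends on the extensions chosen.\<close>

definition bracket_on ::
  "('m::topological_space, 'k::finite) chart set \<Rightarrow> 'm topology \<Rightarrow>
   ('m \<Rightarrow> complex^'k) \<Rightarrow> ('m \<Rightarrow> complex^'k) \<Rightarrow> 'm \<Rightarrow> complex^'k" where
  "bracket_on A T K L p = lie_bracket A (some_extension A T p K) (some_extension A T p L) p"

definition involutive ::
  "('m::topological_space, 'k::finite) chart set \<Rightarrow> 'm topology \<Rightarrow> ('m \<Rightarrow> (complex^'k) set) \<Rightarrow> bool" where
  "involutive A T \<Delta> \<longleftrightarrow>
     (\<forall>K\<in>sections A T (topspace T) \<Delta>. \<forall>L\<in>sections A T (topspace T) \<Delta>.
        \<forall>p\<in>topspace T. bracket_on A T K L p \<in> \<Delta> p)"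

definition second_ff ::
  "('m::topological_space, 'k::finite) chart set \<Rightarrow> 'm topology \<Rightarrow>
   ('m \<Rightarrow> complex^'k \<Rightarrow> complex^'k \<Rightarrow> real) \<Rightarrow> ('m, 'k) conn \<Rightarrow>
   ('m \<Rightarrow> complex^'k) \<Rightarrow> ('m \<Rightarrow> complex^'k) \<Rightarrow> 'm \<Rightarrow> complex^'k" where
  "second_ff A T g nabla K L p =
     (THE z. z \<in> normal_vectors A T g p \<and>
             nabla p (K p) (some_extension A T p L) - z \<in> tangent_space A T p)"


section \<open>Semi-invariant submanifolds\<close>

text \<open>\<open>sp{U,V}\<close>: on overlaps of neighbourhoods the local fields span the same plane.\<close>

definition UV_span ::
  "'i set \<Rightarrow> ('i \<Rightarrow> 'm set) \<Rightarrow> ('i \<Rightarrow> 'm \<Rightarrow> complex^'k::finite) \<Rightarrow> 'm \<Rightarrow> (complex^'k) set" where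
  "UV_span I N U p = span {w. \<exists>i\<in>I. p \<in> N i \<and> (w = U i p \<or> w = V_of (U i) p)}"

definition dist_sum ::
  "('m \<Rightarrow> 'v::ab_group_add set) \<Rightarrow> ('m \<Rightarrow> 'v set) \<Rightarrow> 'm \<Rightarrow> 'v set" where
  "dist_sum \<Delta> \<Delta>' p = {x + y | x y. x \<in> \<Delta> p \<and> y \<in> \<Delta>' p}"

definition orthogonal_dists ::
  "'m topology \<Rightarrow> ('m \<Rightarrow> 'v \<Rightarrow> 'v \<Rightarrow> real) \<Rightarrow> ('m \<Rightarrow> 'v set) \<Rightarrow> ('m \<Rightarrow> 'v set) \<Rightarrow> bool" where
  "orthogonal_dists T g \<Delta> \<Delta>' \<longleftrightarrow> (\<forall>p\<in>topspace T. \<forall>x\<in>\<Delta> p. \<forall>y\<in>\<Delta>' p. g p x y = 0)"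

text \<open>\<open>D\<close> is the invariant and \<open>D'\<close> the anti-invariant distribution.\<close>

definition semi_invariant_submanifold ::
  "('m::{t2_space,second_countable_topology}, 'k::finite) chart set \<Rightarrow> 'i set \<Rightarrow> ('i \<Rightarrow> 'm set) \<Rightarrow>
   ('m \<Rightarrow> complex^'k \<Rightarrow> complex^'k \<Rightarrow> real) \<Rightarrow> ('i \<Rightarrow> 'm \<Rightarrow> complex^'k) \<Rightarrow>
   ('i \<Rightarrow> 'm \<Rightarrow> complex^'k \<Rightarrow> complex^'k) \<Rightarrow> 'm topology \<Rightarrow> nat \<Rightarrow>
   ('m \<Rightarrow> (complex^'k) set) \<Rightarrow> ('m \<Rightarrow> (complex^'k) set) \<Rightarrow> bool" where
  "semi_invariant_submanifold A I N g U G T n D D' \<longleftrightarrow>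
     complex_submanifold A T (n + 2) \<and>
     (\<forall>i\<in>I. \<forall>p\<in>topspace T \<inter> N i.
        U i p \<in> tangent_space A T p \<and> V_of (U i) p \<in> tangent_space A T p) \<and>
     smooth_distribution A T D \<and> smooth_distribution A T D' \<and>
     orthogonal_dists T g D D' \<and>
     orthogonal_dists T g D (UV_span I N U) \<and> orthogonal_dists T g D' (UV_span I N U) \<and>
     (\<forall>p\<in>topspace T. tangent_space A T p = dist_sum (dist_sum D D') (UV_span I N U) p) \<and>
     (\<forall>i\<in>I. \<forall>p\<in>topspace T \<inter> N i.
        G i p ` D p = D p \<and> H_of (G i) p ` D p = D p \<and>
        G i p ` D' p \<subseteq> normal_vectors A T g p \<and> H_of (G i) p ` D' p \<subseteq> normal_vectors A T g p)"

end

theory Submission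
  imports Defs
begin

text \<open>Let \<open>h\<close> be the second fundamental form, \<open>\<nabla>\<close> the Levi-Civita connection and \<open>K, L\<close> sections of
  the invariant distribution \<open>D\<close>.  Torsion-freeness gives that \<open>h(K, GL) - h(GK, L)\<close> is the normal part of
  \<open>(\<nabla>\<^sub>K G)L - (\<nabla>\<^sub>L G)K + G[K, L]\<close>.  On horizontal vectors normality and \<open>d(du) = 0\<close> force
  \<open>(\<nabla>\<^sub>K G)L = \<sigma>(K) HL\<close> modulo \<open>U, V\<close>, so the first two terms are tangent; what remains is \<open>G\<close> applied to the anti-invariant
  component of \<open>[K, L]\<close>, and \<open>G\<close> is injective there.  Hence the condition on \<open>h\<close> says that brackets of
  sections of \<open>D\<close> have no anti-invariant component.  Brackets with \<open>U\<close> and \<open>V\<close> never have one: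
  \<open>S(K, U) = 0\<close> reads \<open>G[GK, U] = G\<^sup>2[K, U] - \<sigma>(U) GHK\<close>, and pairing with the normal vector \<open>Gz\<close>
  for \<open>z\<close> anti-invariant annihilates the right-hand side; \<open>T(K, V) = 0\<close> does the same for \<open>V\<close>.\<close>

section \<open>Calculus of smooth maps\<close>

text \<open>Sections of \<open>D\<close> live on M only, and the extensions entering brackets and
  covariant derivatives are arbitrary: off M they need be neither tangent nor horizontal. Normality,
  however, speaks of fields horizontal on an open set of the ambient manifold. Two facts bridge the
  gap: \<open>(\<nabla>G)Y\<close> is tensorial in \<open>Y\<close>, and derivatives in directions
  tangent to M see only the restriction to M.

  The formula for \<open>\<nabla>G\<close> results from the defect
  \<open>Om(x,y,z) = g((\<nabla>_x G)y - \<sigma>(x)Hy, z)\<close>, which is skew in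
  \<open>y\<close>, \<open>z\<close>. Subtracting the \<open>\<sigma>\<close> term makes both
  \<open>S = 0\<close> and \<open>d(du) = 0\<close> homogeneous linear identities for
  \<open>Om\<close> on horizontal vectors, and linear algebra gives \<open>Om = 0\<close>.

  A section \<open>X\<close> of the sum of \<open>D\<close> and the vertical plane has the smooth
  \<open>D\<close>-component \<open>X - u(X)U - v(X)V\<close>. Expanding a bracket of two such
  sections, derivatives of the coefficients only multiply \<open>U\<close> and \<open>V\<close>;
  besides brackets with \<open>U\<close> and \<open>V\<close> there remains \<open>[V,U]\<close>,
  which is vertical by \<open>S(V,U) = 0\<close>.\<close>

lemma frechet_derivative_cong_open:
  assumes "open S" "x \<in> S" "\<And>y. y \<in> S \<Longrightarrow> f y = h y"
  shows "frechet_derivative f (at x) = frechet_derivative h (at x)"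
proof -
  have "(f has_derivative D) (at x) \<longleftrightarrow> (h has_derivative D) (at x)" for D
    using has_derivative_transform_within_open[OF _ assms(1,2)] assms(3) by metis
  then show ?thesis by (simp add: frechet_derivative_def)
qed

lemma differentiable_cong_open:
  assumes "open S" "x \<in> S" "\<And>y. y \<in> S \<Longrightarrow> f y = h y" "f differentiable (at x)"
  shows "h differentiable (at x)"
  using assms has_derivative_transform_within_open[OF _ assms(1,2)] unfolding differentiable_def by metis

lemma frechet_derivative_eqI:
  "(f has_derivative D) (at x) \<Longrightarrow> frechet_derivative f (at x) = D"
  using frechet_derivative_at by metis

lemma has_frechet_derivative:
  "f differentiable (at x) \<Longrightarrow> (f has_derivative frechet_derivative f (at x)) (at x)"
  by (simp add: frechet_derivative_works)

section \<open>Closure properties of smooth maps\<close>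

lemma Ck_on_cong:
  assumes "open S" "\<And>x. x \<in> S \<Longrightarrow> f x = h x" "Ck_on k S f"
  shows "Ck_on k S h"
  using assms(2,3)
proof (induction k arbitrary: f h)
  case 0
  then show ?case by (metis Ck_on.simps(1) continuous_on_cong)
next
  case (Suc k)
  have "h differentiable (at x)" if "x \<in> S" for x
    using differentiable_cong_open[OF assms(1) that] Suc.prems that by auto
  moreover have "Ck_on k S (\<lambda>x. frechet_derivative h (at x) v)" for v
    using Suc.prems Suc.IH[of "\<lambda>x. frechet_derivative f (at x) v"]
      frechet_derivative_cong_open[OF assms(1), of _ f h] by auto
  ultimately show ?case by simp
qed

lemma Ck_on_subset: "Ck_on k S f \<Longrightarrow> S' \<subseteq> S \<Longrightarrow> Ck_on k S' f"
  by (induction k arbitrary: f) (auto intro: continuous_on_subset)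

lemma Ck_on_SucD: "Ck_on (Suc k) S f \<Longrightarrow> Ck_on k S f"
proof (induction k arbitrary: f)
  case 0
  then show ?case
    by (auto intro!: continuous_at_imp_continuous_on differentiable_imp_continuous_within)
next
  case (Suc k)
  then show ?case by simp
qed

lemma Ck_on_const: "Ck_on k S (\<lambda>x. c)"
  by (induction k arbitrary: c) auto

lemma Ck_on_bounded_linear:
  assumes "open S" "bounded_linear h" "Ck_on k S f"
  shows "Ck_on k S (\<lambda>x. h (f x))"
  using assms(3)
proof (induction k arbitrary: f)
  case 0
  then show ?case using assms(2) by (auto intro: bounded_linear.continuous_on)
next
  case (Suc k)
  have D: "((\<lambda>x. h (f x)) has_derivative (\<lambda>v. h (frechet_derivative f (at x) v))) (at x)"
    if "x \<in> S" for x
    using bounded_linear.has_derivative[OF assms(2) has_frechet_derivative, of f x] Suc.prems that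
    by simp
  have "Ck_on k S (\<lambda>x. frechet_derivative (\<lambda>x. h (f x)) (at x) v)" for v
    by (rule Ck_on_cong[OF assms(1) _ Suc.IH[of "\<lambda>x. frechet_derivative f (at x) v"]])
      (use Suc.prems frechet_derivative_eqI[OF D] in auto)
  then show ?case using D by (auto simp: differentiable_def)
qed

lemma Ck_on_add:
  assumes "open S" "Ck_on k S f" "Ck_on k S h"
  shows "Ck_on k S (\<lambda>x. f x + h x)"
  using assms(2,3)
proof (induction k arbitrary: f h)
  case 0
  then show ?case by (auto intro: continuous_intros)
next
  case (Suc k)
  have D: "((\<lambda>x. f x + h x) has_derivative
      (\<lambda>v. frechet_derivative f (at x) v + frechet_derivative h (at x) v)) (at x)" if "x \<in> S" for x
    using Suc.prems that by (intro has_derivative_add has_frechet_derivative) auto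
  have "Ck_on k S (\<lambda>x. frechet_derivative (\<lambda>x. f x + h x) (at x) v)" for v
    by (rule Ck_on_cong[OF assms(1) _ Suc.IH[of "\<lambda>x. frechet_derivative f (at x) v"
      "\<lambda>x. frechet_derivative h (at x) v"]])
      (use Suc.prems frechet_derivative_eqI[OF D] in auto)
  then show ?case using D by (auto simp: differentiable_def)
qed

lemma Ck_on_scaleR:
  fixes f :: "'a::real_normed_vector \<Rightarrow> real"
  assumes "open S" "Ck_on k S f" "Ck_on k S h"
  shows "Ck_on k S (\<lambda>x. f x *\<^sub>R h x)"
  using assms(2,3)
proof (induction k arbitrary: f h)
  case 0
  then show ?case by (auto intro: continuous_intros)
next
  case (Suc k)
  have D: "((\<lambda>x. f x *\<^sub>R h x) has_derivative
      (\<lambda>v. f x *\<^sub>R frechet_derivative h (at x) v + frechet_derivative f (at x) v *\<^sub>R h x)) (at x)"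
    if "x \<in> S" for x
    using Suc.prems that by (intro has_derivative_scaleR has_frechet_derivative) auto
  have "Ck_on k S (\<lambda>x. frechet_derivative (\<lambda>x. f x *\<^sub>R h x) (at x) v)" for v
    by (rule Ck_on_cong[OF assms(1) _ Ck_on_add[OF assms(1)
        Suc.IH[of f "\<lambda>x. frechet_derivative h (at x) v"]
        Suc.IH[of "\<lambda>x. frechet_derivative f (at x) v" h]]])
      (use Suc.prems frechet_derivative_eqI[OF D] Ck_on_SucD in auto)
  then show ?case using D by (auto simp: differentiable_def)
qed

lemma Ck_on_sum:
  assumes "open S" "finite B" "\<And>b. b \<in> B \<Longrightarrow> Ck_on k S (f b)"
  shows "Ck_on k S (\<lambda>x. \<Sum>b\<in>B. f b x)"
  using assms(2,3)
  by (induction B rule: finite_induct) (auto intro: Ck_on_const Ck_on_add[OF assms(1)])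

lemma linear_euclidean_expand:
  fixes y :: "'a::euclidean_space"
  assumes "linear h"
  shows "h y = (\<Sum>b\<in>Basis. (y \<bullet> b) *\<^sub>R h b)"
  by (metis (mono_tags, lifting) assms euclidean_representation linear_scale linear_sum sum.cong)

lemma Ck_on_compose:
  fixes f :: "'a::real_normed_vector \<Rightarrow> 'b::euclidean_space"
  assumes "open S" "open S'" "Ck_on k S' h" "Ck_on k S f" "f ` S \<subseteq> S'"
  shows "Ck_on k S (\<lambda>x. h (f x))"
  using assms(3,4)
proof (induction k arbitrary: h)
  case 0
  then show ?case using assms(5) by (auto intro: continuous_on_compose2)
next
  case (Suc k)
  have D: "((\<lambda>x. h (f x)) has_derivative
      (\<lambda>v. frechet_derivative h (at (f x)) (frechet_derivative f (at x) v))) (at x)"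
    if "x \<in> S" for x
  proof -
    have "(f has_derivative frechet_derivative f (at x)) (at x)"
      "(h has_derivative frechet_derivative h (at (f x))) (at (f x))"
      using Suc.prems that assms(5) by (auto intro!: has_frechet_derivative)
    from has_derivative_compose[OF this] show ?thesis .
  qed
  have "Ck_on k S (\<lambda>x. frechet_derivative (\<lambda>x. h (f x)) (at x) v)" for v
  proof (rule Ck_on_cong[OF assms(1)])
    \<comment> \<open>\<open>Ck_on\<close> speaks of derivatives in a fixed direction, while the
      chain rule differentiates \<open>h\<close> in a direction that moves with \<open>x\<close>.
      Expanding that direction in the basis gives fixed directions with smooth scalar
      coefficients.\<close>
    show "Ck_on k S (\<lambda>x. \<Sum>b\<in>Basis. (frechet_derivative f (at x) v \<bullet> b) *\<^sub>R
        frechet_derivative h (at (f x)) b)"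
    proof (intro Ck_on_sum Ck_on_scaleR assms(1) finite_Basis)
      fix b :: 'b
      show "Ck_on k S (\<lambda>x. frechet_derivative f (at x) v \<bullet> b)"
        using Suc.prems(2) by (intro Ck_on_bounded_linear[OF assms(1) bounded_linear_inner_left]) simp
      show "Ck_on k S (\<lambda>x. frechet_derivative h (at (f x)) b)"
        by (rule Suc.IH[of "\<lambda>z. frechet_derivative h (at z) b"])
          (use Suc.prems(1) Ck_on_SucD[OF Suc.prems(2)] in auto)
    qed
    fix x assume x: "x \<in> S"
    have "linear (frechet_derivative h (at (f x)))"
      using Suc.prems x assms(5) by (auto intro!: linear_frechet_derivative)
    from linear_euclidean_expand[OF this, of "frechet_derivative f (at x) v"]
    show "(\<Sum>b\<in>Basis. (frechet_derivative f (at x) v \<bullet> b) *\<^sub>R frechet_derivative h (at (f x)) b)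
        = frechet_derivative (\<lambda>x. h (f x)) (at x) v"
      using frechet_derivative_eqI[OF D[OF x]] by simp
  qed
  then show ?case using D by (auto simp: differentiable_def)
qed

lemma Cinf_on_cong: "open S \<Longrightarrow> (\<And>x. x \<in> S \<Longrightarrow> f x = h x) \<Longrightarrow> Cinf_on S f \<Longrightarrow> Cinf_on S h"
  unfolding Cinf_on_def using Ck_on_cong by metis

lemma Cinf_on_subset: "Cinf_on S f \<Longrightarrow> S' \<subseteq> S \<Longrightarrow> Cinf_on S' f"
  unfolding Cinf_on_def using Ck_on_subset by metis

lemma Cinf_on_const: "Cinf_on S (\<lambda>x. c)"
  by (simp add: Cinf_on_def Ck_on_const)

lemma Cinf_on_bounded_linear:
  "open S \<Longrightarrow> bounded_linear h \<Longrightarrow> Cinf_on S f \<Longrightarrow> Cinf_on S (\<lambda>x. h (f x))"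
  by (simp add: Cinf_on_def Ck_on_bounded_linear)

lemma Cinf_on_add: "open S \<Longrightarrow> Cinf_on S f \<Longrightarrow> Cinf_on S h \<Longrightarrow> Cinf_on S (\<lambda>x. f x + h x)"
  by (simp add: Cinf_on_def Ck_on_add)

lemma Cinf_on_scaleR:
  fixes f :: "'a::real_normed_vector \<Rightarrow> real"
  shows "open S \<Longrightarrow> Cinf_on S f \<Longrightarrow> Cinf_on S h \<Longrightarrow> Cinf_on S (\<lambda>x. f x *\<^sub>R h x)"
  by (simp add: Cinf_on_def Ck_on_scaleR)

lemma Cinf_on_sum:
  "open S \<Longrightarrow> finite B \<Longrightarrow> (\<And>b. b \<in> B \<Longrightarrow> Cinf_on S (f b)) \<Longrightarrow> Cinf_on S (\<lambda>x. \<Sum>b\<in>B. f b x)"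
  by (simp add: Cinf_on_def Ck_on_sum)

lemma Cinf_on_compose:
  fixes f :: "'a::real_normed_vector \<Rightarrow> 'b::euclidean_space"
  shows "open S \<Longrightarrow> open S' \<Longrightarrow> Cinf_on S' h \<Longrightarrow> Cinf_on S f \<Longrightarrow> f ` S \<subseteq> S' \<Longrightarrow>
    Cinf_on S (\<lambda>x. h (f x))"
  unfolding Cinf_on_def using Ck_on_compose by metis

lemma Cinf_on_differentiable: "Cinf_on S f \<Longrightarrow> x \<in> S \<Longrightarrow> f differentiable (at x)"
  unfolding Cinf_on_def by (metis Ck_on.simps(2))

lemma Cinf_on_derivative: "Cinf_on S f \<Longrightarrow> Cinf_on S (\<lambda>x. frechet_derivative f (at x) v)"
  unfolding Cinf_on_def by (metis Ck_on.simps(2))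

lemma Cinf_on_continuous: "Cinf_on S f \<Longrightarrow> continuous_on S f"
  unfolding Cinf_on_def by (metis Ck_on.simps(1))

lemma Cinf_on_components:
  fixes f :: "'a::real_normed_vector \<Rightarrow> complex^'k::finite"
  assumes "open S" "\<And>j. Cinf_on S (\<lambda>x. f x $ j)"
  shows "Cinf_on S f"
proof (rule Cinf_on_cong[OF assms(1)])
  have "bounded_linear (axis j :: complex \<Rightarrow> complex^'k)" for j
    by (rule linear_conv_bounded_linear[THEN iffD1], rule linearI) (auto simp: axis_def vec_eq_iff)
  then show "Cinf_on S (\<lambda>x. \<Sum>j\<in>UNIV. axis j (f x $ j))"
    by (intro Cinf_on_sum assms(1) finite_UNIV Cinf_on_bounded_linear[where h = "axis _"] assms(2)) auto
  show "(\<Sum>j\<in>UNIV. axis j (f x $ j)) = f x" for x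
    by (simp add: vec_eq_iff axis_def)
qed

section \<open>Symmetry of second derivatives and differentiation along a field\<close>

lemma second_difference_mean_value:
  fixes F :: "'a::real_normed_vector \<Rightarrow> real"
  assumes h: "0 < h"
    and dF: "\<And>s t. 0 \<le> s \<Longrightarrow> s \<le> h \<Longrightarrow> 0 \<le> t \<Longrightarrow> t \<le> h \<Longrightarrow>
      F differentiable (at (x + s *\<^sub>R v + t *\<^sub>R w))"
    and ddF: "\<And>s t. 0 \<le> s \<Longrightarrow> s \<le> h \<Longrightarrow> 0 \<le> t \<Longrightarrow> t \<le> h \<Longrightarrow>
      (\<lambda>y. frechet_derivative F (at y) v) differentiable (at (x + s *\<^sub>R v + t *\<^sub>R w))"
  shows "\<exists>s t. 0 \<le> s \<and> s \<le> h \<and> 0 \<le> t \<and> t \<le> h \<and>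
    F (x + h *\<^sub>R v + h *\<^sub>R w) - F (x + h *\<^sub>R v) - F (x + h *\<^sub>R w) + F x =
    h * h * frechet_derivative (\<lambda>y. frechet_derivative F (at y) v)
      (at (x + s *\<^sub>R v + t *\<^sub>R w)) w"
proof -
  let ?D = "\<lambda>y. frechet_derivative F (at y) v"
  \<comment> \<open>The second difference is the increment over \<open>[0, h]\<close> of the first
    difference in direction \<open>w\<close>. The mean value theorem is applied to it, and then to
    the resulting increment of the \<open>v\<close>-derivative.\<close>
  define \<phi> where "\<phi> s = F (x + s *\<^sub>R v + h *\<^sub>R w) - F (x + s *\<^sub>R v)" for s
  have line: "((\<lambda>s. k (a + s *\<^sub>R b)) has_field_derivative frechet_derivative k (at (a + s *\<^sub>R b)) b) (at s)"
    if "k differentiable (at (a + s *\<^sub>R b))" for k :: "'a \<Rightarrow> real" and a b s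
  proof -
    have "((\<lambda>s. a + s *\<^sub>R b) has_derivative (\<lambda>t. t *\<^sub>R b)) (at s)"
      by (auto intro!: derivative_eq_intros)
    from has_derivative_compose[OF this has_frechet_derivative[OF that]]
    have "((\<lambda>s. k (a + s *\<^sub>R b)) has_derivative
        (\<lambda>t. frechet_derivative k (at (a + s *\<^sub>R b)) (t *\<^sub>R b))) (at s)" .
    then show ?thesis
      by (simp add: has_field_derivative_def linear_scale[OF linear_frechet_derivative[OF that]]
          mult_commute_abs)
  qed
  have d1: "(\<phi> has_field_derivative ?D (x + s *\<^sub>R v + h *\<^sub>R w) - ?D (x + s *\<^sub>R v)) (at s)"
    if "0 \<le> s" "s \<le> h" for s
  proof -
    have c: "x + h *\<^sub>R w + s *\<^sub>R v = x + s *\<^sub>R v + h *\<^sub>R w" for s by simp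
    show ?thesis
      unfolding \<phi>_def
      using line[of F "x + h *\<^sub>R w" s v, unfolded c] line[of F x s v] dF[of s h] dF[of s 0] that h
      by (intro DERIV_diff) auto
  qed
  obtain s where s: "0 < s" "s < h"
    "\<phi> h - \<phi> 0 = h * (?D (x + s *\<^sub>R v + h *\<^sub>R w) - ?D (x + s *\<^sub>R v))"
    using MVT2[of 0 h \<phi>, OF h d1] by auto
  have d2: "((\<lambda>t. ?D (x + s *\<^sub>R v + t *\<^sub>R w)) has_field_derivative
      frechet_derivative ?D (at (x + s *\<^sub>R v + t *\<^sub>R w)) w) (at t)" if "0 \<le> t" "t \<le> h" for t
    using line[of ?D "x + s *\<^sub>R v" t w] ddF that s by auto
  obtain t where t: "0 < t" "t < h"
    "?D (x + s *\<^sub>R v + h *\<^sub>R w) - ?D (x + s *\<^sub>R v) =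
      h * frechet_derivative ?D (at (x + s *\<^sub>R v + t *\<^sub>R w)) w"
    using MVT2[of 0 h "\<lambda>t. ?D (x + s *\<^sub>R v + t *\<^sub>R w)", OF h d2] by auto
  have "F (x + h *\<^sub>R v + h *\<^sub>R w) - F (x + h *\<^sub>R v) - F (x + h *\<^sub>R w) + F x = \<phi> h - \<phi> 0"
    by (simp add: \<phi>_def)
  then show ?thesis using s t by (intro exI[of _ s] exI[of _ t]) auto
qed

text \<open>Schwarz's argument: the second difference over the parallelogram spanned by
  \<open>h v\<close> and \<open>h w\<close> is symmetric in \<open>v\<close> and \<open>w\<close>,
  and it equals \<open>h * h\<close> times either mixed derivative at some point of the
  parallelogram. Continuity of both mixed derivatives at \<open>x\<close> then excludes a gap
  between them.\<close>

lemma second_derivative_symmetric: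
  fixes F :: "'a::real_normed_vector \<Rightarrow> real"
  assumes S: "open S" "x \<in> S" and F: "Cinf_on S F"
  shows "frechet_derivative (\<lambda>y. frechet_derivative F (at y) v) (at x) w =
    frechet_derivative (\<lambda>y. frechet_derivative F (at y) w) (at x) v" (is "?a x = ?b x")
proof (rule ccontr)
  assume ne: "?a x \<noteq> ?b x"
  define e where "e = \<bar>?a x - ?b x\<bar> / 2"
  have e: "e > 0" using ne by (simp add: e_def)
  have "continuous_on S ?a" "continuous_on S ?b"
    by (intro Cinf_on_continuous Cinf_on_derivative F)+
  then have ca: "isCont ?a x" and cb: "isCont ?b x"
    using S continuous_on_eq_continuous_at by blast+
  obtain r1 where r1: "r1 > 0" "\<And>y. dist y x < r1 \<Longrightarrow> dist (?a y) (?a x) < e"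
    using ca e unfolding continuous_at_eps_delta by blast
  obtain r2 where r2: "r2 > 0" "\<And>y. dist y x < r2 \<Longrightarrow> dist (?b y) (?b x) < e"
    using cb e unfolding continuous_at_eps_delta by blast
  obtain r3 where r3: "r3 > 0" "\<And>y. dist y x < r3 \<Longrightarrow> y \<in> S"
    using S by (metis open_dist)
  define r where "r = min r1 (min r2 r3)"
  have r: "r > 0" using r1 r2 r3 by (simp add: r_def)
  \<comment> \<open>The \<open>+ 1\<close> keeps the denominator positive when \<open>v\<close> and
    \<open>w\<close> vanish, and places the whole parallelogram strictly within distance
    \<open>r\<close> of \<open>x\<close>.\<close>
  define h where "h = r / (norm v + norm w + 1)"
  have h: "h > 0" using r by (simp add: h_def add_nonneg_pos)
  have near: "dist (x + s *\<^sub>R v + t *\<^sub>R w) x < r" if "0 \<le> s" "s \<le> h" "0 \<le> t" "t \<le> h" for s t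
  proof -
    have "dist (x + s *\<^sub>R v + t *\<^sub>R w) x \<le> s * norm v + t * norm w"
      using norm_triangle_ineq[of "s *\<^sub>R v" "t *\<^sub>R w"] that by (simp add: dist_norm add.commute add.left_commute)
    also have "\<dots> \<le> h * norm v + h * norm w"
      using that by (intro add_mono mult_right_mono) auto
    also have "\<dots> < h * (norm v + norm w + 1)" using h by (simp add: algebra_simps)
    also have "\<dots> = r"
      using add_nonneg_pos[of "norm v + norm w" 1] unfolding h_def by simp
    finally show ?thesis .
  qed
  have inS: "x + s *\<^sub>R v + t *\<^sub>R w \<in> S" "x + s *\<^sub>R w + t *\<^sub>R v \<in> S"
    if "0 \<le> s" "s \<le> h" "0 \<le> t" "t \<le> h" for s t
  proof -
    have "x + s *\<^sub>R w + t *\<^sub>R v = x + t *\<^sub>R v + s *\<^sub>R w" by simp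
    moreover have "dist (x + s *\<^sub>R v + t *\<^sub>R w) x < r3" "dist (x + t *\<^sub>R v + s *\<^sub>R w) x < r3"
      using near[OF that] near[OF that(3,4,1,2)] by (simp_all add: r_def)
    ultimately show "x + s *\<^sub>R v + t *\<^sub>R w \<in> S" "x + s *\<^sub>R w + t *\<^sub>R v \<in> S"
      using r3(2) by metis+
  qed
  obtain s t where st: "0 \<le> s" "s \<le> h" "0 \<le> t" "t \<le> h"
    "F (x + h *\<^sub>R v + h *\<^sub>R w) - F (x + h *\<^sub>R v) - F (x + h *\<^sub>R w) + F x =
      h * h * ?a (x + s *\<^sub>R v + t *\<^sub>R w)"
    using second_difference_mean_value[OF h, of F x v w] inS(1)
      Cinf_on_differentiable[OF F] Cinf_on_differentiable[OF Cinf_on_derivative[OF F, of v]] by blast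
  obtain s' t' where st': "0 \<le> s'" "s' \<le> h" "0 \<le> t'" "t' \<le> h"
    "F (x + h *\<^sub>R w + h *\<^sub>R v) - F (x + h *\<^sub>R w) - F (x + h *\<^sub>R v) + F x =
      h * h * ?b (x + s' *\<^sub>R w + t' *\<^sub>R v)"
    using second_difference_mean_value[OF h, of F x w v] inS(2)
      Cinf_on_differentiable[OF F] Cinf_on_differentiable[OF Cinf_on_derivative[OF F, of w]] by blast
  have "x + h *\<^sub>R w + h *\<^sub>R v = x + h *\<^sub>R v + h *\<^sub>R w" by simp
  with st'(5) have "F (x + h *\<^sub>R v + h *\<^sub>R w) - F (x + h *\<^sub>R w) - F (x + h *\<^sub>R v) + F x =
      h * h * ?b (x + s' *\<^sub>R w + t' *\<^sub>R v)" by metis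
  with st(5) have "h * h * ?a (x + s *\<^sub>R v + t *\<^sub>R w) = h * h * ?b (x + s' *\<^sub>R w + t' *\<^sub>R v)"
    by linarith
  then have eq: "?a (x + s *\<^sub>R v + t *\<^sub>R w) = ?b (x + s' *\<^sub>R w + t' *\<^sub>R v)" using h by simp
  have "dist (?a (x + s *\<^sub>R v + t *\<^sub>R w)) (?a x) < e"
    using near[OF st(1-4)] r1 by (auto simp: r_def)
  moreover have "dist (?b (x + s' *\<^sub>R w + t' *\<^sub>R v)) (?b x) < e"
  proof -
    have "x + s' *\<^sub>R w + t' *\<^sub>R v = x + t' *\<^sub>R v + s' *\<^sub>R w" by simp
    moreover have "dist (x + t' *\<^sub>R v + s' *\<^sub>R w) x < r2"
      using near[OF st'(3,4,1,2)] by (simp add: r_def)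
    ultimately show ?thesis using r2(2) by metis
  qed
  ultimately show False using eq unfolding dist_real_def e_def by (smt (verit) field_sum_of_halves)
qed

text \<open>The product rule for the basis expansion of the vector \<open>Y y\<close>. Symmetry of
  second derivatives moves the basis vector into the slot of differentiation, where linearity is
  immediate and the sum collapses.\<close>

lemma has_derivative_along_field:
  fixes F :: "'a::euclidean_space \<Rightarrow> real"
  assumes S: "open S" "x \<in> S" and F: "Cinf_on S F" and Y: "Y differentiable (at x)"
  shows "((\<lambda>y. frechet_derivative F (at y) (Y y)) has_derivative
    (\<lambda>h. frechet_derivative F (at x) (frechet_derivative Y (at x) h) +
      frechet_derivative (\<lambda>y. frechet_derivative F (at y) h) (at x) (Y x))) (at x)"
proof -
  let ?D = "\<lambda>y. frechet_derivative F (at y)"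
  have lin: "linear (?D y)" if "y \<in> S" for y
    using Cinf_on_differentiable[OF F that] by (rule linear_frechet_derivative)
  have dD: "((\<lambda>y. ?D y b) has_derivative frechet_derivative (\<lambda>y. ?D y b) (at x)) (at x)" for b
    by (intro has_frechet_derivative Cinf_on_differentiable[OF Cinf_on_derivative[OF F] S(2)])
  have "((\<lambda>y. \<Sum>b\<in>Basis. (Y y \<bullet> b) *\<^sub>R ?D y b) has_derivative
      (\<lambda>h. \<Sum>b\<in>Basis. (Y x \<bullet> b) *\<^sub>R frechet_derivative (\<lambda>y. ?D y b) (at x) h +
        (frechet_derivative Y (at x) h \<bullet> b) *\<^sub>R ?D x b)) (at x)"
    by (intro has_derivative_sum has_derivative_scaleR dD
      has_derivative_inner_left has_frechet_derivative Y)
  moreover have "(\<Sum>b\<in>Basis. (Y x \<bullet> b) *\<^sub>R frechet_derivative (\<lambda>y. ?D y b) (at x) h +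
        (frechet_derivative Y (at x) h \<bullet> b) *\<^sub>R ?D x b) =
      ?D x (frechet_derivative Y (at x) h) + frechet_derivative (\<lambda>y. ?D y h) (at x) (Y x)" for h
  proof -
    have l2: "linear (frechet_derivative (\<lambda>y. ?D y h) (at x))"
      by (intro linear_frechet_derivative Cinf_on_differentiable[OF Cinf_on_derivative[OF F] S(2)])
    show ?thesis
      by (subst linear_euclidean_expand[OF lin[OF S(2)], of "frechet_derivative Y (at x) h"],
          subst linear_euclidean_expand[OF l2, of "Y x"])
        (simp add: second_derivative_symmetric[OF S F] sum.distrib add.commute)
  qed
  ultimately have "((\<lambda>y. \<Sum>b\<in>Basis. (Y y \<bullet> b) *\<^sub>R ?D y b) has_derivative
      (\<lambda>h. ?D x (frechet_derivative Y (at x) h) +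
        frechet_derivative (\<lambda>y. ?D y h) (at x) (Y x))) (at x)"
    by simp
  then show ?thesis
    by (rule has_derivative_transform_within_open[OF _ S])
      (rule linear_euclidean_expand[OF lin, symmetric])
qed

section \<open>Charts, smooth functions and vector fields\<close>

lemma atlas_chart:
  assumes "complex_atlas B" "c \<in> B"
  shows "open (fst c)" "open (snd c ` fst c)"
    "\<And>q. q \<in> fst c \<Longrightarrow> chart_inv c (snd c q) = q"
    "\<And>x. x \<in> snd c ` fst c \<Longrightarrow> chart_inv c x \<in> fst c \<and> snd c (chart_inv c x) = x"
    "continuous_on (fst c) (snd c)" "continuous_on (snd c ` fst c) (chart_inv c)"
proof -
  have h: "open (fst c)" "open (snd c ` fst c)"
    "homeomorphism (fst c) (snd c ` fst c) (snd c) (chart_inv c)"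
    using assms by (auto simp: complex_atlas_def)
  show "open (fst c)" "open (snd c ` fst c)" by fact+
  show "\<And>q. q \<in> fst c \<Longrightarrow> chart_inv c (snd c q) = q"
    "continuous_on (fst c) (snd c)" "continuous_on (snd c ` fst c) (chart_inv c)"
    "\<And>x. x \<in> snd c ` fst c \<Longrightarrow> chart_inv c x \<in> fst c \<and> snd c (chart_inv c x) = x"
    using h(3) unfolding homeomorphism_def by auto
qed

lemma open_chart_image:
  assumes "complex_atlas B" "c \<in> B" "open W"
  shows "open (snd c ` (fst c \<inter> W))"
proof -
  note c = atlas_chart[OF assms(1,2)]
  have "snd c ` (fst c \<inter> W) = chart_inv c -` W \<inter> snd c ` fst c"
    using c(3) by force
  then show ?thesis
    using continuous_on_open_vimage[OF c(2), THEN iffD1, OF c(6)] assms(3) by auto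
qed

lemma smooth_transition:
  assumes "complex_atlas B" "c \<in> B" "c' \<in> B"
  shows "Cinf_on (snd c ` (fst c \<inter> fst c')) (transition c c')"
proof (rule Cinf_on_components[OF open_chart_image[OF assms(1,2) atlas_chart(1)[OF assms(1,3)]]])
  fix j
  have "holo_on (snd c ` (fst c \<inter> fst c')) (\<lambda>x. transition c c' x $ j)"
    using assms unfolding complex_atlas_def by blast
  then show "Cinf_on (snd c ` (fst c \<inter> fst c')) (\<lambda>x. transition c c' x $ j)"
    by (simp add: holo_on_def)
qed

lemma transition_differentiable:
  assumes "complex_atlas B" "c \<in> B" "c' \<in> B" "q \<in> fst c" "q \<in> fst c'"
  shows "transition c c' differentiable (at (snd c q))"
  by (rule Cinf_on_differentiable[OF smooth_transition[OF assms(1-3)]]) (use assms(4,5) in auto)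

lemma transition_Jc:
  assumes "complex_atlas B" "c \<in> B" "c' \<in> B" "q \<in> fst c" "q \<in> fst c'"
  shows "frechet_derivative (transition c c') (at (snd c q)) (Jc v) =
    Jc (frechet_derivative (transition c c') (at (snd c q)) v)"
proof -
  let ?x = "snd c q"
  have comp: "frechet_derivative (\<lambda>x. transition c c' x $ j) (at ?x) =
      (\<lambda>v. frechet_derivative (transition c c') (at ?x) v $ j)" for j
    by (intro frechet_derivative_eqI bounded_linear.has_derivative[OF bounded_linear_vec_nth]
      has_frechet_derivative transition_differentiable[OF assms])
  have "holo_on (snd c ` (fst c \<inter> fst c')) (\<lambda>x. transition c c' x $ j)" for j
    using assms(1-3) by (auto simp: complex_atlas_def)
  then have "frechet_derivative (\<lambda>x. transition c c' x $ j) (at ?x) (\<i> *s v) =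
      \<i> * frechet_derivative (\<lambda>x. transition c c' x $ j) (at ?x) v" for j
    using assms(4,5) by (auto simp: holo_on_def)
  then show ?thesis unfolding comp by (simp add: vec_eq_iff Jc_def)
qed

text \<open>The cocycle rule for derivatives of transition maps; it makes \<open>to_chart\<close>
  and \<open>from_chart\<close> mutually inverse.\<close>

lemma transition_chain:
  assumes B: "complex_atlas B" "a \<in> B" "b \<in> B" "c \<in> B" and q: "q \<in> fst a" "q \<in> fst b" "q \<in> fst c"
  shows "frechet_derivative (transition b c) (at (snd b q))
      (frechet_derivative (transition a b) (at (snd a q)) v) =
    frechet_derivative (transition a c) (at (snd a q)) v"
proof -
  have "(transition a b has_derivative frechet_derivative (transition a b) (at (snd a q))) (at (snd a q))"
    by (intro has_frechet_derivative transition_differentiable[OF B(1-3)] q)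
  moreover have bq: "transition a b (snd a q) = snd b q"
    using atlas_chart(3)[OF B(1,2) q(1)] by (simp add: transition_def)
  have "(transition b c has_derivative frechet_derivative (transition b c) (at (snd b q)))
      (at (transition a b (snd a q)))"
    unfolding bq by (intro has_frechet_derivative transition_differentiable[OF B(1,3,4)] q)
  ultimately have "((\<lambda>x. transition b c (transition a b x)) has_derivative
      (\<lambda>v. frechet_derivative (transition b c) (at (snd b q))
        (frechet_derivative (transition a b) (at (snd a q)) v))) (at (snd a q))"
    by (rule has_derivative_compose)
  then have "(transition a c has_derivative
      (\<lambda>v. frechet_derivative (transition b c) (at (snd b q))
        (frechet_derivative (transition a b) (at (snd a q)) v))) (at (snd a q))"
  proof (rule has_derivative_transform_within_open)
    show "open (snd a ` (fst a \<inter> fst b))"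
      by (intro open_chart_image[OF B(1,2)] atlas_chart(1)[OF B(1,3)])
    show "snd a q \<in> snd a ` (fst a \<inter> fst b)" using q by auto
    fix x assume "x \<in> snd a ` (fst a \<inter> fst b)"
    then show "transition b c (transition a b x) = transition a c x"
      using atlas_chart(3)[OF B(1,2)] atlas_chart(3)[OF B(1,3)] by (auto simp: transition_def)
  qed
  then show ?thesis by (metis frechet_derivative_eqI)
qed

lemma transition_same:
  assumes B: "complex_atlas B" "c \<in> B" and q: "q \<in> fst c"
  shows "frechet_derivative (transition c c) (at (snd c q)) v = v"
proof -
  have "frechet_derivative (transition c c) (at (snd c q)) = frechet_derivative (\<lambda>x. x) (at (snd c q))"
    using atlas_chart[OF B] q by (intro frechet_derivative_cong_open[of "snd c ` fst c"]) (auto simp: transition_def)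
  then show ?thesis by simp
qed

definition mdiff :: "('m, 'k::finite) chart set \<Rightarrow> ('m \<Rightarrow> real) \<Rightarrow> 'm \<Rightarrow> bool" where
  "mdiff A f p \<longleftrightarrow>
    (\<lambda>x. f (chart_inv (chart_at A p) x)) differentiable (at (snd (chart_at A p) p))"

text \<open>The coordinate vector field with constant components \<open>w\<close> in the chart
  \<open>c\<close>. These fields commute, and they extend every tangent vector to a local smooth
  field.\<close>

definition coord_field :: "('m, 'k::finite) chart set \<Rightarrow> ('m, 'k) chart \<Rightarrow> complex^'k \<Rightarrow> 'm \<Rightarrow> complex^'k" where
  "coord_field A c w q = from_chart A c q w"

locale complex_manifold =
  fixes A :: "('m::{t2_space,second_countable_topology}, 'k::finite) chart set"
  assumes atlas: "complex_atlas A"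
begin

lemma chart_at: "chart_at A p \<in> A" "p \<in> fst (chart_at A p)"
proof -
  have "p \<in> (\<Union>c\<in>A. fst c)" using atlas unfolding complex_atlas_def by simp
  then have "\<exists>c. c \<in> A \<and> p \<in> fst c" by blast
  then have "chart_at A p \<in> A \<and> p \<in> fst (chart_at A p)"
    unfolding chart_at_def by (rule someI_ex)
  then show "chart_at A p \<in> A" "p \<in> fst (chart_at A p)" by auto
qed

lemma compatible: "c \<in> A \<Longrightarrow> compatible_chart A c"
  by (simp add: compatible_chart_def atlas insert_absorb)

lemma compatible_atlas: "compatible_chart A c \<Longrightarrow> complex_atlas (insert c A)"
  by (simp add: compatible_chart_def)

lemma chart_at_inv: "chart_inv (chart_at A p) (snd (chart_at A p) p) = p"
  using atlas_chart(3)[OF atlas chart_at] .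

lemma to_chart_from_chart:
  assumes c: "compatible_chart A c" "q \<in> fst c"
  shows "to_chart A c q (from_chart A c q w) = w"
  unfolding to_chart_def from_chart_def
  by (simp add: transition_chain[OF compatible_atlas[OF c(1)]]
      transition_same[OF compatible_atlas[OF c(1)]] chart_at c(2))

lemma from_chart_to_chart:
  assumes c: "compatible_chart A c" "q \<in> fst c"
  shows "from_chart A c q (to_chart A c q w) = w"
  unfolding to_chart_def from_chart_def
  by (simp add: transition_chain[OF compatible_atlas[OF c(1)]] transition_same[OF atlas] chart_at c(2))

lemma linear_to_chart: "compatible_chart A c \<Longrightarrow> q \<in> fst c \<Longrightarrow> linear (to_chart A c q)"
  unfolding to_chart_def
  using transition_differentiable[OF compatible_atlas, of c "chart_at A q" c q] chart_at[of q]
  by (auto intro: linear_frechet_derivative)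

lemma to_chart_Jc: "compatible_chart A c \<Longrightarrow> q \<in> fst c \<Longrightarrow> to_chart A c q (Jc v) = Jc (to_chart A c q v)"
  unfolding to_chart_def
  using transition_Jc[OF compatible_atlas, of c "chart_at A q" c q v] chart_at[of q] by auto

lemma to_chart_at: "to_chart A (chart_at A p) p v = v"
  unfolding to_chart_def using transition_same[OF atlas chart_at] .

lemma smooth_fun_subset: "smooth_fun A W f \<Longrightarrow> W' \<subseteq> W \<Longrightarrow> smooth_fun A W' f"
  unfolding smooth_fun_def using Cinf_on_subset by (metis Int_mono image_mono order_refl)

lemma smooth_vf_subset: "smooth_vf A W X \<Longrightarrow> W' \<subseteq> W \<Longrightarrow> smooth_vf A W' X"
  unfolding smooth_vf_def using Cinf_on_subset by (metis Int_mono image_mono order_refl)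

lemma smooth_fun_const: "smooth_fun A W (\<lambda>q. c)"
  by (simp add: smooth_fun_def Cinf_on_const)

lemma smooth_fun_cong:
  assumes "open W" "\<And>q. q \<in> W \<Longrightarrow> f q = h q" "smooth_fun A W f"
  shows "smooth_fun A W h"
  unfolding smooth_fun_def
proof
  fix c assume c: "c \<in> A"
  show "Cinf_on (snd c ` (fst c \<inter> W)) (\<lambda>x. h (chart_inv c x))"
    by (rule Cinf_on_cong[OF open_chart_image[OF atlas c assms(1)], of "\<lambda>x. f (chart_inv c x)"])
      (use assms(2,3) c in \<open>auto simp: smooth_fun_def atlas_chart(3)[OF atlas c]\<close>)
qed

lemma smooth_vf_cong:
  assumes "open W" "\<And>q. q \<in> W \<Longrightarrow> X q = Y q" "smooth_vf A W X"
  shows "smooth_vf A W Y"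
  unfolding smooth_vf_def
proof
  fix c assume c: "c \<in> A"
  show "Cinf_on (snd c ` (fst c \<inter> W)) (vf_rep A c Y)"
    by (rule Cinf_on_cong[OF open_chart_image[OF atlas c assms(1)], of "vf_rep A c X"])
      (use assms(2,3) c in \<open>auto simp: smooth_vf_def vf_rep_def atlas_chart(3)[OF atlas c]\<close>)
qed

lemma smooth_vf_zero: "open W \<Longrightarrow> smooth_vf A W (\<lambda>q. 0)"
  unfolding smooth_vf_def
proof (intro ballI)
  fix c assume W: "open W" and c: "c \<in> A"
  show "Cinf_on (snd c ` (fst c \<inter> W)) (vf_rep A c (\<lambda>q. 0))"
    by (rule Cinf_on_cong[OF open_chart_image[OF atlas c W] _ Cinf_on_const[of _ 0]])
      (auto simp: vf_rep_def atlas_chart(3)[OF atlas c] linear_0[OF linear_to_chart[OF compatible[OF c]]])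
qed

lemma smooth_vf_add:
  assumes W: "open W" and "smooth_vf A W X" "smooth_vf A W Y"
  shows "smooth_vf A W (\<lambda>q. X q + Y q)"
  unfolding smooth_vf_def
proof (intro ballI)
  fix c assume c: "c \<in> A"
  note o = open_chart_image[OF atlas c W]
  show "Cinf_on (snd c ` (fst c \<inter> W)) (vf_rep A c (\<lambda>q. X q + Y q))"
    by (rule Cinf_on_cong[OF o _ Cinf_on_add[OF o, of "vf_rep A c X" "vf_rep A c Y"]])
      (use assms(2,3) c in \<open>auto simp: smooth_vf_def vf_rep_def atlas_chart(3)[OF atlas c]
        linear_add[OF linear_to_chart[OF compatible[OF c]]]\<close>)
qed

lemma smooth_vf_scale:
  assumes W: "open W" and "smooth_fun A W f" "smooth_vf A W Y"
  shows "smooth_vf A W (\<lambda>q. f q *\<^sub>R Y q)"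
  unfolding smooth_vf_def
proof (intro ballI)
  fix c assume c: "c \<in> A"
  note o = open_chart_image[OF atlas c W]
  show "Cinf_on (snd c ` (fst c \<inter> W)) (vf_rep A c (\<lambda>q. f q *\<^sub>R Y q))"
    by (rule Cinf_on_cong[OF o _ Cinf_on_scaleR[OF o, of "\<lambda>x. f (chart_inv c x)" "vf_rep A c Y"]])
      (use assms(2,3) c in \<open>auto simp: smooth_vf_def smooth_fun_def vf_rep_def atlas_chart(3)[OF atlas c]
        linear_scale[OF linear_to_chart[OF compatible[OF c]]]\<close>)
qed

lemma smooth_vf_uminus: "open W \<Longrightarrow> smooth_vf A W Y \<Longrightarrow> smooth_vf A W (\<lambda>q. - Y q)"
  using smooth_vf_scale[OF _ smooth_fun_const[of W "-1"], of Y] by simp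

lemma smooth_vf_diff:
  "open W \<Longrightarrow> smooth_vf A W X \<Longrightarrow> smooth_vf A W Y \<Longrightarrow> smooth_vf A W (\<lambda>q. X q - Y q)"
  using smooth_vf_add[OF _ _ smooth_vf_uminus, of W X Y] by simp

lemma smooth_vf_Jc:
  assumes W: "open W" and "smooth_vf A W Y"
  shows "smooth_vf A W (\<lambda>q. Jc (Y q))"
  unfolding smooth_vf_def
proof (intro ballI)
  fix c assume c: "c \<in> A"
  note o = open_chart_image[OF atlas c W]
  have J: "bounded_linear (Jc :: complex^'k \<Rightarrow> complex^'k)"
    by (rule linear_conv_bounded_linear[THEN iffD1], rule linearI)
      (auto simp: Jc_def vec_eq_iff algebra_simps)
  show "Cinf_on (snd c ` (fst c \<inter> W)) (vf_rep A c (\<lambda>q. Jc (Y q)))"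
    by (rule Cinf_on_cong[OF o _ Cinf_on_bounded_linear[OF o J, of "vf_rep A c Y"]])
      (use assms(2) c in \<open>auto simp: smooth_vf_def vf_rep_def atlas_chart(3)[OF atlas c]
        to_chart_Jc[OF compatible[OF c]]\<close>)
qed

section \<open>Directional derivatives and Lie brackets\<close>

lemma smooth_fun_mdiff: "open W \<Longrightarrow> p \<in> W \<Longrightarrow> smooth_fun A W f \<Longrightarrow> mdiff A f p"
  unfolding smooth_fun_def mdiff_def using chart_at[of p] by (auto intro!: Cinf_on_differentiable)

lemma eventually_chart:
  assumes "open W" "p \<in> W"
  obtains Q where "open Q" "snd (chart_at A p) p \<in> Q"
    "\<And>x. x \<in> Q \<Longrightarrow> chart_inv (chart_at A p) x \<in> W"
proof
  show "open (snd (chart_at A p) ` (fst (chart_at A p) \<inter> W))"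
    by (rule open_chart_image[OF atlas chart_at(1) assms(1)])
  show "snd (chart_at A p) p \<in> snd (chart_at A p) ` (fst (chart_at A p) \<inter> W)"
    using chart_at assms by auto
  show "\<And>x. x \<in> snd (chart_at A p) ` (fst (chart_at A p) \<inter> W) \<Longrightarrow> chart_inv (chart_at A p) x \<in> W"
    using atlas_chart(3)[OF atlas chart_at(1)] by auto
qed

lemma dir_deriv_cong:
  assumes "open W" "p \<in> W" "\<And>q. q \<in> W \<Longrightarrow> f q = h q"
  shows "dir_deriv A f p v = dir_deriv A h p v"
proof -
  obtain Q where "open Q" "snd (chart_at A p) p \<in> Q"
    "\<And>x. x \<in> Q \<Longrightarrow> chart_inv (chart_at A p) x \<in> W"
    using eventually_chart[OF assms(1,2)] by blast
  then show ?thesis unfolding dir_deriv_def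
    by (subst frechet_derivative_cong_open[of Q _ _ "\<lambda>x. h (chart_inv (chart_at A p) x)"])
      (auto intro: assms(3))
qed

lemma dir_deriv_const: "dir_deriv A (\<lambda>q. c) p v = 0"
  by (simp add: dir_deriv_def)

lemma linear_dir_deriv: "mdiff A f p \<Longrightarrow> linear (dir_deriv A f p)"
  unfolding mdiff_def dir_deriv_def by (simp add: linear_frechet_derivative)

lemma dir_deriv_add:
  "mdiff A f p \<Longrightarrow> mdiff A h p \<Longrightarrow>
    dir_deriv A (\<lambda>q. f q + h q) p v = dir_deriv A f p v + dir_deriv A h p v"
  unfolding mdiff_def dir_deriv_def
  by (subst frechet_derivative_eqI[OF has_derivative_add[OF has_frechet_derivative has_frechet_derivative]]) auto

lemma dir_deriv_diff:
  "mdiff A f p \<Longrightarrow> mdiff A h p \<Longrightarrow>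
    dir_deriv A (\<lambda>q. f q - h q) p v = dir_deriv A f p v - dir_deriv A h p v"
  unfolding mdiff_def dir_deriv_def
  by (subst frechet_derivative_eqI[OF has_derivative_diff[OF has_frechet_derivative has_frechet_derivative]]) auto

lemma mdiff_mult: "mdiff A f p \<Longrightarrow> mdiff A h p \<Longrightarrow> mdiff A (\<lambda>q. f q * h q) p"
  unfolding mdiff_def by (rule differentiable_mult)

lemma mdiff_add: "mdiff A f p \<Longrightarrow> mdiff A h p \<Longrightarrow> mdiff A (\<lambda>q. f q + h q) p"
  unfolding mdiff_def by (rule differentiable_add)

lemma mdiff_const: "mdiff A (\<lambda>q. c) p"
  unfolding mdiff_def by simp

lemma dir_deriv_mult:
  "mdiff A f p \<Longrightarrow> mdiff A h p \<Longrightarrow>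
    dir_deriv A (\<lambda>q. f q * h q) p v = f p * dir_deriv A h p v + dir_deriv A f p v * h p"
  unfolding mdiff_def dir_deriv_def
  by (subst frechet_derivative_eqI[OF has_derivative_mult[OF has_frechet_derivative has_frechet_derivative]])
    (auto simp: chart_at_inv)

lemma dir_deriv_chart:
  fixes f :: "'m \<Rightarrow> real"
  assumes c: "compatible_chart A c" "p \<in> fst c"
    and d: "(\<lambda>x. f (chart_inv c x)) differentiable (at (snd c p))"
  shows "dir_deriv A f p v = frechet_derivative (\<lambda>x. f (chart_inv c x)) (at (snd c p)) (to_chart A c p v)"
proof -
  let ?e = "chart_at A p"
  note B = compatible_atlas[OF c(1)]
  have e: "?e \<in> insert c A" and cB: "c \<in> insert c A" using chart_at by auto
  have tp: "transition ?e c (snd ?e p) = snd c p"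
    by (simp add: transition_def chart_at_inv)
  have "(transition ?e c has_derivative to_chart A c p) (at (snd ?e p))"
    unfolding to_chart_def
    by (intro has_frechet_derivative transition_differentiable[OF B e cB chart_at(2) c(2)])
  moreover have "((\<lambda>x. f (chart_inv c x)) has_derivative
      frechet_derivative (\<lambda>x. f (chart_inv c x)) (at (snd c p))) (at (transition ?e c (snd ?e p)))"
    unfolding tp by (rule has_frechet_derivative[OF d])
  ultimately have "((\<lambda>x. f (chart_inv c (transition ?e c x))) has_derivative
      (\<lambda>v. frechet_derivative (\<lambda>x. f (chart_inv c x)) (at (snd c p)) (to_chart A c p v))) (at (snd ?e p))"
    by (rule has_derivative_compose)
  then have "((\<lambda>x. f (chart_inv ?e x)) has_derivative
      (\<lambda>v. frechet_derivative (\<lambda>x. f (chart_inv c x)) (at (snd c p)) (to_chart A c p v))) (at (snd ?e p))"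
  proof (rule has_derivative_transform_within_open)
    show "open (snd ?e ` (fst ?e \<inter> fst c))"
      by (rule open_chart_image[OF B e atlas_chart(1)[OF B cB]])
    show "snd ?e p \<in> snd ?e ` (fst ?e \<inter> fst c)" using chart_at(2) c(2) by auto
    fix x assume "x \<in> snd ?e ` (fst ?e \<inter> fst c)"
    then show "f (chart_inv c (transition ?e c x)) = f (chart_inv ?e x)"
      using atlas_chart(3)[OF B e] atlas_chart(3)[OF B cB] by (auto simp: transition_def)
  qed
  then show ?thesis unfolding dir_deriv_def by (metis frechet_derivative_eqI)
qed

text \<open>\<open>dir_deriv\<close> at a point uses the chart chosen for that very point, and this
  choice varies without any continuity. Rewriting it in one fixed chart makes the function
  \<open>Y f\<close> accessible to calculus.\<close>

lemma dir_deriv_field_local: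
  fixes f :: "'m \<Rightarrow> real"
  assumes W: "open W" and f: "smooth_fun A W f" and c: "c \<in> A" and x: "x \<in> snd c ` (fst c \<inter> W)"
  shows "dir_deriv A f (chart_inv c x) (Y (chart_inv c x)) =
    frechet_derivative (\<lambda>x. f (chart_inv c x)) (at x) (vf_rep A c Y x)"
proof -
  note cc = atlas_chart[OF atlas c]
  have q: "chart_inv c x \<in> fst c" "snd c (chart_inv c x) = x" using cc(4) x by auto
  have "(\<lambda>x. f (chart_inv c x)) differentiable (at x)"
    using f c x unfolding smooth_fun_def by (auto intro: Cinf_on_differentiable)
  then show ?thesis
    using dir_deriv_chart[OF compatible[OF c] q(1)] q(2) by (simp add: vf_rep_def)
qed

lemma has_derivative_dir_deriv_field:
  fixes f :: "'m \<Rightarrow> real"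
  assumes W: "open W" "p \<in> W" and f: "smooth_fun A W f" and Y: "smooth_vf A W Y"
  defines "e \<equiv> chart_at A p"
  defines "F \<equiv> \<lambda>x. f (chart_inv e x)"
  shows "((\<lambda>x. dir_deriv A f (chart_inv e x) (Y (chart_inv e x))) has_derivative
    (\<lambda>h. frechet_derivative F (at (snd e p)) (frechet_derivative (vf_rep A e Y) (at (snd e p)) h) +
      frechet_derivative (\<lambda>y. frechet_derivative F (at y) h) (at (snd e p)) (Y p))) (at (snd e p))"
proof -
  let ?S = "snd e ` (fst e \<inter> W)"
  have e: "e \<in> A" "p \<in> fst e" using chart_at by (auto simp: e_def)
  have S: "open ?S" "snd e p \<in> ?S" using open_chart_image[OF atlas e(1) W(1)] e(2) W(2) by auto
  have F: "Cinf_on ?S F" using f e(1) by (auto simp: smooth_fun_def F_def)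
  have d: "vf_rep A e Y differentiable (at (snd e p))"
    using Y e(1) S(2) by (auto simp: smooth_vf_def intro: Cinf_on_differentiable)
  have v: "vf_rep A e Y (snd e p) = Y p"
    by (simp add: vf_rep_def e_def chart_at_inv to_chart_at)
  have "((\<lambda>x. frechet_derivative F (at x) (vf_rep A e Y x)) has_derivative
    (\<lambda>h. frechet_derivative F (at (snd e p)) (frechet_derivative (vf_rep A e Y) (at (snd e p)) h) +
      frechet_derivative (\<lambda>y. frechet_derivative F (at y) h) (at (snd e p)) (Y p))) (at (snd e p))"
    using has_derivative_along_field[OF S F d] unfolding v .
  then show ?thesis
    by (rule has_derivative_transform_within_open[OF _ S])
      (simp add: dir_deriv_field_local[OF W(1) f e(1)] F_def)
qed

lemma mdiff_dir_deriv_field: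
  fixes f :: "'m \<Rightarrow> real"
  assumes "open W" "p \<in> W" "smooth_fun A W f" "smooth_vf A W Y"
  shows "mdiff A (\<lambda>q. dir_deriv A f q (Y q)) p"
  using has_derivative_dir_deriv_field[OF assms] unfolding mdiff_def differentiable_def by blast

text \<open>The second-order terms of \<open>X(Y f)\<close> and \<open>Y(X f)\<close> agree by
  symmetry of second derivatives; what is left is the derivative of \<open>f\<close> along the
  expression defining the bracket. Brackets can thus be tested on functions instead of being
  transformed between charts.\<close>

lemma dir_deriv_lie_bracket:
  fixes f :: "'m \<Rightarrow> real"
  assumes W: "open W" "p \<in> W" and f: "smooth_fun A W f" and XY: "smooth_vf A W X" "smooth_vf A W Y"
  shows "dir_deriv A f p (lie_bracket A X Y p) =
    dir_deriv A (\<lambda>q. dir_deriv A f q (Y q)) p (X p) - dir_deriv A (\<lambda>q. dir_deriv A f q (X q)) p (Y p)"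
proof -
  define e where "e = chart_at A p"
  define F where "F = (\<lambda>x. f (chart_inv e x))"
  let ?S = "snd e ` (fst e \<inter> W)"
  have e: "e \<in> A" "p \<in> fst e" using chart_at by (auto simp: e_def)
  have S: "open ?S" "snd e p \<in> ?S" using open_chart_image[OF atlas e(1) W(1)] e(2) W(2) by auto
  have F: "Cinf_on ?S F" using f e(1) by (auto simp: smooth_fun_def F_def)
  have lin: "linear (frechet_derivative F (at (snd e p)))"
    by (intro linear_frechet_derivative Cinf_on_differentiable[OF F S(2)])
  have d: "dir_deriv A (\<lambda>q. dir_deriv A f q (Y q)) p h =
      frechet_derivative F (at (snd e p)) (frechet_derivative (vf_rep A e Y) (at (snd e p)) h) +
      frechet_derivative (\<lambda>y. frechet_derivative F (at y) h) (at (snd e p)) (Y p)"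
    if "smooth_vf A W Y" for Y h
    using frechet_derivative_eqI[OF has_derivative_dir_deriv_field[OF W f that]]
    by (simp add: dir_deriv_def e_def F_def)
  show ?thesis
    unfolding d[OF XY(1)] d[OF XY(2)]
    by (simp add: second_derivative_symmetric[OF S F, of "X p" "Y p"] lie_bracket_def dir_deriv_def
        linear_diff[OF lin, unfolded e_def F_def] e_def[symmetric] F_def[symmetric] linear_diff[OF lin])
qed

lemma smooth_chart_component:
  assumes c: "compatible_chart A c"
  shows "smooth_fun A (fst c) (\<lambda>q. snd c q \<bullet> b)"
  unfolding smooth_fun_def
proof
  fix e assume e: "e \<in> A"
  note B = compatible_atlas[OF c]
  have "Cinf_on (snd e ` (fst e \<inter> fst c)) (transition e c)"
    using smooth_transition[OF B, of e c] e by auto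
  from Cinf_on_bounded_linear[OF _ bounded_linear_inner_left this]
  show "Cinf_on (snd e ` (fst e \<inter> fst c)) (\<lambda>x. snd c (chart_inv e x) \<bullet> b)"
    using open_chart_image[OF atlas e atlas_chart(1)[OF B, of c]] by (auto simp: transition_def)
qed

lemma dir_deriv_chart_component:
  assumes c: "compatible_chart A c" "q \<in> fst c"
  shows "dir_deriv A (\<lambda>q. snd c q \<bullet> b) q v = to_chart A c q v \<bullet> b"
proof -
  have "transition (chart_at A q) c differentiable (at (snd (chart_at A q) q))"
    using transition_differentiable[OF compatible_atlas[OF c(1)], of "chart_at A q" c q] chart_at[of q] c(2)
    by auto
  from frechet_derivative_eqI[OF bounded_linear.has_derivative[OF bounded_linear_inner_left
      has_frechet_derivative[OF this], of b]]
  show ?thesis by (simp add: dir_deriv_def to_chart_def transition_def[abs_def])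
qed

text \<open>In a second chart the components are the derivative of the transition map in the
  constant direction \<open>w\<close>, composed with the reverse transition.\<close>

lemma smooth_coord_field:
  assumes c: "c \<in> A"
  shows "smooth_vf A (fst c) (coord_field A c w)"
  unfolding smooth_vf_def
proof
  fix c' assume c': "c' \<in> A"
  have o: "open (snd c' ` (fst c' \<inter> fst c))" "open (snd c ` (fst c \<inter> fst c'))"
    by (auto intro!: open_chart_image[OF atlas] atlas_chart(1)[OF atlas] c c')
  show "Cinf_on (snd c' ` (fst c' \<inter> fst c)) (vf_rep A c' (coord_field A c w))"
  proof (rule Cinf_on_cong[OF o(1)])
    show "Cinf_on (snd c' ` (fst c' \<inter> fst c))
        (\<lambda>x. frechet_derivative (transition c c') (at (transition c' c x)) w)"
      by (rule Cinf_on_compose[OF o Cinf_on_derivative[OF smooth_transition[OF atlas c c']]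
          smooth_transition[OF atlas c' c]])
        (auto simp: transition_def atlas_chart(3)[OF atlas c'])
    fix x assume "x \<in> snd c' ` (fst c' \<inter> fst c)"
    then obtain q where q: "q \<in> fst c'" "q \<in> fst c" "x = snd c' q" by auto
    then have "chart_inv c' x = q" using atlas_chart(3)[OF atlas c'] by simp
    then show "frechet_derivative (transition c c') (at (transition c' c x)) w =
        vf_rep A c' (coord_field A c w) x"
      using transition_chain[OF atlas c chart_at(1) c' q(2) chart_at(2) q(1), of w]
      by (simp add: vf_rep_def coord_field_def to_chart_def from_chart_def transition_def[of c' c])
  qed
qed

text \<open>Tested on the linear coordinates of \<open>c\<close>: each coordinate field
  differentiates them to constants, so both iterated derivatives vanish. This avoids comparing
  \<open>c\<close> with the chart used in the definition of the bracket.\<close>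

lemma lie_bracket_coord_fields:
  assumes c: "c \<in> A" "q \<in> fst c"
  shows "lie_bracket A (coord_field A c w) (coord_field A c z) q = 0"
proof -
  note cc = compatible[OF c(1)]
  have o: "open (fst c)" using atlas_chart(1)[OF atlas c(1)] .
  have const: "dir_deriv A (\<lambda>q. dir_deriv A (\<lambda>q. snd c q \<bullet> b) q (coord_field A c w q)) q v = 0" for b w v
    using dir_deriv_cong[OF o c(2), of "\<lambda>q. dir_deriv A (\<lambda>q. snd c q \<bullet> b) q (coord_field A c w q)" "\<lambda>q. w \<bullet> b"]
    by (simp add: dir_deriv_chart_component[OF cc] coord_field_def to_chart_from_chart[OF cc] dir_deriv_const)
  have "to_chart A c q (lie_bracket A (coord_field A c w) (coord_field A c z) q) \<bullet> b = 0" for b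
    using dir_deriv_lie_bracket[OF o c(2) smooth_chart_component[OF cc] smooth_coord_field[OF c(1)]
        smooth_coord_field[OF c(1)], of b w z]
    by (simp add: const dir_deriv_chart_component[OF cc c(2)])
  then have "to_chart A c q (lie_bracket A (coord_field A c w) (coord_field A c z) q) = 0"
    using inner_eq_zero_iff by blast
  then show ?thesis
    using from_chart_to_chart[OF cc c(2)] linear_0[OF linear_to_chart[OF cc c(2)]] by metis
qed

lemma coord_field_at: "coord_field A (chart_at A p) w p = w"
  unfolding coord_field_def from_chart_def using transition_same[OF atlas chart_at] .

end

section \<open>Levi-Civita connections\<close>

locale hermitian_manifold = complex_manifold A
  for A :: "('m::{t2_space,second_countable_topology}, 'k::finite) chart set" +
  fixes g :: "'m \<Rightarrow> complex^'k \<Rightarrow> complex^'k \<Rightarrow> real"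
    and nabla :: "('m, 'k) conn"
  assumes herm: "hermitian_metric A g" and lc: "levi_civita A g nabla"
begin

lemma bilinear_g: "bilinear (g p)" and g_sym: "g p x y = g p y x"
  and g_pos: "x \<noteq> 0 \<Longrightarrow> g p x x > 0" and g_Jc: "g p (Jc x) (Jc y) = g p x y"
  using herm by (auto simp: hermitian_metric_def)

lemmas g_linear [simp] =
  bilinear_ladd[OF bilinear_g] bilinear_radd[OF bilinear_g]
  bilinear_lsub[OF bilinear_g] bilinear_rsub[OF bilinear_g]
  bilinear_lmul[OF bilinear_g] bilinear_rmul[OF bilinear_g]
  bilinear_lneg[OF bilinear_g] bilinear_rneg[OF bilinear_g]
  bilinear_lzero[OF bilinear_g] bilinear_rzero[OF bilinear_g]

lemma g_self_zero: "g p x x = 0 \<Longrightarrow> x = 0"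
  using g_pos[of x p] by force

lemma smooth_g:
  "open W \<Longrightarrow> smooth_vf A W X \<Longrightarrow> smooth_vf A W Y \<Longrightarrow> smooth_fun A W (\<lambda>q. g q (X q) (Y q))"
  using herm by (auto simp: hermitian_metric_def)

lemma connection: "affine_connection A nabla"
  using lc by (simp add: levi_civita_def)

lemmas connection_on = connection[unfolded affine_connection_def, THEN spec, THEN spec, THEN mp, OF conjI]

lemma linear_nabla: "open W \<Longrightarrow> smooth_vf A W Y \<Longrightarrow> p \<in> W \<Longrightarrow> linear (\<lambda>v. nabla p v Y)"
  using connection_on[of W Y] by simp

lemma smooth_nabla:
  "open W \<Longrightarrow> smooth_vf A W X \<Longrightarrow> smooth_vf A W Y \<Longrightarrow> smooth_vf A W (\<lambda>q. nabla q (X q) Y)"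
  using connection_on[of W Y] by simp

lemma nabla_add:
  "open W \<Longrightarrow> smooth_vf A W Y \<Longrightarrow> smooth_vf A W Z \<Longrightarrow> p \<in> W \<Longrightarrow>
    nabla p v (\<lambda>q. Y q + Z q) = nabla p v Y + nabla p v Z"
  using connection_on[of W Y] by simp

lemma nabla_scale:
  "open W \<Longrightarrow> smooth_vf A W Y \<Longrightarrow> smooth_fun A W f \<Longrightarrow> p \<in> W \<Longrightarrow>
    nabla p v (\<lambda>q. f q *\<^sub>R Y q) = dir_deriv A f p v *\<^sub>R Y p + f p *\<^sub>R nabla p v Y"
  using connection_on[of W Y] by simp

lemma torsion_free:
  "open W \<Longrightarrow> smooth_vf A W X \<Longrightarrow> smooth_vf A W Y \<Longrightarrow> p \<in> W \<Longrightarrow>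
    nabla p (X p) Y - nabla p (Y p) X = lie_bracket A X Y p"
  using lc unfolding levi_civita_def by blast

lemma metric_connection:
  "open W \<Longrightarrow> smooth_vf A W X \<Longrightarrow> smooth_vf A W Y \<Longrightarrow> p \<in> W \<Longrightarrow>
    dir_deriv A (\<lambda>q. g q (X q) (Y q)) p v = g p (nabla p v X) (Y p) + g p (X p) (nabla p v Y)"
  using lc unfolding levi_civita_def by blast

text \<open>The axioms only constrain a field on the open set \<open>W\<close>; multiplying by a function that is 1 on
  \<open>W\<close> and 0 outside removes the dependence on the values elsewhere.\<close>

lemma nabla_cong:
  assumes W: "open W" "p \<in> W" and Y: "smooth_vf A W Y" and eq: "\<And>q. q \<in> W \<Longrightarrow> Y q = Z q"
  shows "nabla p v Y = nabla p v Z"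
proof -
  define f :: "'m \<Rightarrow> real" where "f q = (if q \<in> W then 1 else 0)" for q
  have f: "smooth_fun A W f"
    by (rule smooth_fun_cong[OF W(1) _ smooth_fun_const[of W 1]]) (simp add: f_def)
  have f0: "dir_deriv A f p v = 0"
    using dir_deriv_cong[OF W, of f "\<lambda>q. 1"] by (simp add: f_def dir_deriv_const)
  have cut: "nabla p v (\<lambda>q. f q *\<^sub>R X q) = nabla p v X" if "smooth_vf A W X" for X
    using nabla_scale[OF W(1) that f W(2)] f0 W(2) by (simp add: f_def)
  have "(\<lambda>q. f q *\<^sub>R Y q) = (\<lambda>q. f q *\<^sub>R Z q)" using eq by (auto simp: f_def)
  then show ?thesis
    using cut[OF Y] cut[OF smooth_vf_cong[OF W(1) eq Y]] by simp
qed

lemma nabla_zero: "nabla p v (\<lambda>q. 0) = 0"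
  using nabla_scale[OF open_UNIV smooth_vf_zero[OF open_UNIV] smooth_fun_const[of UNIV "0::real"], of p v]
  by (simp add: dir_deriv_const)

lemma nabla_uminus:
  "open W \<Longrightarrow> smooth_vf A W Y \<Longrightarrow> p \<in> W \<Longrightarrow> nabla p v (\<lambda>q. - Y q) = - nabla p v Y"
  using nabla_scale[OF _ _ smooth_fun_const[of W "-1"], of Y p v] by (simp add: dir_deriv_const)

lemma nabla_diff:
  "open W \<Longrightarrow> smooth_vf A W Y \<Longrightarrow> smooth_vf A W Z \<Longrightarrow> p \<in> W \<Longrightarrow>
    nabla p v (\<lambda>q. Y q - Z q) = nabla p v Y - nabla p v Z"
  using nabla_add[OF _ _ smooth_vf_uminus, of W Y Z p v] nabla_uminus[of W Z p v] by simp

lemma extend_vector: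
  assumes W: "open W" "p \<in> W"
  shows "\<exists>W'. open W' \<and> p \<in> W' \<and> W' \<subseteq> W \<and> W' \<subseteq> fst (chart_at A p) \<and>
    (\<forall>w. smooth_vf A W' (coord_field A (chart_at A p) w))"
proof (intro exI conjI allI)
  show "open (W \<inter> fst (chart_at A p))" using W(1) atlas_chart(1)[OF atlas chart_at(1)] by auto
  show "p \<in> W \<inter> fst (chart_at A p)" using W(2) chart_at(2) by simp
  show "smooth_vf A (W \<inter> fst (chart_at A p)) (coord_field A (chart_at A p) w)" for w
    by (rule smooth_vf_subset[OF smooth_coord_field[OF chart_at(1)]]) simp
qed auto

lemma smooth_endo_linear: "smooth_endo A W F \<Longrightarrow> p \<in> W \<Longrightarrow> linear (F p)"
  by (simp add: smooth_endo_def)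

lemma smooth_endo_vf:
  "smooth_endo A W F \<Longrightarrow> open W' \<Longrightarrow> W' \<subseteq> W \<Longrightarrow> smooth_vf A W' X \<Longrightarrow> smooth_vf A W' (\<lambda>q. F q (X q))"
  by (simp add: smooth_endo_def)

lemma smooth_endo_subset: "smooth_endo A W F \<Longrightarrow> W' \<subseteq> W \<Longrightarrow> smooth_endo A W' F"
  unfolding smooth_endo_def by (auto dest: subset_trans)

text \<open>Differentiating the skewness relation along \<open>w\<close> with a metric connection
  passes skewness from \<open>F\<close> to its covariant derivative.\<close>

lemma cov_endo_skew:
  assumes W: "open W" "p \<in> W" and F: "smooth_endo A W F"
    and skew: "\<And>q x y. q \<in> W \<Longrightarrow> g q x (F q y) = - g q (F q x) y"
    and Y: "smooth_vf A W Y" and Z: "smooth_vf A W Z"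
  shows "g p (cov_endo nabla F p w Y) (Z p) = - g p (Y p) (cov_endo nabla F p w Z)"
proof -
  note FY = smooth_endo_vf[OF F W(1) order_refl Y] and FZ = smooth_endo_vf[OF F W(1) order_refl Z]
  have m: "mdiff A (\<lambda>q. g q (F q (Y q)) (Z q)) p"
    by (rule smooth_fun_mdiff[OF W smooth_g[OF W(1) FY Z]])
  have "dir_deriv A (\<lambda>q. g q (Y q) (F q (Z q))) p w = dir_deriv A (\<lambda>q. 0 - g q (F q (Y q)) (Z q)) p w"
    by (rule dir_deriv_cong[OF W]) (simp add: skew)
  also have "\<dots> = - dir_deriv A (\<lambda>q. g q (F q (Y q)) (Z q)) p w"
    using dir_deriv_diff[OF mdiff_const[of 0] m, of w] by (simp add: dir_deriv_const)
  finally have "g p (nabla p w Y) (F p (Z p)) + g p (Y p) (nabla p w (\<lambda>q. F q (Z q))) =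
      - (g p (nabla p w (\<lambda>q. F q (Y q))) (Z p) + g p (F p (Y p)) (nabla p w Z))"
    unfolding metric_connection[OF W(1) Y FZ W(2)] metric_connection[OF W(1) FY Z W(2)] .
  then show ?thesis
    using skew[OF W(2), of "nabla p w Y" "Z p"] skew[OF W(2), of "Y p" "nabla p w Z"]
    by (simp add: cov_endo_def)
qed

text \<open>Skewness trades the field \<open>Y\<close> for a test field: if \<open>X\<close> extends
  \<open>x\<close>, then \<open>g((\<nabla>_w F)Y, x)\<close> equals
  \<open>- g(Y p, (\<nabla>_w F)X)\<close>, which involves only the value of \<open>Y\<close> at
  \<open>p\<close>.\<close>

lemma cov_endo_tensorial:
  assumes W: "open W" "p \<in> W" and F: "smooth_endo A W F"
    and skew: "\<And>q x y. q \<in> W \<Longrightarrow> g q x (F q y) = - g q (F q x) y"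
    and Y: "smooth_vf A W Y" and Z: "smooth_vf A W Z" and eq: "Y p = Z p"
  shows "cov_endo nabla F p w Y = cov_endo nabla F p w Z"
proof -
  obtain W' where W': "open W'" "p \<in> W'" "W' \<subseteq> W"
    and c: "\<forall>w. smooth_vf A W' (coord_field A (chart_at A p) w)"
    using extend_vector[OF W] by blast
  note c = c[rule_format]
  have F': "smooth_endo A W' F" using F W'(3) by (rule smooth_endo_subset)
  have sk: "g q x (F q y) = - g q (F q x) y" if "q \<in> W'" for q x y
    using skew W'(3) that by blast
  have "g p (cov_endo nabla F p w Y - cov_endo nabla F p w Z) x = 0" for x
    using cov_endo_skew[OF W'(1,2) F' sk smooth_vf_subset[OF Y W'(3)] c[of x], of w]
      cov_endo_skew[OF W'(1,2) F' sk smooth_vf_subset[OF Z W'(3)] c[of x], of w] eq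
    by (simp add: coord_field_at)
  then have "cov_endo nabla F p w Y - cov_endo nabla F p w Z = 0"
    using g_self_zero by blast
  then show ?thesis by simp
qed

text \<open>As \<open>F Z\<close> vanishes identically,
  \<open>(\<nabla>F)Z = - F(\<nabla>Z)\<close>, and torsion-freeness assembles the remaining
  covariant derivatives into brackets.\<close>

lemma nijenhuis_kernel:
  assumes W: "open W" "p \<in> W" and F: "smooth_endo A W F"
    and K: "smooth_vf A W K" and Z: "smooth_vf A W Z" and FZ: "\<And>q. q \<in> W \<Longrightarrow> F q (Z q) = 0"
  shows "nijenhuis nabla F K Z p =
    F p (F p (lie_bracket A K Z p)) - F p (lie_bracket A (\<lambda>q. F q (K q)) Z p)"
proof -
  note FK = smooth_endo_vf[OF F W(1) order_refl K]
  note lin = smooth_endo_linear[OF F W(2)]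
  have "nabla p x (\<lambda>q. F q (Z q)) = 0" for x
    using nabla_cong[OF W smooth_endo_vf[OF F W(1) order_refl Z], of "\<lambda>q. 0" x] FZ
    by (simp add: nabla_zero)
  then have a: "cov_endo nabla F p x Z = - F p (nabla p x Z)" for x by (simp add: cov_endo_def)
  have b: "cov_endo nabla F p (F p (Z p)) K = 0"
    using FZ[OF W(2)] linear_0[OF linear_nabla[OF W(1) FK W(2)]]
      linear_0[OF linear_nabla[OF W(1) K W(2)]] linear_0[OF lin]
    by (simp add: cov_endo_def)
  show ?thesis
    unfolding nijenhuis_def a b torsion_free[OF W(1) K Z W(2), symmetric]
      torsion_free[OF W(1) FK Z W(2), symmetric]
    by (simp add: cov_endo_def linear_diff[OF lin] linear_neg[OF lin])
qed

end


section \<open>Normal complex contact metric structures\<close>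

text \<open>One coordinate neighbourhood with the index suppressed. The horizontal bundle is
  described by \<open>u\<close> and \<open>v\<close> instead of the kernel of the holomorphic
  form.\<close>

locale contact_structure = hermitian_manifold A g nabla
  for A :: "('m::{t2_space,second_countable_topology}, 'k::finite) chart set"
    and g :: "'m \<Rightarrow> complex^'k \<Rightarrow> complex^'k \<Rightarrow> real"
    and nabla :: "('m, 'k) conn" +
  fixes N :: "'m set"
    and u :: "'m \<Rightarrow> complex^'k \<Rightarrow> real"
    and U :: "'m \<Rightarrow> complex^'k"
    and G :: "'m \<Rightarrow> complex^'k \<Rightarrow> complex^'k"
  assumes openN: "open N"
    and smooth_u: "smooth_one_form A N u" and smooth_U: "smooth_vf A N U" and smooth_G: "smooth_endo A N G"
    and g_U_U: "p \<in> N \<Longrightarrow> g p (U p) (U p) = 1"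
    and u_eq: "p \<in> N \<Longrightarrow> u p x = g p x (U p)"
    and G_G: "p \<in> N \<Longrightarrow> G p (G p x) = - x + u p x *\<^sub>R U p + v_of u p x *\<^sub>R V_of U p"
    and H_H: "p \<in> N \<Longrightarrow> H_of G p (H_of G p x) = - x + u p x *\<^sub>R U p + v_of u p x *\<^sub>R V_of U p"
    and G_Jc: "p \<in> N \<Longrightarrow> G p (Jc x) = - Jc (G p x)"
    and G_U: "p \<in> N \<Longrightarrow> G p (U p) = 0"
    and G_skew: "p \<in> N \<Longrightarrow> g p x (G p y) = - g p (G p x) y"
    and du: "open W \<Longrightarrow> W \<subseteq> N \<Longrightarrow> smooth_vf A W K \<Longrightarrow> smooth_vf A W L \<Longrightarrow> p \<in> W \<Longrightarrow>
      ext_d A u K L p = g p (K p) (G p (L p)) + wedge (sigma_of g nabla U p) (v_of u p) (K p) (L p)"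
    and dv: "open W \<Longrightarrow> W \<subseteq> N \<Longrightarrow> smooth_vf A W K \<Longrightarrow> smooth_vf A W L \<Longrightarrow> p \<in> W \<Longrightarrow>
      ext_d A (v_of u) K L p = g p (K p) (H_of G p (L p)) - wedge (sigma_of g nabla U p) (u p) (K p) (L p)"
    and S_horizontal: "open W \<Longrightarrow> W \<subseteq> N \<Longrightarrow> smooth_vf A W K \<Longrightarrow> smooth_vf A W L \<Longrightarrow>
      (\<And>q. q \<in> W \<Longrightarrow> u q (K q) = 0 \<and> v_of u q (K q) = 0 \<and> u q (L q) = 0 \<and> v_of u q (L q) = 0) \<Longrightarrow>
      p \<in> W \<Longrightarrow> S_tensor g nabla u U G K L p = 0"
    and S_vertical: "open W \<Longrightarrow> W \<subseteq> N \<Longrightarrow> smooth_vf A W K \<Longrightarrow> p \<in> W \<Longrightarrow>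
      S_tensor g nabla u U G K U p = 0"
    and T_vertical: "open W \<Longrightarrow> W \<subseteq> N \<Longrightarrow> smooth_vf A W K \<Longrightarrow> p \<in> W \<Longrightarrow>
      T_tensor g nabla u U G K (V_of U) p = 0"
begin

abbreviation "v \<equiv> v_of u"
abbreviation "V \<equiv> V_of U"
abbreviation "H \<equiv> H_of G"
abbreviation "\<sigma> \<equiv> sigma_of g nabla U"

lemma linear_Jc: "linear (Jc :: complex^'k \<Rightarrow> complex^'k)"
  by (rule linearI) (auto simp: Jc_def vec_eq_iff algebra_simps)

lemma Jc_Jc: "Jc (Jc x) = - (x :: complex^'k)"
  by (simp add: Jc_def vec_eq_iff mult.assoc[symmetric])

lemmas Jc_linear [simp] = linear_add[OF linear_Jc] linear_diff[OF linear_Jc] linear_neg[OF linear_Jc]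
  linear_scale[OF linear_Jc] linear_0[OF linear_Jc] Jc_Jc

lemma linear_G: "p \<in> N \<Longrightarrow> linear (G p)"
  using smooth_G by (rule smooth_endo_linear)

lemma G_linear [simp]: assumes "p \<in> N"
  shows "G p (x + y) = G p x + G p y" "G p (x - y) = G p x - G p y" "G p (- x) = - G p x"
    "G p (c *\<^sub>R x) = c *\<^sub>R G p x" "G p 0 = 0"
  using assms by (simp_all add: linear_add[OF linear_G] linear_diff[OF linear_G]
      linear_neg[OF linear_G] linear_scale[OF linear_G] linear_0[OF linear_G])

lemma H_linear [simp]: assumes "p \<in> N"
  shows "H p (x + y) = H p x + H p y" "H p (x - y) = H p x - H p y" "H p (- x) = - H p x"
    "H p (c *\<^sub>R x) = c *\<^sub>R H p x" "H p 0 = 0"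
  using assms by (auto simp: H_of_def)

lemma g_Jc_left: "g p (Jc x) y = - g p x (Jc y)"
  using g_Jc[of p x "Jc y"] by simp

lemma v_eq: "p \<in> N \<Longrightarrow> v p x = g p x (V p)"
  by (simp add: v_of_def V_of_def u_eq g_Jc_left)

lemma g_U_V: "p \<in> N \<Longrightarrow> g p (U p) (V p) = 0"
  using g_Jc_left[of p "U p" "U p"] g_sym[of p "Jc (U p)" "U p"] by (simp add: V_of_def)

lemma g_V_V: "p \<in> N \<Longrightarrow> g p (V p) (V p) = 1"
  by (simp add: V_of_def g_Jc g_U_U)

lemma G_V: "p \<in> N \<Longrightarrow> G p (V p) = 0" and H_U: "p \<in> N \<Longrightarrow> H p (U p) = 0" and H_V: "p \<in> N \<Longrightarrow> H p (V p) = 0"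
  by (auto simp: V_of_def H_of_def G_Jc G_U)

lemma H_skew: "p \<in> N \<Longrightarrow> g p x (H p y) = - g p (H p x) y"
  using G_skew[of p x "Jc y"] g_Jc_left[of p "G p x" y] G_Jc[of p x] by (simp add: H_of_def)

lemma uv_UV: assumes "p \<in> N"
  shows "u p (U p) = 1" "u p (V p) = 0" "v p (U p) = 0" "v p (V p) = 1"
  using assms g_U_U g_U_V g_V_V g_sym by (auto simp: u_eq v_eq)

lemma uv_linear [simp]: assumes "p \<in> N"
  shows "u p (x + y) = u p x + u p y" "u p (x - y) = u p x - u p y" "u p (- x) = - u p x"
    "u p (c *\<^sub>R x) = c * u p x" "u p 0 = 0"
    "v p (x + y) = v p x + v p y" "v p (x - y) = v p x - v p y" "v p (- x) = - v p x"
    "v p (c *\<^sub>R x) = c * v p x" "v p 0 = 0"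
  using assms by (auto simp: u_eq v_eq)

lemma uv_image: assumes "p \<in> N"
  shows "u p (G p x) = 0" "v p (G p x) = 0" "u p (H p x) = 0" "v p (H p x) = 0"
proof -
  show "u p (G p x) = 0" using G_skew[OF assms, of x "U p"] by (simp add: assms u_eq G_U)
  show "v p (G p x) = 0" using G_skew[OF assms, of x "V p"] by (simp add: assms v_eq G_V)
  show "u p (H p x) = 0" using H_skew[OF assms, of x "U p"] by (simp add: assms u_eq H_U)
  show "v p (H p x) = 0" using H_skew[OF assms, of x "V p"] by (simp add: assms v_eq H_V)
qed

definition horizontal :: "'m \<Rightarrow> complex^'k \<Rightarrow> bool" where
  "horizontal p x \<longleftrightarrow> u p x = 0 \<and> v p x = 0"

lemma horizontal_image: "p \<in> N \<Longrightarrow> horizontal p (G p x)" "p \<in> N \<Longrightarrow> horizontal p (H p x)"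
  by (auto simp: horizontal_def uv_image)

lemma horizontal_G_G: "p \<in> N \<Longrightarrow> horizontal p x \<Longrightarrow> G p (G p x) = - x"
  and horizontal_H_H: "p \<in> N \<Longrightarrow> horizontal p x \<Longrightarrow> H p (H p x) = - x"
  by (auto simp: horizontal_def G_G H_H)

lemma horizontal_g: assumes "p \<in> N" "horizontal p x"
  shows "g p (U p) x = 0" "g p (V p) x = 0" "g p x (U p) = 0" "g p x (V p) = 0"
  using assms g_sym by (auto simp: horizontal_def u_eq v_eq)

lemma smooth_u_vf: "open W \<Longrightarrow> W \<subseteq> N \<Longrightarrow> smooth_vf A W X \<Longrightarrow> smooth_fun A W (\<lambda>q. u q (X q))"
  using smooth_u unfolding smooth_one_form_def by blast

lemma smooth_v_vf: "open W \<Longrightarrow> W \<subseteq> N \<Longrightarrow> smooth_vf A W X \<Longrightarrow> smooth_fun A W (\<lambda>q. v q (X q))"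
  using smooth_u_vf[OF _ _ smooth_vf_Jc, of W X] by (simp add: v_of_def)

lemma smooth_V: "smooth_vf A N V"
  using smooth_vf_uminus[OF openN smooth_vf_Jc[OF openN smooth_U]] by (simp add: V_of_def[abs_def])

lemma smooth_H: "smooth_endo A N H"
  unfolding smooth_endo_def
proof (intro conjI allI ballI impI)
  show "linear (H p)" if "p \<in> N" for p
    using linear_compose[OF linear_Jc linear_G[OF that]] by (simp add: H_of_def[abs_def] comp_def)
  show "smooth_vf A W (\<lambda>p. H p (X p))" if "open W \<and> W \<subseteq> N \<and> smooth_vf A W X" for W X
    using smooth_endo_vf[OF smooth_G _ _ smooth_vf_Jc, of W X] that by (simp add: H_of_def)
qed

lemma smooth_sigma: "open W \<Longrightarrow> W \<subseteq> N \<Longrightarrow> smooth_vf A W X \<Longrightarrow> smooth_fun A W (\<lambda>q. \<sigma> q (X q))"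
  unfolding sigma_of_def
  by (intro smooth_g smooth_nabla smooth_vf_subset[OF smooth_U] smooth_vf_subset[OF smooth_V])

lemma sigma_zero: "p \<in> N \<Longrightarrow> \<sigma> p 0 = 0"
  unfolding sigma_of_def using linear_0[OF linear_nabla[OF openN smooth_U]] by simp

text \<open>Coordinate fields commute, so only the two derivative terms of the exterior derivative
  survive; the factor 2 comes from the convention for \<open>2 d\<close>. The identities hold at
  every point of the chart inside \<open>N\<close>, so they can be differentiated once more.\<close>

lemma ext_d_coord:
  assumes c: "c \<in> A" "q \<in> fst c" and "q \<in> N"
  shows "dir_deriv A (\<lambda>q. u q (coord_field A c y q)) q (coord_field A c x q) -
      dir_deriv A (\<lambda>q. u q (coord_field A c x q)) q (coord_field A c y q) =
      2 * g q (coord_field A c x q) (G q (coord_field A c y q)) +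
      \<sigma> q (coord_field A c x q) * v q (coord_field A c y q) -
      \<sigma> q (coord_field A c y q) * v q (coord_field A c x q)" (is ?th1)
    and "dir_deriv A (\<lambda>q. v q (coord_field A c y q)) q (coord_field A c x q) -
      dir_deriv A (\<lambda>q. v q (coord_field A c x q)) q (coord_field A c y q) =
      2 * g q (coord_field A c x q) (H q (coord_field A c y q)) -
      (\<sigma> q (coord_field A c x q) * u q (coord_field A c y q) -
      \<sigma> q (coord_field A c y q) * u q (coord_field A c x q))" (is ?th2)
proof -
  let ?W = "N \<inter> fst c"
  have W: "open ?W" "?W \<subseteq> N" "q \<in> ?W"
    using openN atlas_chart(1)[OF atlas c(1)] assms by auto
  have X: "smooth_vf A ?W (coord_field A c w)" for w
    by (rule smooth_vf_subset[OF smooth_coord_field[OF c(1)]]) auto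
  show ?th1 using du[OF W(1,2) X X W(3), of x y] assms(3)
    by (simp add: ext_d_def wedge_def lie_bracket_coord_fields[OF c])
  show ?th2 using dv[OF W(1,2) X X W(3), of x y] assms(3)
    by (simp add: ext_d_def wedge_def lie_bracket_coord_fields[OF c] diff_divide_distrib)
qed

text \<open>The defect in the expected formula \<open>(\<nabla>_x G)y = \<sigma>(x) H y\<close>,
  paired with \<open>z\<close>. Extending \<open>y\<close> by a coordinate field makes it a function
  of vectors; by tensoriality any other extension gives the same value.\<close>

definition Om :: "'m \<Rightarrow> complex^'k \<Rightarrow> complex^'k \<Rightarrow> complex^'k \<Rightarrow> real" where
  "Om p x y z = g p (cov_endo nabla G p x (coord_field A (chart_at A p) y)) z - \<sigma> p x * g p (H p y) z"

lemma Om_eq: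
  assumes W: "open W" "W \<subseteq> N" "p \<in> W" and Y: "smooth_vf A W Y"
  shows "Om p x (Y p) z = g p (cov_endo nabla G p x Y) z - \<sigma> p x * g p (H p (Y p)) z"
proof -
  obtain W' where W': "open W'" "p \<in> W'" "W' \<subseteq> W"
    and c: "\<forall>w. smooth_vf A W' (coord_field A (chart_at A p) w)"
    using extend_vector[OF W(1,3)] by blast
  note c = c[rule_format]
  have G': "smooth_endo A W' G" using smooth_endo_subset[OF smooth_G] W(2) W'(3) by blast
  have "cov_endo nabla G p x (coord_field A (chart_at A p) (Y p)) = cov_endo nabla G p x Y"
    by (rule cov_endo_tensorial[OF W'(1,2) G' _ c smooth_vf_subset[OF Y W'(3)]])
      (use G_skew W(2) W'(3) in \<open>auto simp: coord_field_at\<close>)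
  then show ?thesis by (simp add: Om_def)
qed

lemma Om_skew:
  assumes p: "p \<in> N"
  shows "Om p x y z = - Om p x z y"
proof -
  obtain W' where W': "open W'" "p \<in> W'" "W' \<subseteq> N"
    and c: "\<forall>w. smooth_vf A W' (coord_field A (chart_at A p) w)"
    using extend_vector[OF openN p] by blast
  note c = c[rule_format]
  have G': "smooth_endo A W' G" using smooth_G W'(3) by (rule smooth_endo_subset)
  have sk: "g q x (G q y) = - g q (G q x) y" if "q \<in> W'" for q x y
    using G_skew W'(3) that by blast
  have "g p (cov_endo nabla G p x (coord_field A (chart_at A p) y)) z =
      - g p y (cov_endo nabla G p x (coord_field A (chart_at A p) z))"
    using cov_endo_skew[OF W'(1,2) G' sk c c, of x y z] by (simp add: coord_field_at)
  then show ?thesis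
    using H_skew[OF p, of y z] g_sym[of p y "H p z"]
      g_sym[of p y "cov_endo nabla G p x (coord_field A (chart_at A p) z)"] by (simp add: Om_def)
qed

text \<open>This is \<open>d(du) = 0\<close>, evaluated on commuting coordinate fields.\<close>

lemma Om_cyclic:
  assumes p: "p \<in> N" and h: "horizontal p x" "horizontal p y" "horizontal p z"
  shows "Om p x y z + Om p y z x + Om p z x y = 0"
proof -
  obtain W where W: "open W" "p \<in> W" "W \<subseteq> N" "W \<subseteq> fst (chart_at A p)"
    and c: "\<forall>w. smooth_vf A W (coord_field A (chart_at A p) w)"
    using extend_vector[OF openN p] by blast
  note c = c[rule_format]
  define X where "X = coord_field A (chart_at A p)"
  note X = c[folded X_def]
  have Xp: "X w p = w" for w by (simp add: X_def coord_field_at)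
  have br: "lie_bracket A (X a) (X b) p = 0" for a b
    unfolding X_def by (rule lie_bracket_coord_fields[OF chart_at])
  have GX: "smooth_vf A W (\<lambda>q. G q (X a q))" for a
    by (rule smooth_endo_vf[OF smooth_G W(1,3) X])
  \<comment> \<open>\<open>L a b\<close> is \<open>X_a(u(X_b))\<close>. Its antisymmetrization is
    twice \<open>du(X_a, X_b)\<close>, and since the fields commute, a further derivative can be
    exchanged with the one along \<open>X_a\<close>; this exchange is the content of
    \<open>d(du) = 0\<close>.\<close>
  define L where "L a b q = dir_deriv A (\<lambda>q. u q (X b q)) q (X a q)" for a b q
  have L: "dir_deriv A (\<lambda>q. L b c q) p a = dir_deriv A (\<lambda>q. L a c q) p b" for a b c
    using dir_deriv_lie_bracket[OF W(1,2) smooth_u_vf[OF W(1,3) X] X X, of c a b]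
      linear_0[OF linear_dir_deriv[OF smooth_fun_mdiff[OF W(1,2) smooth_u_vf[OF W(1,3) X[of c]]]]]
    by (simp add: br Xp L_def)
  \<comment> \<open>At \<open>p\<close> the arguments are horizontal, so derivatives of
    \<open>\<sigma>\<close> come multiplied by a vanishing value of \<open>v\<close>. Only
    derivatives of \<open>v\<close> survive, and the structure equation for \<open>dv\<close>
    evaluates these.\<close>
  have dL: "dir_deriv A (\<lambda>q. L a b q) p e - dir_deriv A (\<lambda>q. L b a q) p e =
      2 * (g p (nabla p e (X a)) (G p b) + g p a (nabla p e (\<lambda>q. G q (X b q)))) +
      \<sigma> p a * dir_deriv A (\<lambda>q. v q (X b q)) p e - \<sigma> p b * dir_deriv A (\<lambda>q. v q (X a q)) p e"
    if ab: "horizontal p a" "horizontal p b" for a b e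
  proof -
    have mL: "mdiff A (\<lambda>q. L a b q) p" for a b
      unfolding L_def by (rule mdiff_dir_deriv_field[OF W(1,2) smooth_u_vf[OF W(1,3) X] X])
    have m: "mdiff A (\<lambda>q. g q (X a q) (G q (X b q))) p" "mdiff A (\<lambda>q. \<sigma> q (X a q)) p"
      "mdiff A (\<lambda>q. v q (X a q)) p" for a b
      by (intro smooth_fun_mdiff[OF W(1,2)] smooth_g smooth_sigma smooth_v_vf W X GX)+
    have "dir_deriv A (\<lambda>q. L a b q) p e - dir_deriv A (\<lambda>q. L b a q) p e =
        dir_deriv A (\<lambda>q. L a b q - L b a q) p e"
      by (simp add: dir_deriv_diff mL)
    also have "\<dots> = dir_deriv A (\<lambda>q. 2 * g q (X a q) (G q (X b q)) +
        \<sigma> q (X a q) * v q (X b q) - \<sigma> q (X b q) * v q (X a q)) p e"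
      unfolding L_def X_def
      by (rule dir_deriv_cong[OF W(1,2)], rule ext_d_coord(1)[OF chart_at(1)]) (use W in auto)
    also have "\<dots> = 2 * dir_deriv A (\<lambda>q. g q (X a q) (G q (X b q))) p e +
        (\<sigma> p a * dir_deriv A (\<lambda>q. v q (X b q)) p e + dir_deriv A (\<lambda>q. \<sigma> q (X a q)) p e * v p b) -
        (\<sigma> p b * dir_deriv A (\<lambda>q. v q (X a q)) p e + dir_deriv A (\<lambda>q. \<sigma> q (X b q)) p e * v p a)"
      by (simp add: dir_deriv_diff dir_deriv_add dir_deriv_mult mdiff_add mdiff_mult mdiff_const
          dir_deriv_const m Xp)
    also have "dir_deriv A (\<lambda>q. g q (X a q) (G q (X b q))) p e =
        g p (nabla p e (X a)) (G p b) + g p a (nabla p e (\<lambda>q. G q (X b q)))"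
      using metric_connection[OF W(1) X GX W(2)] by (simp add: Xp)
    finally show ?thesis using ab by (simp add: horizontal_def)
  qed
  have dvp: "dir_deriv A (\<lambda>q. v q (X b q)) p a - dir_deriv A (\<lambda>q. v q (X a q)) p b = 2 * g p a (H p b)"
    if "horizontal p a" "horizontal p b" for a b
    using ext_d_coord(2)[OF chart_at p, of b a] that by (simp add: X_def coord_field_at horizontal_def)
  have dvs: "\<sigma> p e * dir_deriv A (\<lambda>q. v q (X b q)) p a - \<sigma> p e * dir_deriv A (\<lambda>q. v q (X a q)) p b =
      2 * (\<sigma> p e * g p a (H p b))" if "horizontal p a" "horizontal p b" for a b e
    unfolding right_diff_distrib[symmetric] dvp[OF that] by simp
  have tors: "nabla p a (X b) = nabla p b (X a)" for a b
    using torsion_free[OF W(1) X X W(2), of a b] by (simp add: Xp br)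
  have cov: "g p b (nabla p a (\<lambda>q. G q (X e q))) = - Om p a b e - \<sigma> p a * g p e (H p b) - g p (G p b) (nabla p a (X e))"
    for a b e
  proof -
    have "Om p a e b = g p (cov_endo nabla G p a (X e)) b - \<sigma> p a * g p (H p e) b"
      using Om_eq[OF W(1,3,2) X[of e]] by (simp add: Xp)
    then show ?thesis
      using Om_skew[OF p, of a e b] G_skew[OF p, of b "nabla p a (X e)"] H_skew[OF p, of e b]
        g_sym[of p _ b] by (simp add: cov_endo_def algebra_simps)
  qed
  \<comment> \<open>By torsion-freeness the derivatives of the coordinate fields themselves match in
    pairs and cancel in the cyclic sum, which leaves only \<open>Om\<close>.\<close>
  have s1: "g p (G p y) (nabla p x (X z)) = g p (nabla p z (X x)) (G p y)" for x y z
    using tors g_sym by metis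
  have "0 = (dir_deriv A (\<lambda>q. L x y q) p z - dir_deriv A (\<lambda>q. L y x q) p z) +
      (dir_deriv A (\<lambda>q. L y z q) p x - dir_deriv A (\<lambda>q. L z y q) p x) +
      (dir_deriv A (\<lambda>q. L z x q) p y - dir_deriv A (\<lambda>q. L x z q) p y)"
    using L[of x y z] L[of y z x] L[of z x y] by linarith
  then have "0 = (g p (nabla p z (X x)) (G p y) + g p x (nabla p z (\<lambda>q. G q (X y q)))) +
      (g p (nabla p x (X y)) (G p z) + g p y (nabla p x (\<lambda>q. G q (X z q)))) +
      (g p (nabla p y (X z)) (G p x) + g p z (nabla p y (\<lambda>q. G q (X x q)))) +
      \<sigma> p x * g p z (H p y) + \<sigma> p y * g p x (H p z) + \<sigma> p z * g p y (H p x)"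
    unfolding dL[OF h(1,2)] dL[OF h(2,3)] dL[OF h(3,1)]
    using dvs[OF h(3,2), of x] dvs[OF h(1,3), of y] dvs[OF h(2,1), of z] by argo
  then show ?thesis
    using cov[of x z y] cov[of y x z] cov[of z y x] s1[of y x z] s1[of z y x] s1[of x z y] by linarith
qed

text \<open>Projection along \<open>U\<close> and \<open>V\<close>. It makes an arbitrary local
  field horizontal on an open subset of \<open>N\<close>, as normality requires, and along M it
  extracts the \<open>D\<close>-component of a section of the sum of \<open>D\<close> and the
  vertical plane.\<close>

definition hor :: "('m \<Rightarrow> complex^'k) \<Rightarrow> 'm \<Rightarrow> complex^'k" where
  "hor X q = X q - u q (X q) *\<^sub>R U q - v q (X q) *\<^sub>R V q"

lemma smooth_hor: "open W \<Longrightarrow> W \<subseteq> N \<Longrightarrow> smooth_vf A W X \<Longrightarrow> smooth_vf A W (hor X)"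
  unfolding hor_def[abs_def]
  by (intro smooth_vf_diff smooth_vf_scale smooth_u_vf smooth_v_vf
      smooth_vf_subset[OF smooth_U] smooth_vf_subset[OF smooth_V])

lemma hor_horizontal: "p \<in> N \<Longrightarrow> horizontal p (hor X p)"
  by (simp add: hor_def horizontal_def uv_UV)

lemma hor_id: "horizontal p (X p) \<Longrightarrow> hor X p = X p"
  by (simp add: hor_def horizontal_def)

text \<open>Pair \<open>S(x, y) = 0\<close> with a horizontal \<open>z\<close>: the terms with
  \<open>U\<close>, \<open>V\<close> and \<open>v\<close> drop out, skewness moves the outer
  \<open>G\<close> onto \<open>z\<close>, and the four \<open>\<sigma>\<close> terms of
  \<open>S\<close> are exactly those subtracted in \<open>Om\<close>.\<close>

lemma Om_S:
  assumes p: "p \<in> N" and h: "horizontal p x" "horizontal p y" "horizontal p z"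
  shows "Om p (G p x) y z - Om p (G p y) x z + Om p x y (G p z) - Om p y x (G p z) = 0"
proof -
  obtain W where W: "open W" "p \<in> W" "W \<subseteq> N" "W \<subseteq> fst (chart_at A p)"
    and c: "\<forall>w. smooth_vf A W (coord_field A (chart_at A p) w)"
    using extend_vector[OF openN p] by blast
  note c = c[rule_format]
  \<comment> \<open>Normality is assumed for fields horizontal throughout \<open>W\<close>, so the
    coordinate fields are projected. They need not commute any more, but \<open>S\<close> is written
    in covariant derivatives and contains no brackets.\<close>
  define X where "X w = hor (coord_field A (chart_at A p) w)" for w
  have X: "smooth_vf A W (X w)" for w
    unfolding X_def by (rule smooth_hor[OF W(1,3) c])
  have Xp: "X w p = w" if "horizontal p w" for w
    using hor_id[of p "coord_field A (chart_at A p) w"] that by (simp add: X_def coord_field_at)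
  have hX: "u q (X w q) = 0 \<and> v q (X w q) = 0" if "q \<in> W" for w q
    using hor_horizontal[of q] that W(3) by (auto simp: X_def horizontal_def)
  have S: "S_tensor g nabla u U G (X x) (X y) p = 0"
    by (rule S_horizontal[OF W(1,3) X X _ W(2)]) (use hX in blast)
  have Om: "g p (cov_endo nabla G p w (X a)) b = Om p w a b + \<sigma> p w * g p (H p a) b"
    if "horizontal p a" for a b w
    using Om_eq[OF W(1,3,2) X[of a]] by (simp add: Xp[OF that])
  have hp: "v p x = 0" "v p y = 0" using h by (auto simp: horizontal_def)
  have Gs: "g p (G p a) z = - g p a (G p z)" for a
    using G_skew[OF p, of a z] by simp
  have "0 = cov_endo nabla G p (G p x) (X y) - cov_endo nabla G p (G p y) (X x)
      - G p (cov_endo nabla G p x (X y)) + G p (cov_endo nabla G p y (X x))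
      + (2 * g p x (G p y)) *\<^sub>R U p - (2 * g p x (H p y)) *\<^sub>R V p
      + \<sigma> p (G p y) *\<^sub>R H p x - \<sigma> p (G p x) *\<^sub>R H p y
      + \<sigma> p x *\<^sub>R G p (H p y) - \<sigma> p y *\<^sub>R G p (H p x)"
    using S unfolding S_tensor_def Let_def nijenhuis_def Xp[OF h(1)] Xp[OF h(2)] hp by simp
  then have "0 = g p (cov_endo nabla G p (G p x) (X y) - cov_endo nabla G p (G p y) (X x)
      - G p (cov_endo nabla G p x (X y)) + G p (cov_endo nabla G p y (X x))
      + (2 * g p x (G p y)) *\<^sub>R U p - (2 * g p x (H p y)) *\<^sub>R V p
      + \<sigma> p (G p y) *\<^sub>R H p x - \<sigma> p (G p x) *\<^sub>R H p y
      + \<sigma> p x *\<^sub>R G p (H p y) - \<sigma> p y *\<^sub>R G p (H p x)) z"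
    using g_linear(9) by metis
  then show ?thesis
    unfolding g_linear Gs Om[OF h(1)] Om[OF h(2)] horizontal_g[OF p h(3)] by simp
qed

text \<open>Writing \<open>\<Psi>(x,y,z)\<close> for the value at \<open>(Gx,y,z)\<close>, the cyclic identity turns \<open>Om_S\<close> into
  \<open>\<Psi>(x,y,z) + \<Psi>(y,z,x) = \<Psi>(z,x,y)\<close>; permuting cyclically, \<open>\<Psi> = 0\<close>.\<close>

lemma Om_zero:
  assumes p: "p \<in> N" and h: "horizontal p x" "horizontal p y" "horizontal p z"
  shows "Om p x y z = 0"
proof -
  have *: "Om p (G p x) y z + Om p (G p y) z x - Om p (G p z) x y = 0"
    if "horizontal p x" "horizontal p y" "horizontal p z" for x y z
    using Om_S[OF p that] Om_cyclic[OF p that(1,2) horizontal_image(1)[OF p], of z]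
      Om_skew[OF p, of "G p y" z x] Om_skew[OF p, of y x "G p z"] by linarith
  have "Om p (G p x) y z = 0" if "horizontal p x" "horizontal p y" "horizontal p z" for x y z
    using *[OF that] *[OF that(2,3,1)] *[OF that(3,1,2)] by linarith
  \<comment> \<open>Every horizontal vector is the image under \<open>G\<close> of a horizontal one,
    as \<open>x = G (G (- x))\<close>.\<close>
  from this[OF horizontal_image(1)[OF p] h(2,3), of "- x"] show ?thesis
    using horizontal_G_G[OF p, of "- x"] h(1) by (simp add: p horizontal_G_G)
qed

lemma cov_G_horizontal:
  assumes W: "open W" "W \<subseteq> N" "p \<in> W" and Y: "smooth_vf A W Y"
    and h: "horizontal p x" "horizontal p (Y p)" "horizontal p z"
  shows "g p (cov_endo nabla G p x Y) z = \<sigma> p x * g p (H p (Y p)) z"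
  using Om_eq[OF W Y, of x z] Om_zero[OF _ h] W(2,3) by auto

section \<open>Brackets with the vertical fields \<open>U\<close> and \<open>V\<close>\<close>

lemma G_bracket_U:
  assumes W: "open W" "W \<subseteq> N" "p \<in> W" and K: "smooth_vf A W K"
  shows "G p (lie_bracket A (\<lambda>q. G q (K q)) U p) =
    G p (G p (lie_bracket A K U p)) - \<sigma> p (U p) *\<^sub>R G p (H p (K p))"
proof -
  have p: "p \<in> N" using W by auto
  have "nijenhuis nabla G K U p =
      G p (G p (lie_bracket A K U p)) - G p (lie_bracket A (\<lambda>q. G q (K q)) U p)"
    by (rule nijenhuis_kernel[OF W(1,3) smooth_endo_subset[OF smooth_G W(2)] K
      smooth_vf_subset[OF smooth_U W(2)]]) (use G_U W(2) in auto)
  then show ?thesis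
    using S_vertical[OF W(1,2) K W(3)]
    by (simp add: S_tensor_def Let_def p G_U H_U uv_UV sigma_zero algebra_simps)
qed

lemma H_bracket_V:
  assumes W: "open W" "W \<subseteq> N" "p \<in> W" and K: "smooth_vf A W K"
  shows "H p (lie_bracket A (\<lambda>q. H q (K q)) V p) =
    H p (H p (lie_bracket A K V p)) - \<sigma> p (V p) *\<^sub>R G p (H p (K p))"
proof -
  have p: "p \<in> N" using W by auto
  have "nijenhuis nabla H K V p =
      H p (H p (lie_bracket A K V p)) - H p (lie_bracket A (\<lambda>q. H q (K q)) V p)"
    by (rule nijenhuis_kernel[OF W(1,3) smooth_endo_subset[OF smooth_H W(2)] K
      smooth_vf_subset[OF smooth_V W(2)]]) (use H_V W(2) in auto)
  then show ?thesis
    using T_vertical[OF W(1,2) K W(3)]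
    by (simp add: T_tensor_def Let_def p G_V H_V uv_UV sigma_zero algebra_simps)
qed

end

section \<open>Submanifolds\<close>

text \<open>Gram-Schmidt with respect to an arbitrary positive definite form, by induction on a
  spanning set. Normal vectors are measured by \<open>g p\<close>, not by the standard inner
  product.\<close>

lemma exists_orthogonal_projection:
  fixes b :: "'a::euclidean_space \<Rightarrow> 'a \<Rightarrow> real"
  assumes b: "bilinear b" "\<And>x y. b x y = b y x" "\<And>x. x \<noteq> 0 \<Longrightarrow> b x x > 0" and S: "subspace S"
  shows "\<exists>s\<in>S. \<forall>t\<in>S. b (x - s) t = 0"
proof -
  note lin = bilinear_ladd[OF b(1)] bilinear_radd[OF b(1)] bilinear_lsub[OF b(1)] bilinear_rsub[OF b(1)]
    bilinear_lmul[OF b(1)] bilinear_rmul[OF b(1)] bilinear_lzero[OF b(1)] bilinear_rzero[OF b(1)]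
  have "finite B \<Longrightarrow> \<exists>s\<in>span B. \<forall>t\<in>span B. b (x - s) t = 0" for B x
  proof (induction B arbitrary: x rule: finite_induct)
    case empty
    then show ?case by (simp add: lin)
  next
    case (insert a B)
    obtain a' where a': "a' \<in> span B" "\<forall>t\<in>span B. b (a - a') t = 0" using insert.IH by blast
    obtain s where s: "s \<in> span B" "\<forall>t\<in>span B. b (x - s) t = 0" using insert.IH by blast
    define c where "c = a - a'"
    \<comment> \<open>\<open>c\<close> is the part of the new vector orthogonal to the old span. If
      it vanishes, the span has not grown and the coefficient 0 is right.\<close>
    define k where "k = (if c = 0 then 0 else b (x - s) c / b c c)"
    have c: "b (x - s - k *\<^sub>R c) c = 0"
      using b(3)[of c] by (auto simp: k_def lin)
    have "a \<in> span (insert a B)" by (simp add: span_base)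
    then have c_in: "c \<in> span (insert a B)"
      unfolding c_def using a'(1) span_mono[of B "insert a B"] by (blast intro: span_diff)
    have "b (x - (s + k *\<^sub>R c)) t = 0" if tin: "t \<in> span (insert a B)" for t
    proof -
      obtain j where j: "t - j *\<^sub>R a \<in> span B" using tin span_breakdown_eq by blast
      define r where "r = t - j *\<^sub>R a + j *\<^sub>R a'"
      have r: "r \<in> span B" unfolding r_def using j a'(1) by (intro span_add span_scale) auto
      have t: "t = r + j *\<^sub>R c" by (simp add: r_def c_def algebra_simps)
      have "b (x - s - k *\<^sub>R c) r = 0"
        using r s(2) a'(2) by (simp add: lin c_def[symmetric])
      then have "b (x - s - k *\<^sub>R c) t = 0"
        using c unfolding t bilinear_radd[OF b(1)] bilinear_rmul[OF b(1)] by simp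
      then show ?thesis by (simp add: diff_diff_eq)
    qed
    moreover have "s + k *\<^sub>R c \<in> span (insert a B)"
      using s(1) span_mono[of B "insert a B"] c_in by (blast intro: span_add span_scale)
    ultimately show ?case by blast
  qed
  moreover obtain B where "finite B" "span B = S"
    using basis_subspace_exists[OF S] by (metis finiteI_independent)
  ultimately show ?thesis by blast
qed

locale submanifold = hermitian_manifold A g nabla
  for A :: "('m::{t2_space,second_countable_topology}, 'k::finite) chart set"
    and g :: "'m \<Rightarrow> complex^'k \<Rightarrow> complex^'k \<Rightarrow> real"
    and nabla :: "('m, 'k) conn" +
  fixes T :: "'m topology" and d :: nat
  assumes sub: "complex_submanifold A T d"
begin

lemma slice_chart:
  assumes "p \<in> topspace T"
  obtains c E P where "compatible_chart A c" "p \<in> fst c" "subspace E"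
    "P = {q \<in> fst c. snd c q \<in> E}" "p \<in> P" "openin T P" "subtopology T P = top_of_set P"
proof -
  obtain W \<phi> E P where "compatible_chart A (W, \<phi>)" "p \<in> W" "subspace E"
    "P = {q \<in> W. \<phi> q \<in> E}" "p \<in> P" "openin T P" "subtopology T P = top_of_set P"
    using sub assms unfolding complex_submanifold_def by meson
  then show thesis using that[of "(W, \<phi>)" E P] by simp
qed

text \<open>Slices are open in \<open>T\<close>, carry the ambient topology and cover M, so the
  claim can be checked slice by slice; \<open>T\<close> is at least as fine as the subspace
  topology.\<close>

lemma openin_inter_open:
  assumes "openin T P" "open Q"
  shows "openin T (P \<inter> Q)"
proof (subst openin_subopen, intro ballI)
  fix p assume p: "p \<in> P \<inter> Q"
  then have "p \<in> topspace T" using openin_subset[OF assms(1)] by blast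
  then obtain c E P' where P': "p \<in> P'" "openin T P'" "subtopology T P' = top_of_set P'"
    by (rule slice_chart)
  have "openin (subtopology T P') (P' \<inter> Q)"
    unfolding P'(3) using assms(2) by (rule openin_open_Int)
  then have "openin T (P' \<inter> Q)" using P'(2) by (rule openin_trans_full)
  then have "openin T (P \<inter> (P' \<inter> Q))" using assms(1) by blast
  then show "\<exists>S. openin T S \<and> p \<in> S \<and> S \<subseteq> P \<inter> Q" using p P'(1) by blast
qed

text \<open>A curve with velocity \<open>v\<close> stays in \<open>P\<close> for small times, and
  \<open>f\<close> is zero along it. Continuity into \<open>T\<close>, and not just into the ambient
  manifold, is what keeps the curve in \<open>P\<close>.\<close>

lemma dir_deriv_tangent_zero:
  assumes P: "openin T P" "p \<in> P" "\<And>q. q \<in> P \<Longrightarrow> f q = 0"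
    and f: "mdiff A f p" and v: "v \<in> tangent_space A T p"
  shows "dir_deriv A f p v = 0"
proof -
  let ?e = "chart_at A p"
  obtain \<gamma> :: "real \<Rightarrow> 'm" and \<epsilon> where e: "\<epsilon> > 0" and \<gamma>: "continuous_map (top_of_set {-\<epsilon><..<\<epsilon>}) T \<gamma>" "\<gamma> 0 = p"
    "((\<lambda>t. snd ?e (\<gamma> t)) has_vector_derivative v) (at 0)"
    using v by (auto simp: tangent_space_def)
  have P': "openin T (P \<inter> fst ?e)"
    by (rule openin_inter_open[OF P(1) atlas_chart(1)[OF atlas chart_at(1)]])
  define I where "I = {t \<in> {-\<epsilon><..<\<epsilon>}. \<gamma> t \<in> P \<inter> fst ?e}"
  have "openin (top_of_set {-\<epsilon><..<\<epsilon>}) I"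
    using openin_continuous_map_preimage[OF \<gamma>(1) P'] by (simp add: I_def)
  then have I: "open I" using openin_open_trans[OF _ open_greaterThanLessThan] by blast
  have I0: "0 \<in> I" using e \<gamma>(2) P(2) chart_at(2) by (simp add: I_def)
  let ?F = "\<lambda>x. f (chart_inv ?e x)"
  have F: "(?F has_derivative dir_deriv A f p) (at (snd ?e (\<gamma> 0)))"
    using has_frechet_derivative[OF f[unfolded mdiff_def]] by (simp add: dir_deriv_def[abs_def] \<gamma>(2))
  have "((\<lambda>t. ?F (snd ?e (\<gamma> t))) has_derivative (\<lambda>h. dir_deriv A f p (h *\<^sub>R v))) (at 0)"
    using has_derivative_compose[OF \<gamma>(3)[unfolded has_vector_derivative_def] F] .
  then have "((\<lambda>t. 0) has_derivative (\<lambda>h. dir_deriv A f p (h *\<^sub>R v))) (at (0::real))"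
    by (rule has_derivative_transform_within_open[OF _ I I0])
      (use atlas_chart(3)[OF atlas chart_at(1)] P(3) in \<open>auto simp: I_def\<close>)
  then have "(\<lambda>h::real. dir_deriv A f p (h *\<^sub>R v)) = (\<lambda>h. 0)"
    by (rule has_derivative_unique) simp
  from fun_cong[OF this, of 1] show ?thesis by simp
qed

text \<open>The difference of the extensions vanishes on \<open>P\<close>, hence so does its inner
  product with any field. The tangential derivative of that product is zero, and metric
  compatibility turns this into \<open>\<nabla>_w (Y - Z) = 0\<close>.\<close>

lemma nabla_extension_independent:
  assumes W: "open W" "p \<in> W" and Y: "smooth_vf A W Y" and Z: "smooth_vf A W Z"
    and P: "openin T P" "p \<in> P" "\<And>q. q \<in> P \<Longrightarrow> Y q = Z q" and w: "w \<in> tangent_space A T p"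
  shows "nabla p w Y = nabla p w Z"
proof -
  obtain W' where W': "open W'" "p \<in> W'" "W' \<subseteq> W"
    and c: "\<forall>w. smooth_vf A W' (coord_field A (chart_at A p) w)"
    using extend_vector[OF W] by blast
  define D where "D q = Y q - Z q" for q
  have D: "smooth_vf A W' D"
    unfolding D_def using smooth_vf_subset[OF smooth_vf_diff[OF W(1) Y Z] W'(3)] .
  have D0: "D q = 0" if "q \<in> P" for q using P(3)[OF that] by (simp add: D_def)
  have "g p (nabla p w D) x = 0" for x
  proof -
    let ?X = "coord_field A (chart_at A p) x"
    have "dir_deriv A (\<lambda>q. g q (D q) (?X q)) p w = 0"
      by (rule dir_deriv_tangent_zero[OF P(1,2) _ smooth_fun_mdiff[OF W'(1,2) smooth_g[OF W'(1) D]] w])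
        (simp_all add: D0 c)
    then show ?thesis
      using metric_connection[OF W'(1) D c[rule_format] W'(2), of x w] D0[OF P(2)]
      by (simp add: coord_field_at)
  qed
  then have "nabla p w D = 0" using g_self_zero by blast
  then show ?thesis using nabla_diff[OF W(1) Y Z W(2)] by (simp add: D_def[abs_def])
qed

text \<open>Linear functionals vanishing on \<open>E\<close> become, through the chart, functions
  vanishing on the slice. Tangent vectors annihilate these, and \<open>E\<close> is its own double
  orthogonal complement.\<close>

lemma tangent_slice:
  assumes c: "compatible_chart A c" "subspace E" "P = {q \<in> fst c. snd c q \<in> E}" "openin T P"
    and q: "q \<in> P" "v \<in> tangent_space A T q"
  shows "to_chart A c q v \<in> E"
proof -
  have qc: "q \<in> fst c" using q c(3) by simp
  have o: "open (fst c)" using atlas_chart(1)[OF compatible_atlas[OF c(1)]] by simp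
  have "to_chart A c q v \<bullet> y = 0" if "y \<in> E\<^sup>\<bottom>" for y
  proof -
    have "dir_deriv A (\<lambda>q. snd c q \<bullet> y) q v = 0"
      by (rule dir_deriv_tangent_zero[OF c(4) q(1) _ smooth_fun_mdiff[OF o qc smooth_chart_component[OF c(1)]] q(2)])
        (use that c(3) in \<open>auto simp: orthogonal_comp_def orthogonal_def\<close>)
    then show ?thesis by (simp add: dir_deriv_chart_component[OF c(1) qc])
  qed
  then have "to_chart A c q v \<in> E\<^sup>\<bottom>\<^sup>\<bottom>"
    by (simp add: orthogonal_comp_def orthogonal_def inner_commute)
  then show ?thesis by (simp add: orthogonal_comp_self[OF c(2)])
qed

lemma slice_tangent:
  assumes c: "compatible_chart A c" "subspace E" "P = {q \<in> fst c. snd c q \<in> E}" "openin T P"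
    "subtopology T P = top_of_set P"
    and q: "q \<in> P" and v: "to_chart A c q v \<in> E"
  shows "v \<in> tangent_space A T q"
proof -
  note B = compatible_atlas[OF c(1)]
  have cB: "c \<in> insert c A" and eB: "chart_at A q \<in> insert c A" using chart_at by auto
  note cc = atlas_chart[OF B cB]
  have qc: "q \<in> fst c" "snd c q \<in> E" using q c(3) by auto
  define w where "w = to_chart A c q v"
  \<comment> \<open>The straight line from the chart image of \<open>q\<close> in the direction
    \<open>w\<close> stays in \<open>E\<close>, so pulled back by the chart it is a curve in the
    slice with velocity \<open>v\<close>.\<close>
  define ray where "ray t = snd c q + t *\<^sub>R w" for t :: real
  have l0: "ray 0 = snd c q" by (simp add: ray_def)
  have lc: "continuous_on S ray" for S unfolding ray_def by (intro continuous_intros)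
  have "open (ray -` (snd c ` fst c))"
    using cc(2) by (rule open_vimage) (rule lc)
  moreover have "0 \<in> ray -` (snd c ` fst c)" using qc(1) l0 by simp
  ultimately obtain \<epsilon> where e: "\<epsilon> > 0" "ball 0 \<epsilon> \<subseteq> ray -` (snd c ` fst c)"
    by (rule openE)
  have e2: "ray t \<in> snd c ` fst c" if "\<bar>t\<bar> < \<epsilon>" for t
    using e(2) that by (auto simp: subset_eq)
  define \<gamma> where "\<gamma> t = chart_inv c (ray t)" for t
  have \<gamma>P: "\<gamma> t \<in> P" if "\<bar>t\<bar> < \<epsilon>" for t
  proof -
    have "ray t \<in> E" unfolding ray_def w_def
      using qc(2) v c(2) by (intro subspace_add subspace_scale) auto
    then show ?thesis using cc(4)[OF e2[OF that]] by (simp add: \<gamma>_def c(3))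
  qed
  have "continuous_on {-\<epsilon><..<\<epsilon>} \<gamma>"
    unfolding \<gamma>_def by (rule continuous_on_compose2[OF cc(6) lc]) (use e2 in auto)
  then have "continuous_map (top_of_set {-\<epsilon><..<\<epsilon>}) (subtopology T P) \<gamma>"
    unfolding c(5) using \<gamma>P by auto
  then have \<gamma>: "continuous_map (top_of_set {-\<epsilon><..<\<epsilon>}) T \<gamma>"
    by (rule continuous_map_into_fulltopology)
  have "(transition c (chart_at A q) has_derivative from_chart A c q) (at (ray 0))"
    unfolding l0 from_chart_def
    by (intro has_frechet_derivative transition_differentiable[OF B cB eB qc(1) chart_at(2)])
  moreover have "(ray has_derivative (\<lambda>t. t *\<^sub>R w)) (at 0)"
    unfolding ray_def by (auto intro!: derivative_eq_intros)
  ultimately have d: "((\<lambda>t. transition c (chart_at A q) (ray t)) has_derivative (\<lambda>t. from_chart A c q (t *\<^sub>R w))) (at 0)"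
    using has_derivative_compose by blast
  have "linear (from_chart A c q)"
    unfolding from_chart_def
    by (intro linear_frechet_derivative transition_differentiable[OF B cB eB qc(1) chart_at(2)])
  then have "((\<lambda>t. transition c (chart_at A q) (ray t)) has_vector_derivative from_chart A c q w) (at 0)"
    using d by (simp add: has_vector_derivative_def linear_scale)
  then have "((\<lambda>t. snd (chart_at A q) (\<gamma> t)) has_vector_derivative v) (at 0)"
    by (simp add: \<gamma>_def transition_def w_def from_chart_to_chart[OF c(1) qc(1)])
  moreover have "\<gamma> 0 = q" by (simp add: \<gamma>_def l0 cc(3)[OF qc(1)])
  ultimately show ?thesis using \<gamma> e(1) unfolding tangent_space_def by blast
qed

text \<open>Let \<open>f\<close> be a linear coordinate vanishing on the slice. For fields tangent
  along M, \<open>X f\<close> and \<open>Y f\<close> vanish on M near \<open>p\<close>; hence both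
  iterated derivatives at \<open>p\<close> are zero and the bracket annihilates
  \<open>f\<close>.\<close>

lemma lie_bracket_tangent:
  assumes W: "open W" and X: "smooth_vf A W X" and Y: "smooth_vf A W Y"
    and P: "openin T P" "p \<in> P" "P \<subseteq> W"
    and t: "\<And>q. q \<in> P \<Longrightarrow> X q \<in> tangent_space A T q \<and> Y q \<in> tangent_space A T q"
  shows "lie_bracket A X Y p \<in> tangent_space A T p"
proof -
  have "p \<in> topspace T" using openin_subset P by blast
  then obtain c E R where c: "compatible_chart A c" "subspace E" "R = {q \<in> fst c. snd c q \<in> E}"
    "openin T R" "subtopology T R = top_of_set R" and p: "p \<in> fst c" "p \<in> R"
    by (rule slice_chart)
  have o: "open (W \<inter> fst c)" "p \<in> W \<inter> fst c"
    using atlas_chart(1)[OF compatible_atlas[OF c(1)], of c] W P p(1) by auto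
  have X': "smooth_vf A (W \<inter> fst c) X" and Y': "smooth_vf A (W \<inter> fst c) Y"
    using X Y smooth_vf_subset by blast+
  have PR: "openin T (P \<inter> R)" "p \<in> P \<inter> R" using P c(4) p(2) by auto
  have "to_chart A c p (lie_bracket A X Y p) \<bullet> y = 0" if y: "y \<in> E\<^sup>\<bottom>" for y
  proof -
    let ?f = "\<lambda>q. snd c q \<bullet> y"
    have f: "smooth_fun A (W \<inter> fst c) ?f"
      using smooth_fun_subset[OF smooth_chart_component[OF c(1)]] by blast
    have z: "dir_deriv A (\<lambda>q. dir_deriv A ?f q (Z q)) p x = 0"
      if "smooth_vf A (W \<inter> fst c) Z" "\<And>q. q \<in> P \<Longrightarrow> Z q \<in> tangent_space A T q"
        "x \<in> tangent_space A T p" for Z x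
    proof (rule dir_deriv_tangent_zero[OF PR _ mdiff_dir_deriv_field[OF o f that(1)] that(3)])
      fix q assume q: "q \<in> P \<inter> R"
      then have "to_chart A c q (Z q) \<in> E"
        using tangent_slice[OF c(1-4)] that(2) by blast
      then show "dir_deriv A ?f q (Z q) = 0"
        using y q c(3) dir_deriv_chart_component[OF c(1)]
        by (auto simp: orthogonal_comp_def orthogonal_def)
    qed
    have "dir_deriv A ?f p (lie_bracket A X Y p) = 0"
      unfolding dir_deriv_lie_bracket[OF o f X' Y'] using z[OF X'] z[OF Y'] t P(2) by simp
    then show ?thesis by (simp add: dir_deriv_chart_component[OF c(1) p(1)])
  qed
  then have "to_chart A c p (lie_bracket A X Y p) \<in> E\<^sup>\<bottom>\<^sup>\<bottom>"
    by (simp add: orthogonal_comp_def orthogonal_def inner_commute)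
  then have "to_chart A c p (lie_bracket A X Y p) \<in> E" by (simp add: orthogonal_comp_self[OF c(2)])
  then show ?thesis by (rule slice_tangent[OF c p(2)])
qed

lemma some_extension:
  "local_extension A T p X Y \<Longrightarrow> local_extension A T p X (some_extension A T p X)"
  unfolding some_extension_def by (rule someI[of "local_extension A T p X"])

text \<open>The definition uses a chosen extension of \<open>L\<close>, which may be replaced by
  \<open>Y\<close> because \<open>K p\<close> is tangent. Existence of the normal part is orthogonal
  projection, and uniqueness is positivity of \<open>g\<close>.\<close>

lemma second_ff_characterization:
  assumes S: "subspace (tangent_space A T p)"
    and W: "open W" "smooth_vf A W Y" and P: "openin T P" "p \<in> P" "P \<subseteq> W" "\<And>q. q \<in> P \<Longrightarrow> Y q = L q"
    and K: "K p \<in> tangent_space A T p"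
  shows "second_ff A T g nabla K L p \<in> normal_vectors A T g p"
    "nabla p (K p) Y - second_ff A T g nabla K L p \<in> tangent_space A T p"
proof -
  let ?y = "nabla p (K p) Y"
  let ?Z = "some_extension A T p L"
  have "local_extension A T p L Y" unfolding local_extension_def using W P by blast
  from some_extension[OF this] obtain W' P' where W': "open W'" "smooth_vf A W' ?Z"
    and P': "openin T P'" "p \<in> P'" "P' \<subseteq> W'" "\<And>q. q \<in> P' \<Longrightarrow> ?Z q = L q"
    unfolding local_extension_def by blast
  have "nabla p (K p) Y = nabla p (K p) ?Z"
  proof (rule nabla_extension_independent)
    show "open (W \<inter> W')" "p \<in> W \<inter> W'" using W W' P P' by auto
    show "smooth_vf A (W \<inter> W') Y" "smooth_vf A (W \<inter> W') ?Z"
      using W(2) W'(2) smooth_vf_subset by blast+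
    show "openin T (P \<inter> P')" "p \<in> P \<inter> P'" using P P' by auto
    show "Y q = ?Z q" if "q \<in> P \<inter> P'" for q using that P(4) P'(4) by simp
  qed (rule K)
  then have ff: "second_ff A T g nabla K L p =
      (THE z. z \<in> normal_vectors A T g p \<and> ?y - z \<in> tangent_space A T p)"
    by (simp add: second_ff_def)
  have "\<exists>!z. z \<in> normal_vectors A T g p \<and> ?y - z \<in> tangent_space A T p"
  proof (rule ex_ex1I)
    obtain s where s: "s \<in> tangent_space A T p" "\<forall>t\<in>tangent_space A T p. g p (?y - s) t = 0"
      using exists_orthogonal_projection[OF bilinear_g g_sym g_pos S] by blast
    then show "\<exists>z. z \<in> normal_vectors A T g p \<and> ?y - z \<in> tangent_space A T p"
      by (intro exI[of _ "?y - s"]) (auto simp: normal_vectors_def)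
    fix z z' assume z: "z \<in> normal_vectors A T g p \<and> ?y - z \<in> tangent_space A T p"
      "z' \<in> normal_vectors A T g p \<and> ?y - z' \<in> tangent_space A T p"
    then have "(?y - z') - (?y - z) \<in> tangent_space A T p" using subspace_diff[OF S] by blast
    then have "z - z' \<in> tangent_space A T p" by simp
    then have "g p z (z - z') = 0" "g p z' (z - z') = 0" using z by (auto simp: normal_vectors_def)
    then have "g p (z - z') (z - z') = 0" by simp
    then show "z = z'" using g_self_zero by fastforce
  qed
  from theI'[OF this] show "second_ff A T g nabla K L p \<in> normal_vectors A T g p"
    "nabla p (K p) Y - second_ff A T g nabla K L p \<in> tangent_space A T p"
    unfolding ff by auto
qed

text \<open>Tangent remainders pair to zero with normal vectors, so two normal parts can be compared
  without computing either of them.\<close>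

lemma normal_part_eq:
  assumes S: "subspace (tangent_space A T p)"
    and a: "a \<in> normal_vectors A T g p" "x - a \<in> tangent_space A T p"
    and b: "b \<in> normal_vectors A T g p" "y - b \<in> tangent_space A T p"
  shows "a = b \<longleftrightarrow> (\<forall>\<xi>\<in>normal_vectors A T g p. g p (x - y) \<xi> = 0)"
proof -
  have g: "g p (x - y) \<xi> = g p (a - b) \<xi>" if "\<xi> \<in> normal_vectors A T g p" for \<xi>
  proof -
    have "g p (x - a) \<xi> = 0" "g p (y - b) \<xi> = 0"
      using that a b g_sym by (auto simp: normal_vectors_def simp del: g_linear)
    then show ?thesis by simp
  qed
  have "a - b \<in> normal_vectors A T g p" using a b by (simp add: normal_vectors_def)
  then show ?thesis using g g_self_zero[of p "a - b"] by auto
qed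

end

section \<open>Semi-invariant submanifolds\<close>

lemma span_pair: "x \<in> span {a, b} \<longleftrightarrow> (\<exists>s t. x = s *\<^sub>R a + t *\<^sub>R b)"
  for a b :: "'a::real_vector"
proof -
  have "x \<in> span {a, b} \<longleftrightarrow> (\<exists>s t. x - s *\<^sub>R a = t *\<^sub>R b)"
    by (auto simp: span_breakdown_eq[of x a "{b}"] span_singleton)
  then show ?thesis by (simp add: diff_eq_eq add.commute)
qed

locale contact_submanifold = contact_structure A g nabla N u U G + submanifold A g nabla T d
  for A :: "('m::{t2_space,second_countable_topology}, 'k::finite) chart set"
    and g :: "'m \<Rightarrow> complex^'k \<Rightarrow> complex^'k \<Rightarrow> real"
    and nabla :: "('m, 'k) conn"
    and N :: "'m set"
    and u :: "'m \<Rightarrow> complex^'k \<Rightarrow> real"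
    and U :: "'m \<Rightarrow> complex^'k"
    and G :: "'m \<Rightarrow> complex^'k \<Rightarrow> complex^'k"
    and T :: "'m topology" and d :: nat +
  fixes D D' :: "'m \<Rightarrow> (complex^'k) set"
  assumes subspace_D: "p \<in> topspace T \<Longrightarrow> p \<in> N \<Longrightarrow> subspace (D p)"
    and subspace_D': "p \<in> topspace T \<Longrightarrow> p \<in> N \<Longrightarrow> subspace (D' p)"
    and D_D': "p \<in> topspace T \<Longrightarrow> p \<in> N \<Longrightarrow> x \<in> D p \<Longrightarrow> z \<in> D' p \<Longrightarrow> g p x z = 0"
    and D_UV: "p \<in> topspace T \<Longrightarrow> p \<in> N \<Longrightarrow> x \<in> D p \<Longrightarrow> g p x (U p) = 0 \<and> g p x (V_of U p) = 0"
    and D'_UV: "p \<in> topspace T \<Longrightarrow> p \<in> N \<Longrightarrow> x \<in> D' p \<Longrightarrow> g p x (U p) = 0 \<and> g p x (V_of U p) = 0"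
    and tangent: "p \<in> topspace T \<Longrightarrow> p \<in> N \<Longrightarrow>
      tangent_space A T p = dist_sum (dist_sum D D') (\<lambda>q. span {U q, V_of U q}) p"
    and G_D: "p \<in> topspace T \<Longrightarrow> p \<in> N \<Longrightarrow> x \<in> D p \<Longrightarrow> G p x \<in> D p \<and> H_of G p x \<in> D p"
    and G_D': "p \<in> topspace T \<Longrightarrow> p \<in> N \<Longrightarrow> x \<in> D' p \<Longrightarrow>
      G p x \<in> normal_vectors A T g p \<and> H_of G p x \<in> normal_vectors A T g p"
begin

abbreviation "sp \<equiv> \<lambda>q. span {U q, V q}"

lemma tangentE:
  assumes "p \<in> topspace T" "p \<in> N" "x \<in> tangent_space A T p"
  obtains a b s t where "a \<in> D p" "b \<in> D' p" "x = a + b + (s *\<^sub>R U p + t *\<^sub>R V p)"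
  using assms(3) unfolding tangent[OF assms(1,2)] dist_sum_def by (auto simp: span_pair)

lemma tangentI:
  assumes "p \<in> topspace T" "p \<in> N" "a \<in> D p" "b \<in> D' p"
  shows "a + b + (s *\<^sub>R U p + t *\<^sub>R V p) \<in> tangent_space A T p"
  using assms(3,4) unfolding tangent[OF assms(1,2)] dist_sum_def by (auto simp: span_pair)

lemma subspace_tangent:
  assumes "p \<in> topspace T" "p \<in> N"
  shows "subspace (tangent_space A T p)"
proof -
  have "dist_sum X Y p = {x + y | x y. x \<in> X p \<and> y \<in> Y p}" for X Y :: "'m \<Rightarrow> (complex^'k) set"
    by (simp add: dist_sum_def)
  then show ?thesis
    unfolding tangent[OF assms]
    using subspace_sums[OF subspace_sums[OF subspace_D[OF assms] subspace_D'[OF assms]] subspace_span]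
    by simp
qed

lemma tangent_members:
  assumes "p \<in> topspace T" "p \<in> N"
  shows "U p \<in> tangent_space A T p" "V p \<in> tangent_space A T p" "D p \<subseteq> tangent_space A T p"
proof -
  note z = subspace_0[OF subspace_D[OF assms]] subspace_0[OF subspace_D'[OF assms]]
  show "U p \<in> tangent_space A T p" "V p \<in> tangent_space A T p"
    using tangentI[OF assms z, of 1 0] tangentI[OF assms z, of 0 1] by auto
  show "D p \<subseteq> tangent_space A T p"
    using tangentI[OF assms _ z(2), of _ 0 0] by auto
qed

lemma horizontal_D: "p \<in> topspace T \<Longrightarrow> p \<in> N \<Longrightarrow> x \<in> D p \<Longrightarrow> horizontal p x"
  and horizontal_D': "p \<in> topspace T \<Longrightarrow> p \<in> N \<Longrightarrow> x \<in> D' p \<Longrightarrow> horizontal p x"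
  using D_UV D'_UV by (auto simp: horizontal_def u_eq v_eq)

lemma normal_orthogonal:
  assumes "\<xi> \<in> normal_vectors A T g p" "x \<in> tangent_space A T p"
  shows "g p x \<xi> = 0" "g p \<xi> x = 0"
  using assms g_sym[of p x] by (auto simp: normal_vectors_def)

lemma horizontal_normal:
  assumes "p \<in> topspace T" "p \<in> N" "\<xi> \<in> normal_vectors A T g p"
  shows "horizontal p \<xi>"
  using normal_orthogonal(2)[OF assms(3)] tangent_members[OF assms(1,2)] assms(2)
  by (simp add: horizontal_def u_eq v_eq)

text \<open>The \<open>D'\<close>-part of a tangent vector vanishes as soon as it pairs to zero with
  itself. Involutivity thereby becomes a statement about pairings of brackets with
  \<open>D'\<close>.\<close>

lemma dist_sum_sp_iff:
  assumes p: "p \<in> topspace T" "p \<in> N" and x: "x \<in> tangent_space A T p"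
  shows "x \<in> dist_sum D sp p \<longleftrightarrow> (\<forall>z\<in>D' p. g p x z = 0)"
proof
  assume "x \<in> dist_sum D sp p"
  then obtain a s t where "a \<in> D p" "x = a + (s *\<^sub>R U p + t *\<^sub>R V p)"
    by (auto simp: dist_sum_def span_pair)
  then show "\<forall>z\<in>D' p. g p x z = 0"
    using D_D'[OF p] horizontal_g[OF p(2) horizontal_D'[OF p]] by simp
next
  assume z: "\<forall>z\<in>D' p. g p x z = 0"
  obtain a b s t where x: "a \<in> D p" "b \<in> D' p" "x = a + b + (s *\<^sub>R U p + t *\<^sub>R V p)"
    using tangentE[OF p x] .
  have "g p x b = 0" using z x(2) by blast
  then have "g p b b = 0"
    using D_D'[OF p x(1,2)] horizontal_g[OF p(2) horizontal_D'[OF p x(2)]] by (simp add: x(3))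
  then have "b = 0" by (rule g_self_zero)
  then show "x \<in> dist_sum D sp p"
    using x(1,3) by (auto simp: dist_sum_def span_pair)
qed

text \<open>The vertical coefficients are read off by \<open>u\<close> and \<open>v\<close>, which
  vanish on \<open>D\<close>. The explicit formula is what later shows that the
  \<open>D\<close>-component of a smooth section is smooth.\<close>

lemma dist_sum_sp_projection:
  assumes p: "p \<in> topspace T" "p \<in> N" and a: "a \<in> D p" "x - a \<in> sp p"
  shows "a = x - u p x *\<^sub>R U p - v p x *\<^sub>R V p"
proof -
  obtain s t where "x - a = s *\<^sub>R U p + t *\<^sub>R V p" using a(2) by (auto simp: span_pair)
  then have x: "x = a + (s *\<^sub>R U p + t *\<^sub>R V p)" by (simp add: algebra_simps)
  have "u p x = s" "v p x = t"
    using horizontal_D[OF p a(1)] p(2) by (simp_all add: x horizontal_def uv_UV)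
  then show ?thesis using x by simp
qed

text \<open>Smoothness of extensions refers to an ambient open set \<open>W\<close>, whereas values
  in \<open>D\<close> and agreement with the given fields are available only on \<open>P\<close>,
  open in M; hence two sets.\<close>

definition adapted :: "'m set \<Rightarrow> 'm set \<Rightarrow> 'm \<Rightarrow> bool" where
  "adapted W P p \<longleftrightarrow> open W \<and> W \<subseteq> N \<and> openin T P \<and> p \<in> P \<and> P \<subseteq> W"

lemma adaptedD:
  assumes "adapted W P p"
  shows "open W" "W \<subseteq> N" "openin T P" "p \<in> P" "P \<subseteq> W" "p \<in> W" "p \<in> N" "p \<in> topspace T"
    "\<And>q. q \<in> P \<Longrightarrow> q \<in> W" "\<And>q. q \<in> P \<Longrightarrow> q \<in> N" "\<And>q. q \<in> P \<Longrightarrow> q \<in> topspace T"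
  using assms openin_subset[of T P] by (auto simp: adapted_def)

lemma bracket_tangent:
  assumes "adapted W P p" "smooth_vf A W X" "smooth_vf A W Y"
    "\<And>q. q \<in> P \<Longrightarrow> X q \<in> tangent_space A T q" "\<And>q. q \<in> P \<Longrightarrow> Y q \<in> tangent_space A T q"
  shows "lie_bracket A X Y p \<in> tangent_space A T p"
  using lie_bracket_tangent[of W X Y P p] assms adaptedD(1,3-5)[OF assms(1)] by blast

lemma normal_part_iff_bracket:
  assumes ad: "adapted W P p" and K: "smooth_vf A W K" and L: "smooth_vf A W L"
    and KD: "\<And>q. q \<in> P \<Longrightarrow> K q \<in> D q" and LD: "\<And>q. q \<in> P \<Longrightarrow> L q \<in> D q"
  shows "(\<forall>\<xi>\<in>normal_vectors A T g p.
      g p (nabla p (K p) (\<lambda>q. G q (L q)) - nabla p (G p (K p)) L) \<xi> = 0) \<longleftrightarrow>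
    lie_bracket A K L p \<in> dist_sum D sp p"
proof -
  note a = adaptedD[OF ad]
  note p = a(8,7) and W = a(1,2,6)
  have GK: "smooth_vf A W (\<lambda>q. G q (K q))" and GL: "smooth_vf A W (\<lambda>q. G q (L q))"
    using smooth_endo_vf[OF smooth_G W(1,2)] K L by auto
  have tan: "K q \<in> tangent_space A T q" "L q \<in> tangent_space A T q" "G q (K q) \<in> tangent_space A T q"
    if "q \<in> P" for q
    using KD LD G_D tangent_members(3) a(10,11) that by blast+
  let ?b = "lie_bracket A K L p"
  have b: "?b \<in> tangent_space A T p" and b': "lie_bracket A (\<lambda>q. G q (K q)) L p \<in> tangent_space A T p"
    using bracket_tangent[OF ad K L] bracket_tangent[OF ad GK L] tan by auto
  have Kp: "K p \<in> D p" and Lp: "L p \<in> D p" using KD LD a(4) by auto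
  have g: "g p (nabla p (K p) (\<lambda>q. G q (L q)) - nabla p (G p (K p)) L) \<xi> = g p (G p ?b) \<xi>"
    if \<xi>: "\<xi> \<in> normal_vectors A T g p" for \<xi>
  proof -
    have "g p (cov_endo nabla G p x Y) \<xi> = 0" if "x \<in> D p" "Y p \<in> D p" "smooth_vf A W Y" for x Y
    proof -
      have "H p (Y p) \<in> tangent_space A T p" using G_D[OF p that(2)] tangent_members(3)[OF p] by blast
      then show ?thesis
        using cov_G_horizontal[OF W that(3) horizontal_D[OF p that(1)] horizontal_D[OF p that(2)]
            horizontal_normal[OF p \<xi>]] normal_orthogonal[OF \<xi>] by simp
    qed
    then have "g p (nabla p (K p) (\<lambda>q. G q (L q))) \<xi> = g p (G p (nabla p (K p) L)) \<xi>"
      "g p (nabla p (L p) (\<lambda>q. G q (K q))) \<xi> = g p (G p (nabla p (L p) K)) \<xi>"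
      using Kp Lp K L by (auto simp: cov_endo_def)
    \<comment> \<open>The derivative of \<open>L\<close> along \<open>GK\<close> is exchanged for
      the derivative of \<open>GK\<close> along \<open>L\<close> at the cost of
      \<open>[GK, L]\<close>, which is tangent because \<open>GK\<close> takes values in
      \<open>D\<close> along M.\<close>
    moreover have "nabla p (G p (K p)) L = nabla p (L p) (\<lambda>q. G q (K q)) + lie_bracket A (\<lambda>q. G q (K q)) L p"
      using torsion_free[OF W(1) GK L W(3)] by (simp add: diff_eq_eq add.commute)
    ultimately show ?thesis
      using normal_orthogonal(1)[OF \<xi> b'] p(2)
      by (simp add: torsion_free[OF W(1) K L W(3), symmetric])
  qed
  have "(\<forall>\<xi>\<in>normal_vectors A T g p. g p (G p ?b) \<xi> = 0) \<longleftrightarrow> (\<forall>z\<in>D' p. g p ?b z = 0)"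
  proof
    assume n: "\<forall>\<xi>\<in>normal_vectors A T g p. g p (G p ?b) \<xi> = 0"
    show "\<forall>z\<in>D' p. g p ?b z = 0"
    proof
      fix z assume z: "z \<in> D' p"
      \<comment> \<open>\<open>G z\<close> is normal, and \<open>g(G b, G z) = g(b, z)\<close>
        because \<open>z\<close> is horizontal.\<close>
      then have "g p (G p ?b) (G p z) = 0" using n G_D'[OF p] by blast
      then show "g p ?b z = 0"
        using G_skew[OF p(2), of ?b "G p z"] horizontal_G_G[OF p(2) horizontal_D'[OF p z]] by simp
    qed
  next
    assume "\<forall>z\<in>D' p. g p ?b z = 0"
    then have "?b \<in> dist_sum D sp p" using dist_sum_sp_iff[OF p b] by blast
    then obtain x s t where x: "x \<in> D p" "?b = x + (s *\<^sub>R U p + t *\<^sub>R V p)"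
      by (auto simp: dist_sum_def span_pair)
    have "G p ?b = G p x" using p(2) by (simp add: x(2) G_U G_V)
    then have "G p ?b \<in> tangent_space A T p" using G_D[OF p x(1)] tangent_members(3)[OF p] by auto
    then show "\<forall>\<xi>\<in>normal_vectors A T g p. g p (G p ?b) \<xi> = 0" using normal_orthogonal by blast
  qed
  then show ?thesis using g dist_sum_sp_iff[OF p b] by simp
qed

text \<open>Normality controls \<open>F\<close> applied to brackets of fields of the form
  \<open>F K0\<close>, and pairing with \<open>F z\<close> strips off the outer \<open>F\<close>.
  The pairs \<open>(G, U)\<close> and \<open>(H, V)\<close> satisfy the same relations and are
  handled together in \<open>main\<close>.\<close>

lemma bracket_D_U:
  assumes ad: "adapted W P p" and K: "smooth_vf A W K" and KD: "\<And>q. q \<in> P \<Longrightarrow> K q \<in> D q"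
    and z: "z \<in> D' p"
  shows "g p (lie_bracket A K U p) z = 0" "g p (lie_bracket A K V p) z = 0"
proof -
  note a = adaptedD[OF ad]
  note p = a(8,7) and W = a(1,2,6)
  have U: "smooth_vf A W U" and V: "smooth_vf A W V"
    using smooth_vf_subset smooth_U smooth_V W(2) by blast+
  have hK: "horizontal q (K q)" if "q \<in> P" for q
    using horizontal_D[OF a(11,10) KD] that by blast
  have Kt: "K p \<in> tangent_space A T p" using KD[OF a(4)] tangent_members(3)[OF p] by blast
  have main: "g p (lie_bracket A K X p) z = 0"
    if F: "smooth_endo A N F" and X: "smooth_vf A W X" "\<And>q. q \<in> N \<Longrightarrow> X q = U q \<or> X q = V q"
      and FD: "\<And>q x. q \<in> P \<Longrightarrow> x \<in> D q \<Longrightarrow> F q x \<in> D q"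
      and FF: "\<And>q x. q \<in> N \<Longrightarrow> horizontal q x \<Longrightarrow> F q (F q x) = - x"
      and Fz: "F p z \<in> normal_vectors A T g p"
      and Fs: "\<And>x y. g p x (F p y) = - g p (F p x) y"
      and br: "\<And>K. smooth_vf A W K \<Longrightarrow> F p (lie_bracket A (\<lambda>q. F q (K q)) X p) =
        F p (F p (lie_bracket A K X p)) - \<sigma> p (X p) *\<^sub>R G p (H p (K p))" for F X
  proof -
    \<comment> \<open>Chosen so that \<open>F K0\<close> equals \<open>K\<close> along M, where
      \<open>K\<close> is horizontal; off M the two may differ.\<close>
    define K0 where "K0 q = - F q (K q)" for q
    define K1 where "K1 q = F q (K0 q)" for q
    have K0: "smooth_vf A W K0" unfolding K0_def
      by (rule smooth_vf_uminus[OF W(1) smooth_endo_vf[OF F W(1,2) K]])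
    have K1: "smooth_vf A W K1" unfolding K1_def by (rule smooth_endo_vf[OF F W(1,2) K0])
    have K0D: "K0 q \<in> D q" if "q \<in> P" for q
      using FD[OF that KD[OF that]] subspace_neg[OF subspace_D[OF a(11,10)[OF that]]] by (simp add: K0_def)
    have K1K: "K1 q = K q" if "q \<in> P" for q
      using FF[OF a(10)[OF that] hK[OF that]] linear_neg[OF smooth_endo_linear[OF F a(10)[OF that]]]
      by (simp add: K1_def K0_def)
    have Xt: "X q \<in> tangent_space A T q" if "q \<in> P" for q
      using X(2)[OF a(10)[OF that]] tangent_members(1,2)[OF a(11,10)[OF that]] by auto
    \<comment> \<open>\<open>K1\<close> and \<open>K\<close> agree on \<open>P\<close> and
      \<open>X p\<close> is tangent, so their brackets with \<open>X\<close> at \<open>p\<close>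
      coincide.\<close>
    have "nabla p (X p) K1 = nabla p (X p) K"
      by (rule nabla_extension_independent[OF W(1,3) K1 K a(3,4) K1K Xt[OF a(4)]])
    then have same: "lie_bracket A K1 X p = lie_bracket A K X p"
      using torsion_free[OF W(1) K1 X(1) W(3)] torsion_free[OF W(1) K X(1) W(3)] K1K[OF a(4)] by simp
    let ?c = "lie_bracket A K0 X p"
    have c: "?c \<in> tangent_space A T p"
      by (rule bracket_tangent[OF ad K0 X(1)]) (use K0D Xt tangent_members(3)[OF a(11,10)] in auto)
    have "G p (H p (K0 p)) \<in> tangent_space A T p"
      using G_D[OF p] K0D[OF a(4)] tangent_members(3)[OF p] by blast
    then have e1: "g p (G p (H p (K0 p))) (F p z) = 0" using normal_orthogonal[OF Fz] by blast
    have FFz: "F p (F p z) = - z" using FF[OF p(2) horizontal_D'[OF p z]] .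
    have "g p (F p (F p ?c)) (F p z) = g p (F p ?c) z"
      using Fs[of "F p ?c" "F p z"] by (simp add: FFz)
    also have "\<dots> = 0" using Fs[of ?c z] normal_orthogonal[OF Fz c] by simp
    finally have e2: "g p (F p (F p ?c)) (F p z) = 0" .
    have "g p (lie_bracket A K X p) z = g p (F p (lie_bracket A K X p)) (F p z)"
      using Fs[of "lie_bracket A K X p" "F p z"] by (simp add: FFz)
    also have "F p (lie_bracket A K X p) = F p (F p ?c) - \<sigma> p (X p) *\<^sub>R G p (H p (K0 p))"
      using br[OF K0] same by (simp add: K1_def[abs_def])
    also have "g p \<dots> (F p z) = 0" using e1 e2 by simp
    finally show ?thesis .
  qed
  show "g p (lie_bracket A K U p) z = 0"
    by (rule main[OF smooth_G U]) (use G_D a(10,11) horizontal_G_G G_D'[OF p z] G_skew[OF p(2)]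
      G_bracket_U[OF W] in auto)
  show "g p (lie_bracket A K V p) z = 0"
    by (rule main[OF smooth_H V]) (use G_D a(10,11) horizontal_H_H G_D'[OF p z] H_skew[OF p(2)]
      H_bracket_V[OF W] in auto)
qed

text \<open>Take \<open>K = V\<close> in the identity from \<open>S(K, U) = 0\<close>. As
  \<open>G V = H V = 0\<close>, it says \<open>G (G [V, U]) = 0\<close>, so \<open>[V, U]\<close>
  lies in the span of \<open>U\<close> and \<open>V\<close>.\<close>

lemma bracket_V_U:
  assumes p: "p \<in> topspace T" "p \<in> N" and z: "z \<in> D' p"
  shows "g p (lie_bracket A V U p) z = 0"
proof -
  have GV: "smooth_vf A N (\<lambda>q. G q (V q))"
    by (rule smooth_endo_vf[OF smooth_G openN order_refl smooth_V])
  have "nabla p (U p) (\<lambda>q. G q (V q)) = 0"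
    using nabla_cong[OF openN p(2) GV, of "\<lambda>q. 0" "U p"] G_V by (simp add: nabla_zero)
  then have "lie_bracket A (\<lambda>q. G q (V q)) U p = 0"
    using torsion_free[OF openN GV smooth_U p(2)] linear_0[OF linear_nabla[OF openN smooth_U p(2)]]
    by (simp add: G_V p(2))
  then have "G p (G p (lie_bracket A V U p)) = 0"
    using G_bracket_U[OF openN order_refl p(2) smooth_V] by (simp add: p(2) H_V)
  then have "g p (- lie_bracket A V U p + u p (lie_bracket A V U p) *\<^sub>R U p +
      v p (lie_bracket A V U p) *\<^sub>R V p) z = 0"
    by (simp add: G_G p(2) del: g_linear) simp
  then show ?thesis using horizontal_g[OF p(2) horizontal_D'[OF p z]] by simp
qed

text \<open>Split \<open>K\<close> and \<open>L\<close> into horizontal and vertical parts.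
  Derivatives of the coefficients multiply \<open>U\<close> and \<open>V\<close>, which are
  orthogonal to \<open>z\<close>; the mixed terms are brackets of \<open>hor K\<close> and
  \<open>hor L\<close> with \<open>U\<close> and \<open>V\<close>, together with
  \<open>[V, U]\<close>, and none of these has a \<open>D'\<close>-component.\<close>

lemma bracket_hor:
  assumes ad: "adapted W P p" and K: "smooth_vf A W K" and L: "smooth_vf A W L"
    and KD: "\<And>q. q \<in> P \<Longrightarrow> hor K q \<in> D q" and LD: "\<And>q. q \<in> P \<Longrightarrow> hor L q \<in> D q"
    and z: "z \<in> D' p"
  shows "g p (lie_bracket A K L p) z = g p (lie_bracket A (hor K) (hor L) p) z"
proof -
  note a = adaptedD[OF ad]
  note p = a(8,7) and W = a(1,2,6)
  have U: "smooth_vf A W U" and V: "smooth_vf A W V"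
    using smooth_vf_subset smooth_U smooth_V W(2) by blast+
  note hz = horizontal_g[OF p(2) horizontal_D'[OF p z]]
  have hK: "smooth_vf A W (hor K)" and hL: "smooth_vf A W (hor L)"
    using smooth_hor[OF W(1,2)] K L by auto
  have n: "g p (nabla p w Y) z = g p (nabla p w (hor Y)) z + u p (Y p) * g p (nabla p w U) z +
      v p (Y p) * g p (nabla p w V) z" if Y: "smooth_vf A W Y" for Y w
  proof -
    have f: "smooth_fun A W (\<lambda>q. u q (Y q))" "smooth_fun A W (\<lambda>q. v q (Y q))"
      using smooth_u_vf[OF W(1,2) Y] smooth_v_vf[OF W(1,2) Y] .
    have s: "smooth_vf A W (\<lambda>q. u q (Y q) *\<^sub>R U q)" "smooth_vf A W (\<lambda>q. v q (Y q) *\<^sub>R V q)"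
      using smooth_vf_scale[OF W(1)] f U V by auto
    have "Y = (\<lambda>q. (hor Y q + u q (Y q) *\<^sub>R U q) + v q (Y q) *\<^sub>R V q)"
      by (simp add: hor_def)
    then have "nabla p w Y = nabla p w (\<lambda>q. (hor Y q + u q (Y q) *\<^sub>R U q) + v q (Y q) *\<^sub>R V q)"
      by simp
    also have "\<dots> = nabla p w (hor Y) + nabla p w (\<lambda>q. u q (Y q) *\<^sub>R U q) + nabla p w (\<lambda>q. v q (Y q) *\<^sub>R V q)"
      using nabla_add[OF W(1) smooth_vf_add[OF W(1) smooth_hor[OF W(1,2) Y] s(1)] s(2) W(3)]
        nabla_add[OF W(1) smooth_hor[OF W(1,2) Y] s(1) W(3)] by simp
    finally show ?thesis
      by (simp add: nabla_scale[OF W(1) U f(1) W(3)] nabla_scale[OF W(1) V f(2) W(3)] hz)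
  qed
  have lin: "nabla p (hor X p + (s *\<^sub>R U p + t *\<^sub>R V p)) Y =
      nabla p (hor X p) Y + (s *\<^sub>R nabla p (U p) Y + t *\<^sub>R nabla p (V p) Y)"
    if "smooth_vf A W Y" for X s t Y
    by (simp add: linear_add[OF linear_nabla[OF W(1) that W(3)]]
        linear_scale[OF linear_nabla[OF W(1) that W(3)]])
  have dec: "X p = hor X p + (u p (X p) *\<^sub>R U p + v p (X p) *\<^sub>R V p)" for X
    by (simp add: hor_def)
  have t: "g p (nabla p (X p) Y) z - g p (nabla p (Y p) X) z = g p (lie_bracket A X Y p) z"
    if "smooth_vf A W X" "smooth_vf A W Y" for X Y
    using torsion_free[OF W(1) that W(3)] by (metis g_linear(3))
  have e: "g p (nabla p (K p) Y) z = g p (nabla p (hor K p) Y) z +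
      u p (K p) * g p (nabla p (U p) Y) z + v p (K p) * g p (nabla p (V p) Y) z"
    "g p (nabla p (L p) Y) z = g p (nabla p (hor L p) Y) z +
      u p (L p) * g p (nabla p (U p) Y) z + v p (L p) * g p (nabla p (V p) Y) z"
    if "smooth_vf A W Y" for Y
    by (subst dec[of K], simp add: lin[OF that]) (subst dec[of L], simp add: lin[OF that])
  \<comment> \<open>The vanishing \<open>D'\<close>-parts of the brackets, read through
    torsion-freeness as symmetries of covariant derivatives.\<close>
  have zero: "g p (nabla p (hor K p) U) z = g p (nabla p (U p) (hor K)) z"
    "g p (nabla p (hor K p) V) z = g p (nabla p (V p) (hor K)) z"
    "g p (nabla p (hor L p) U) z = g p (nabla p (U p) (hor L)) z"
    "g p (nabla p (hor L p) V) z = g p (nabla p (V p) (hor L)) z"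
    "g p (nabla p (V p) U) z = g p (nabla p (U p) V) z"
    using t[OF hK U] t[OF hK V] t[OF hL U] t[OF hL V] t[OF V U]
      bracket_D_U[OF ad hK KD z] bracket_D_U[OF ad hL LD z] bracket_V_U[OF p z] by simp_all
  show ?thesis
    unfolding t[OF K L, symmetric] t[OF hK hL, symmetric] n[OF L] n[OF K]
      e(1)[OF hL] e(1)[OF U] e(1)[OF V] e(2)[OF hK] e(2)[OF U] e(2)[OF V] zero
    by (simp add: algebra_simps)
qed

text \<open>The primed fields are the sections, known along M only; the unprimed ones are local
  extensions, to which bracket and connection apply.\<close>

lemma second_ff_eq_iff:
  assumes ad: "adapted W P p" and K: "smooth_vf A W K" and L: "smooth_vf A W L"
    and KD: "\<And>q. q \<in> P \<Longrightarrow> K q \<in> D q" and LD: "\<And>q. q \<in> P \<Longrightarrow> L q \<in> D q"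
    and eq: "\<And>q. q \<in> P \<Longrightarrow> K q = K' q" "\<And>q. q \<in> P \<Longrightarrow> L q = L' q"
  shows "second_ff A T g nabla K' (\<lambda>q. G q (L' q)) p = second_ff A T g nabla (\<lambda>q. G q (K' q)) L' p \<longleftrightarrow>
    lie_bracket A K L p \<in> dist_sum D sp p"
proof -
  note a = adaptedD[OF ad]
  note p = a(8,7) and W = a(1,2,6)
  have GL: "smooth_vf A W (\<lambda>q. G q (L q))"
    using smooth_endo_vf[OF smooth_G W(1,2) L] .
  have K': "K' p = K p" using eq(1)[OF a(4)] by simp
  have t: "K' p \<in> tangent_space A T p" "G p (K' p) \<in> tangent_space A T p"
    using KD[OF a(4)] G_D[OF p] tangent_members(3)[OF p] K' by auto
  have iff: "lie_bracket A K L p \<in> dist_sum D sp p \<longleftrightarrow> (\<forall>\<xi>\<in>normal_vectors A T g p.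
      g p (nabla p (K' p) (\<lambda>q. G q (L q)) - nabla p (G p (K' p)) L) \<xi> = 0)"
    using normal_part_iff_bracket[OF ad K L KD LD] unfolding K' by blast
  show ?thesis
    unfolding iff
  proof (rule normal_part_eq[OF subspace_tangent[OF p]])
    show "second_ff A T g nabla K' (\<lambda>q. G q (L' q)) p \<in> normal_vectors A T g p"
      "nabla p (K' p) (\<lambda>q. G q (L q)) - second_ff A T g nabla K' (\<lambda>q. G q (L' q)) p \<in> tangent_space A T p"
      using second_ff_characterization[where Y = "\<lambda>q. G q (L q)" and K = K' and L = "\<lambda>q. G q (L' q)",
        OF subspace_tangent[OF p] W(1) GL a(3-5)] eq(2) t(1) by auto
    show "second_ff A T g nabla (\<lambda>q. G q (K' q)) L' p \<in> normal_vectors A T g p"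
      "nabla p (G p (K' p)) L - second_ff A T g nabla (\<lambda>q. G q (K' q)) L' p \<in> tangent_space A T p"
      using second_ff_characterization[where Y = L and K = "\<lambda>q. G q (K' q)" and L = L',
        OF subspace_tangent[OF p] W(1) L a(3-5)] eq(2) t(2) by auto
  qed
qed

lemma extension_adapted:
  assumes p: "p \<in> topspace T" "p \<in> N"
    and K: "local_extension A T p K Y" and L: "local_extension A T p L Z"
  shows "\<exists>W P. adapted W P p \<and> smooth_vf A W Y \<and> smooth_vf A W Z \<and>
    (\<forall>q\<in>P. Y q = K q \<and> Z q = L q)"
proof -
  obtain W1 P1 where 1: "open W1" "smooth_vf A W1 Y" "openin T P1" "p \<in> P1" "P1 \<subseteq> W1" "\<And>q. q \<in> P1 \<Longrightarrow> Y q = K q"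
    using K unfolding local_extension_def by blast
  obtain W2 P2 where 2: "open W2" "smooth_vf A W2 Z" "openin T P2" "p \<in> P2" "P2 \<subseteq> W2" "\<And>q. q \<in> P2 \<Longrightarrow> Z q = L q"
    using L unfolding local_extension_def by blast
  have "openin T (P1 \<inter> P2 \<inter> N)" using openin_inter_open[OF _ openN] 1(3) 2(3) by blast
  then have "adapted (W1 \<inter> W2 \<inter> N) (P1 \<inter> P2 \<inter> N) p"
    using 1 2 p openN by (auto simp: adapted_def)
  moreover have "smooth_vf A (W1 \<inter> W2 \<inter> N) Y" "smooth_vf A (W1 \<inter> W2 \<inter> N) Z"
    by (rule smooth_vf_subset[OF 1(2)], blast) (rule smooth_vf_subset[OF 2(2)], blast)
  moreover have "\<forall>q\<in>P1 \<inter> P2 \<inter> N. Y q = K q \<and> Z q = L q" using 1(6) 2(6) by blast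
  ultimately show ?thesis by (intro exI conjI)
qed

end

section \<open>Passing from the indexed structure to a single neighbourhood\<close>

lemma contact_structure_nbhd:
  assumes M: "normal_complex_contact_metric_manifold A m I N \<omega> g nabla u U G" and i: "i \<in> I"
  shows "contact_structure A g nabla (N i) (u i) (U i) (G i)"
proof -
  have C: "complex_contact_manifold A m I N \<omega>" "complex_almost_contact_metric A I N g u U G"
    "levi_civita A g nabla"
    and ker: "\<And>p. p \<in> N i \<Longrightarrow> {x. \<omega> i p x = 0} = {x. u i p x = 0 \<and> v_of (u i) p x = 0}"
    and ext: "\<And>W K L p. open W \<Longrightarrow> W \<subseteq> N i \<Longrightarrow> smooth_vf A W K \<Longrightarrow> smooth_vf A W L \<Longrightarrow> p \<in> W \<Longrightarrow>
        ext_d A (u i) K L p = g p (K p) (G i p (L p)) +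
          wedge (sigma_of g nabla (U i) p) (v_of (u i) p) (K p) (L p) \<and>
        ext_d A (v_of (u i)) K L p = g p (K p) (H_of (G i) p (L p)) -
          wedge (sigma_of g nabla (U i) p) (u i p) (K p) (L p)"
    using M i unfolding normal_complex_contact_metric_manifold_def complex_contact_metric_manifold_def
    by blast+
  have S: "\<forall>W K. open W \<and> W \<subseteq> N i \<and> smooth_vf A W K \<longrightarrow>
        (\<forall>L. smooth_vf A W L \<and> (\<forall>p\<in>W. \<omega> i p (K p) = 0 \<and> \<omega> i p (L p) = 0) \<longrightarrow>
           (\<forall>p\<in>W. S_tensor g nabla (u i) (U i) (G i) K L p = 0 \<and>
                   T_tensor g nabla (u i) (U i) (G i) K L p = 0)) \<and>
        (\<forall>p\<in>W. S_tensor g nabla (u i) (U i) (G i) K (U i) p = 0 \<and>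
                T_tensor g nabla (u i) (U i) (G i) K (V_of (U i)) p = 0)"
    using M i unfolding normal_complex_contact_metric_manifold_def by blast
  have atlas: "complex_atlas A" and nbhd: "coordinate_nbhd A (N i)"
    using C(1) i unfolding complex_contact_manifold_def by blast+
  have herm: "hermitian_metric A g" and sm: "smooth_one_form A (N i) (u i)"
    "smooth_vf A (N i) (U i)" "smooth_endo A (N i) (G i)"
    and pt: "\<forall>p\<in>N i.
           g p (U i p) (U i p) = 1 \<and> (\<forall>x. u i p x = g p x (U i p)) \<and>
           (\<forall>x. G i p (G i p x) = - x + u i p x *\<^sub>R U i p + v_of (u i) p x *\<^sub>R V_of (U i) p) \<and>
           (\<forall>x. H_of (G i) p (H_of (G i) p x) =
                  - x + u i p x *\<^sub>R U i p + v_of (u i) p x *\<^sub>R V_of (U i) p) \<and>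
           (\<forall>x. G i p (Jc x) = - Jc (G i p x)) \<and>
           G i p (U i p) = 0 \<and>
           (\<forall>x y. g p x (G i p y) = - g p (G i p x) y)"
    using C(2) i unfolding complex_almost_contact_metric_def by blast+
  show ?thesis
  proof
    show "complex_atlas A" "hermitian_metric A g" "levi_civita A g nabla" by fact+
    obtain \<phi> where "compatible_chart A (N i, \<phi>)" using nbhd by (auto simp: coordinate_nbhd_def)
    then have "complex_atlas (insert (N i, \<phi>) A)" by (simp add: compatible_chart_def)
    from atlas_chart(1)[OF this, of "(N i, \<phi>)"] show "open (N i)" by simp
    show "S_tensor g nabla (u i) (U i) (G i) K L p = 0"
      if "open W" "W \<subseteq> N i" "smooth_vf A W K" "smooth_vf A W L"
        "\<And>q. q \<in> W \<Longrightarrow> u i q (K q) = 0 \<and> v_of (u i) q (K q) = 0 \<and> u i q (L q) = 0 \<and> v_of (u i) q (L q) = 0"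
        "p \<in> W" for W K L p
    proof -
      have "\<omega> i q (K q) = 0 \<and> \<omega> i q (L q) = 0" if "q \<in> W" for q
        using ker[of q] \<open>W \<subseteq> N i\<close> that \<open>\<And>q. q \<in> W \<Longrightarrow> _ q\<close> by blast
      then show ?thesis using S that by blast
    qed
  qed (use sm pt ext S in blast)+
qed

text \<open>On an overlap, \<open>u j = c u i - d v i\<close> dualizes through the metric to
  \<open>U j = c U i - d V i\<close>, and applying \<open>- J\<close> gives
  \<open>V j = d U i + c V i\<close>; so the plane does not depend on the index.\<close>

lemma UV_span_nbhd:
  assumes M: "normal_complex_contact_metric_manifold A m I N \<omega> g nabla u U G"
    and i: "i \<in> I" and p: "p \<in> N i"
  shows "UV_span I N U p = span {U i p, V_of (U i) p}"
proof -
  interpret i: contact_structure A g nabla "N i" "u i" "U i" "G i"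
    by (rule contact_structure_nbhd[OF M i])
  have "U j p \<in> span {U i p, V_of (U i) p} \<and> V_of (U j) p \<in> span {U i p, V_of (U i) p}"
    if j: "j \<in> I" "p \<in> N j" for j
  proof -
    interpret j: contact_structure A g nabla "N j" "u j" "U j" "G j"
      by (rule contact_structure_nbhd[OF M j(1)])
    have "complex_almost_contact_metric A I N g u U G"
      using M unfolding normal_complex_contact_metric_manifold_def complex_contact_metric_manifold_def by blast
    then have "\<exists>c d. \<forall>p\<in>N i \<inter> N j. \<forall>x. u j p x = c p * u i p x - d p * v_of (u i) p x"
      using i j(1) unfolding complex_almost_contact_metric_def by meson
    then obtain c d where "\<And>x. u j p x = c p * u i p x - d p * v_of (u i) p x"
      using p j(2) by blast
    then have "g p x (U j p - (c p *\<^sub>R U i p - d p *\<^sub>R V_of (U i) p)) = 0" for x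
      using i.u_eq[OF p] i.v_eq[OF p] j.u_eq[OF j(2)] by simp
    then have "U j p - (c p *\<^sub>R U i p - d p *\<^sub>R V_of (U i) p) = 0"
      using i.g_self_zero by blast
    then have U: "U j p = c p *\<^sub>R U i p + (- d p) *\<^sub>R V_of (U i) p" by simp
    then have "V_of (U j) p = d p *\<^sub>R U i p + c p *\<^sub>R V_of (U i) p"
      by (simp add: V_of_def)
    then show ?thesis using U span_pair by blast
  qed
  then have "{w. \<exists>i\<in>I. p \<in> N i \<and> (w = U i p \<or> w = V_of (U i) p)} \<subseteq> span {U i p, V_of (U i) p}"
    by blast
  moreover have "{U i p, V_of (U i) p} \<subseteq> {w. \<exists>i\<in>I. p \<in> N i \<and> (w = U i p \<or> w = V_of (U i) p)}"
    using i p by blast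
  ultimately show ?thesis
    unfolding UV_span_def using span_mono span_minimal[OF _ subspace_span] by (intro equalityI) blast+
qed

lemma contact_submanifold_nbhd:
  assumes M: "normal_complex_contact_metric_manifold A m I N \<omega> g nabla u U G"
    and S: "semi_invariant_submanifold A I N g U G T n D D'" and i: "i \<in> I"
  shows "contact_submanifold A g nabla (N i) (u i) (U i) (G i) T (n + 2) D D'"
proof -
  interpret contact_structure A g nabla "N i" "u i" "U i" "G i"
    by (rule contact_structure_nbhd[OF M i])
  note UV = UV_span_nbhd[OF M i]
  have sub: "complex_submanifold A T (n + 2)" and sd: "smooth_distribution A T D" "smooth_distribution A T D'"
    and o: "orthogonal_dists T g D D'" "orthogonal_dists T g D (UV_span I N U)"
      "orthogonal_dists T g D' (UV_span I N U)"
    and t: "\<And>p. p \<in> topspace T \<Longrightarrow> tangent_space A T p = dist_sum (dist_sum D D') (UV_span I N U) p"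
    and im: "\<And>p. p \<in> topspace T \<Longrightarrow> p \<in> N i \<Longrightarrow> G i p ` D p = D p \<and> H_of (G i) p ` D p = D p \<and>
        G i p ` D' p \<subseteq> normal_vectors A T g p \<and> H_of (G i) p ` D' p \<subseteq> normal_vectors A T g p"
    using S i unfolding semi_invariant_submanifold_def by blast+
  show ?thesis
  proof
    show "complex_submanifold A T (n + 2)" by fact
    fix p assume p: "p \<in> topspace T" "p \<in> N i"
    show "subspace (D p)" "subspace (D' p)"
      using sd p(1) unfolding smooth_distribution_def by blast+
    show "g p x z = 0" if "x \<in> D p" "z \<in> D' p" for x z
      using o(1) p(1) that unfolding orthogonal_dists_def by blast
    have "U i p \<in> UV_span I N U p" "V_of (U i) p \<in> UV_span I N U p"
      using UV[OF p(2)] by (simp_all add: span_base)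
    then have o': "\<forall>x\<in>D p \<union> D' p. g p x (U i p) = 0 \<and> g p x (V_of (U i) p) = 0"
      using o(2,3) p(1) unfolding orthogonal_dists_def by blast
    show "g p x (U i p) = 0 \<and> g p x (V_of (U i) p) = 0" if "x \<in> D p" for x
      using o' that by blast
    show "g p x (U i p) = 0 \<and> g p x (V_of (U i) p) = 0" if "x \<in> D' p" for x
      using o' that by blast
    show "tangent_space A T p = dist_sum (dist_sum D D') (\<lambda>q. span {U i q, V_of (U i) q}) p"
      using t[OF p(1)] UV[OF p(2)] by (simp add: dist_sum_def)
    show "G i p x \<in> D p \<and> H_of (G i) p x \<in> D p" if "x \<in> D p" for x
      using im[OF p] that by blast
    show "G i p x \<in> normal_vectors A T g p \<and> H_of (G i) p x \<in> normal_vectors A T g p" if "x \<in> D' p" for x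
      using im[OF p] that by blast
  qed
qed

theorem theorem5p9:
  fixes A :: "('m::{t2_space,second_countable_topology}, 'k::finite) chart set"
    and m n :: nat
    and I :: "'i set" and N :: "'i \<Rightarrow> 'm set"
    and \<omega> :: "'i \<Rightarrow> 'm \<Rightarrow> complex^'k \<Rightarrow> complex"
    and g :: "'m \<Rightarrow> complex^'k \<Rightarrow> complex^'k \<Rightarrow> real"
    and nabla :: "('m, 'k) conn"
    and u :: "'i \<Rightarrow> 'm \<Rightarrow> complex^'k \<Rightarrow> real"
    and U :: "'i \<Rightarrow> 'm \<Rightarrow> complex^'k"
    and G :: "'i \<Rightarrow> 'm \<Rightarrow> complex^'k \<Rightarrow> complex^'k"
    and T :: "'m topology"
    and D D' :: "'m \<Rightarrow> (complex^'k) set"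
  assumes "normal_complex_contact_metric_manifold A m I N \<omega> g nabla u U G"
    and "semi_invariant_submanifold A I N g U G T n D D'"
  shows "involutive A T (dist_sum D (UV_span I N U)) \<longleftrightarrow>
    (\<forall>K\<in>sections A T (topspace T) D. \<forall>L\<in>sections A T (topspace T) D.
       \<forall>i\<in>I. \<forall>p\<in>topspace T \<inter> N i.
         second_ff A T g nabla K (\<lambda>q. G i q (L q)) p =
         second_ff A T g nabla (\<lambda>q. G i q (K q)) L p)"
proof -
  note M = assms(1) and S = assms(2)
  note loc = contact_submanifold_nbhd[OF M S]
  let ?\<Delta> = "dist_sum D (UV_span I N U)"
  have cover: "\<exists>i\<in>I. p \<in> N i" for p
  proof -
    have "complex_contact_manifold A m I N \<omega>"
      using M unfolding normal_complex_contact_metric_manifold_def complex_contact_metric_manifold_def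
      by (elim conjE)
    then have "(\<Union>i\<in>I. N i) = UNIV"
      unfolding complex_contact_manifold_def by (elim conjE)
    then show ?thesis by blast
  qed
  have \<Delta>: "?\<Delta> p = dist_sum D (\<lambda>q. span {U i q, V_of (U i) q}) p" if "i \<in> I" "p \<in> N i" for i p
    using UV_span_nbhd[OF M that] by (simp add: dist_sum_def)
  have ext: "local_extension A T p K (some_extension A T p K)"
    if "K \<in> sections A T (topspace T) X" "p \<in> topspace T" for K X p
    using that unfolding sections_def some_extension_def by (auto intro!: someI_ex[of "local_extension A T p K"])
  show ?thesis
  proof
    assume inv: "involutive A T ?\<Delta>"
    show "\<forall>K\<in>sections A T (topspace T) D. \<forall>L\<in>sections A T (topspace T) D.
       \<forall>i\<in>I. \<forall>p\<in>topspace T \<inter> N i.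
         second_ff A T g nabla K (\<lambda>q. G i q (L q)) p =
         second_ff A T g nabla (\<lambda>q. G i q (K q)) L p"
    proof (intro ballI)
      fix K L i p
      assume KL: "K \<in> sections A T (topspace T) D" "L \<in> sections A T (topspace T) D"
        and i: "i \<in> I" and "p \<in> topspace T \<inter> N i"
      then have p: "p \<in> topspace T" "p \<in> N i" by auto
      interpret contact_submanifold A g nabla "N i" "u i" "U i" "G i" T "n + 2" D D'
        by (rule loc[OF i])
      have "X \<in> sections A T (topspace T) ?\<Delta>" if X: "X \<in> sections A T (topspace T) D" for X
      proof -
        have "0 \<in> UV_span I N U q" for q by (simp add: UV_span_def span_zero)
        then have "D q \<subseteq> ?\<Delta> q" for q unfolding dist_sum_def by force
        then show ?thesis using X unfolding sections_def by blast
      qed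
      then have br: "lie_bracket A (some_extension A T p K) (some_extension A T p L) p \<in> dist_sum D sp p"
        using inv KL p \<Delta>[OF i p(2)] unfolding involutive_def bracket_on_def by blast
      obtain W P where ad: "adapted W P p" "smooth_vf A W (some_extension A T p K)"
          "smooth_vf A W (some_extension A T p L)"
        and eq': "\<forall>q\<in>P. some_extension A T p K q = K q \<and> some_extension A T p L q = L q"
        using extension_adapted[OF p ext[OF KL(1) p(1)] ext[OF KL(2) p(1)]] by blast
      have eq: "some_extension A T p K q = K q" "some_extension A T p L q = L q" if "q \<in> P" for q
        using eq' that by auto
      have "K q \<in> D q" "L q \<in> D q" if "q \<in> P" for q
        using KL adaptedD(11)[OF ad(1) that] by (auto simp: sections_def)
      then show "second_ff A T g nabla K (\<lambda>q. G i q (L q)) p =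
          second_ff A T g nabla (\<lambda>q. G i q (K q)) L p"
        using second_ff_eq_iff[OF ad _ _ eq] eq br by simp
    qed
  next
    assume h: "\<forall>K\<in>sections A T (topspace T) D. \<forall>L\<in>sections A T (topspace T) D.
       \<forall>i\<in>I. \<forall>p\<in>topspace T \<inter> N i.
         second_ff A T g nabla K (\<lambda>q. G i q (L q)) p =
         second_ff A T g nabla (\<lambda>q. G i q (K q)) L p"
    \<comment> \<open>The hypothesis concerns sections over all of M, so the
      \<open>D\<close>-component has to be defined without reference to a neighbourhood. It is
      chosen pointwise, and its smoothness is recovered from the local formula
      \<open>hor\<close>.\<close>
    define pr where "pr K q = (SOME x. x \<in> D q \<and> K q - x \<in> UV_span I N U q)" for K :: "'m \<Rightarrow> complex^'k" and q
    have pr: "pr K q \<in> D q \<and> K q - pr K q \<in> UV_span I N U q" if "K q \<in> ?\<Delta> q" for K q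
    proof -
      have "\<exists>x. x \<in> D q \<and> K q - x \<in> UV_span I N U q"
        using that by (force simp: dist_sum_def)
      then show ?thesis unfolding pr_def by (rule someI_ex)
    qed
    have local_pr: "\<exists>W P. contact_submanifold.adapted (N i) T W P p \<and>
          smooth_vf A W (some_extension A T p K) \<and> smooth_vf A W (some_extension A T p L) \<and>
          (\<forall>q\<in>P. contact_structure.hor (u i) (U i) (some_extension A T p K) q = pr K q \<and>
                 contact_structure.hor (u i) (U i) (some_extension A T p L) q = pr L q)"
      if KL: "K \<in> sections A T (topspace T) ?\<Delta>" "L \<in> sections A T (topspace T) ?\<Delta>"
        and i: "i \<in> I" and p: "p \<in> topspace T" "p \<in> N i" for K L i p
    proof -
      interpret contact_submanifold A g nabla "N i" "u i" "U i" "G i" T "n + 2" D D'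
        by (rule loc[OF i])
      obtain W P where ad: "adapted W P p" "smooth_vf A W (some_extension A T p K)"
          "smooth_vf A W (some_extension A T p L)"
        and eq': "\<forall>q\<in>P. some_extension A T p K q = K q \<and> some_extension A T p L q = L q"
        using extension_adapted[OF p ext[OF KL(1) p(1)] ext[OF KL(2) p(1)]] by blast
      have eq: "some_extension A T p K q = K q" "some_extension A T p L q = L q" if "q \<in> P" for q
        using eq' that by auto
      have "hor Y q = pr X q" if X: "X \<in> sections A T (topspace T) ?\<Delta>" and q: "q \<in> P" "Y q = X q" for X Y q
      proof -
        note a = adaptedD(11,10)[OF ad(1) q(1)]
        have "pr X q \<in> D q \<and> X q - pr X q \<in> sp q"
          using pr[of X q] X a UV_span_nbhd[OF M i a(2)] by (simp add: sections_def)
        then have "pr X q = X q - u i q (X q) *\<^sub>R U i q - v q (X q) *\<^sub>R V q"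
          using dist_sum_sp_projection[OF a] by blast
        then show ?thesis by (simp add: hor_def q(2))
      qed
      then show ?thesis using ad eq KL by blast
    qed
    have prs: "pr K \<in> sections A T (topspace T) D" if K: "K \<in> sections A T (topspace T) ?\<Delta>" for K
      unfolding sections_def
    proof (intro CollectI ballI conjI)
      fix p assume p: "p \<in> topspace T"
      show "pr K p \<in> D p" using pr K p by (auto simp: sections_def)
      obtain i where i: "i \<in> I" "p \<in> N i" using cover by blast
      interpret contact_submanifold A g nabla "N i" "u i" "U i" "G i" T "n + 2" D D'
        by (rule loc[OF i(1)])
      obtain W P where W: "adapted W P p" "smooth_vf A W (some_extension A T p K)"
        "\<And>q. q \<in> P \<Longrightarrow> hor (some_extension A T p K) q = pr K q"
        using local_pr[OF K K i(1) p i(2)] by blast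
      note a = adaptedD[OF W(1)]
      have "local_extension A T p (pr K) (hor (some_extension A T p K))"
        unfolding local_extension_def using a(1,3-5) smooth_hor[OF a(1,2) W(2)] W(3) by blast
      then show "\<exists>Y. local_extension A T p (pr K) Y" by blast
    qed
    show "involutive A T ?\<Delta>"
      unfolding involutive_def bracket_on_def
    proof (intro ballI)
      fix K L p
      assume KL: "K \<in> sections A T (topspace T) ?\<Delta>" "L \<in> sections A T (topspace T) ?\<Delta>"
        and p: "p \<in> topspace T"
      obtain i where i: "i \<in> I" "p \<in> N i" using cover by blast
      interpret contact_submanifold A g nabla "N i" "u i" "U i" "G i" T "n + 2" D D'
        by (rule loc[OF i(1)])
      let ?K = "some_extension A T p K" and ?L = "some_extension A T p L"
      obtain W P where W: "adapted W P p" "smooth_vf A W ?K" "smooth_vf A W ?L"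
        and eq: "\<And>q. q \<in> P \<Longrightarrow> hor ?K q = pr K q" "\<And>q. q \<in> P \<Longrightarrow> hor ?L q = pr L q"
        using local_pr[OF KL i(1) p i(2)] by blast
      note a = adaptedD[OF W(1)]
      have hD: "hor ?K q \<in> D q" "hor ?L q \<in> D q" if "q \<in> P" for q
        using prs[OF KL(1)] prs[OF KL(2)] a(11)[OF that] eq[OF that] by (auto simp: sections_def)
      have sm: "smooth_vf A W (hor ?K)" "smooth_vf A W (hor ?L)"
        using smooth_hor[OF a(1,2)] W(2,3) by auto
      \<comment> \<open>The horizontal parts of the extensions are themselves extensions of the
        global sections \<open>pr K\<close> and \<open>pr L\<close> of \<open>D\<close>, so the
        hypothesis applies to them.\<close>
      have "lie_bracket A (hor ?K) (hor ?L) p \<in> dist_sum D sp p"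
        using second_ff_eq_iff[OF W(1) sm hD eq] h prs KL i p by blast
      moreover have "lie_bracket A (hor ?K) (hor ?L) p \<in> tangent_space A T p"
        by (rule bracket_tangent[OF W(1) sm]) (use hD tangent_members(3) a(10,11) in blast)+
      ultimately have h0: "\<forall>z\<in>D' p. g p (lie_bracket A ?K ?L p) z = 0"
        using bracket_hor[OF W hD] dist_sum_sp_iff[OF p i(2)] by simp
      \<comment> \<open>Along M an extension is the sum of its horizontal part, which lies in
        \<open>D\<close>, and a vertical part; the \<open>D'\<close>-part is 0.\<close>
      have tan: "?K q \<in> tangent_space A T q" "?L q \<in> tangent_space A T q" if "q \<in> P" for q
      proof -
        have "X q \<in> tangent_space A T q" if "hor X q \<in> D q" for X
          using tangentI[OF a(11,10)[OF \<open>q \<in> P\<close>] that subspace_0[OF subspace_D'[OF a(11,10)[OF \<open>q \<in> P\<close>]]],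
            of "u i q (X q)" "v q (X q)"] by (simp add: hor_def)
        then show "?K q \<in> tangent_space A T q" "?L q \<in> tangent_space A T q" using hD[OF that] by auto
      qed
      show "lie_bracket A ?K ?L p \<in> ?\<Delta> p"
        unfolding \<Delta>[OF i] using h0 dist_sum_sp_iff[OF p i(2) bracket_tangent[OF W tan]] by blast
    qed
  qed
qed

end
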